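(* (a) For every integer $n\ge 1$, the Stirling complex $\operatorname{St}(n)$ is homotopy equivalent to a CW complex consisting of one distinguished $0$-cell together with other cells, each of which has dimension $d$ with $\lceil n/2\rceil-1\le d\le n-2$. (That is, apart from the distinguished $0$-cell there are no cells of dimension less than $\lceil n/2\rceil-1$ and none of dimension $\geq n-1$.) (b) For every integer $n\ge 1$, the Stirling complex $\operatorname{St}(2n)$ is homotopy equivalent to a wedge of $n!$ spheres of dimension $n-1$ with a space $X$, where $X$ is $(n-1)$-connected.
   Context: For a positive integer $m$, the Stirling complex $\operatorname{St}(m)$ is the simplicial complex whose vertices are the squares $(i,j)$ with $1\le i\le j\le m$ ($i$ is the column, $j$ the row) and whose faces are the non-attacking rook placements, i.e. the sets of squares no two of which lie in the same row or in the same column. *)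

theory Defs
  imports "HOL-Analysis.Analysis"
begin

definition stirling_squares :: "nat \<Rightarrow> (nat \<times> nat) set" where
  "stirling_squares m = {(i, j). 1 \<le> i \<and> i \<le> j \<and> j \<le> m}"

(* The faces include the empty placement. *)
definition stirling_complex :: "nat \<Rightarrow> (nat \<times> nat) set set" where
  "stirling_complex m =
     {F. F \<subseteq> stirling_squares m \<and>
         (\<forall>p\<in>F. \<forall>q\<in>F. p \<noteq> q \<longrightarrow> fst p \<noteq> fst q \<and> snd p \<noteq> snd q)}"

(* Barycentric coordinates with the product topology. This is the usual (weak) topology when
   the complex has finitely many vertices, the only case in which it is used here. *)
definition geometric_realization :: "'v set set \<Rightarrow> ('v \<Rightarrow> real) topology" where
  "geometric_realization K =
     subtopology (powertop_real UNIV)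
       {x. (\<forall>v. 0 \<le> x v) \<and> finite {v. x v \<noteq> 0} \<and> {v. x v \<noteq> 0} \<in> K \<and>
           (\<Sum>v | x v \<noteq> 0. x v) = 1}"

(* The closed unit disk, its interior and its boundary, inside Euclidean_space n.
   For n = 0 the disk and its interior are a point, and the boundary is empty. *)
definition disk :: "nat \<Rightarrow> (nat \<Rightarrow> real) topology" where
  "disk n = subtopology (Euclidean_space n) {x. (\<Sum>i<n. x i ^ 2) \<le> 1}"

definition disk_interior :: "nat \<Rightarrow> (nat \<Rightarrow> real) set" where
  "disk_interior n = {x \<in> topspace (Euclidean_space n). (\<Sum>i<n. x i ^ 2) < 1}"

definition disk_boundary :: "nat \<Rightarrow> (nat \<Rightarrow> real) set" where
  "disk_boundary n = {x \<in> topspace (Euclidean_space n). (\<Sum>i<n. x i ^ 2) = 1}"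

(* The set E consists of the open cells, and dm gives their dimensions. The last two clauses
   are the existence of characteristic maps (with closure-finiteness) and the weak topology. *)
definition cw_complex :: "'a topology \<Rightarrow> 'a set set \<Rightarrow> ('a set \<Rightarrow> nat) \<Rightarrow> bool" where
  "cw_complex X E dm \<longleftrightarrow>
     Hausdorff_space X \<and> \<Union>E = topspace X \<and> disjoint E \<and>
     (\<forall>e\<in>E. \<exists>\<Phi>. continuous_map (disk (dm e)) X \<Phi> \<and>
        homeomorphic_map (subtopology (disk (dm e)) (disk_interior (dm e))) (subtopology X e) \<Phi> \<and>
        (\<exists>F \<subseteq> {e' \<in> E. dm e' < dm e}. finite F \<and> \<Phi> ` disk_boundary (dm e) \<subseteq> \<Union>F)) \<and>
     (\<forall>C \<subseteq> topspace X. closedin X C \<longleftrightarrow> (\<forall>e\<in>E. closedin X (C \<inter> X closure_of e)))"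

definition nsphere_base :: "nat \<Rightarrow> real" where
  "nsphere_base = (\<lambda>i. if i = 0 then 1 else 0)"

(* An element of the i-th homotopy group is represented by a pointed map from the i-sphere;
   the group is trivial iff each such map is homotopic to the constant map relative to the
   base point. *)
definition trivial_homotopy_group :: "nat \<Rightarrow> 'a topology \<Rightarrow> 'a \<Rightarrow> bool" where
  "trivial_homotopy_group i X x0 \<longleftrightarrow>
     (\<forall>f. continuous_map (nsphere i) X f \<and> f nsphere_base = x0 \<longrightarrow>
        homotopic_with (\<lambda>g. g nsphere_base = x0) (nsphere i) X f (\<lambda>_. x0))"

definition k_connected_space :: "nat \<Rightarrow> 'a topology \<Rightarrow> bool" where
  "k_connected_space k X \<longleftrightarrow>
     topspace X \<noteq> {} \<and> path_connected_space X \<and>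
     (\<forall>i\<in>{1..k}. \<forall>x0\<in>topspace X. trivial_homotopy_group i X x0)"

definition quotient_topology :: "'a topology \<Rightarrow> ('a \<Rightarrow> 'b) \<Rightarrow> 'b topology" where
  "quotient_topology X f =
     topology (\<lambda>U. U \<subseteq> f ` topspace X \<and> openin X {x \<in> topspace X. f x \<in> U})"

lemma openin_quotient_topology:
  "openin (quotient_topology X f) U \<longleftrightarrow>
     U \<subseteq> f ` topspace X \<and> openin X {x \<in> topspace X. f x \<in> U}"
proof -
  have 1: "{x \<in> topspace X. f x \<in> S \<inter> T} =
      {x \<in> topspace X. f x \<in> S} \<inter> {x \<in> topspace X. f x \<in> T}" for S T
    by auto
  have 2: "{x \<in> topspace X. f x \<in> \<Union>\<K>} = (\<Union>K\<in>\<K>. {x \<in> topspace X. f x \<in> K})" for \<K>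
    by auto
  have "istopology (\<lambda>U. U \<subseteq> f ` topspace X \<and> openin X {x \<in> topspace X. f x \<in> U})"
    unfolding istopology_def 1 2 by blast
  then show ?thesis
    by (simp add: quotient_topology_def)
qed

lemma quotient_map_quotient_topology: "quotient_map X (quotient_topology X f) f"
proof -
  have "{x \<in> topspace X. f x \<in> f ` topspace X} = topspace X"
    by auto
  then have "openin (quotient_topology X f) (f ` topspace X)"
    by (simp add: openin_quotient_topology)
  then have "topspace (quotient_topology X f) = f ` topspace X"
    by (metis openin_quotient_topology openin_subset openin_topspace subset_antisym)
  then show ?thesis
    by (auto simp: quotient_map_def openin_quotient_topology)
qed

(* The disjoint union of the X i (i in I) with the base points b i collapsed to one point:
   the points of the wedge are the set B of all base points and the remaining singletons. *)
definition wedge_sum :: "('i \<Rightarrow> 'a topology) \<Rightarrow> ('i \<Rightarrow> 'a) \<Rightarrow> 'i set \<Rightarrow> ('i \<times> 'a) set topology" where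
  "wedge_sum X b I =
     (let B = (\<lambda>i. (i, b i)) ` I
      in quotient_topology (sum_topology X I) (\<lambda>p. if p \<in> B then B else {p}))"

(* The wedge of k spheres of dimension d, indexed by 0, ..., k - 1, with the pointed space (X, x0),
   which has index k. *)
definition wedge_of_spheres_with ::
    "nat \<Rightarrow> nat \<Rightarrow> (nat \<Rightarrow> real) topology \<Rightarrow> (nat \<Rightarrow> real) \<Rightarrow> (nat \<times> (nat \<Rightarrow> real)) set topology" where
  "wedge_of_spheres_with k d X x0 =
     wedge_sum (\<lambda>i. if i < k then nsphere d else X) (\<lambda>i. if i < k then nsphere_base else x0) {..k}"

end

(* Write K for St(m). Toggling the diagonal square (r, r) with the least possible r is an acyclic
   matching on the faces of K; its critical placements cover every index as a row or a column, so
   they have at least m/2 rooks. Hence the placements with at most k < m/2 rooks, their partners and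
   the faces of the full diagonal (the only placement with m rooks) form a collapsible subcomplex A,
   and K is homotopy equivalent to K/A, whose cells other than the base point are the faces of K
   outside A. This is (a).

   For m = 2n and k = n, the critical placements with n rooks are perfect matchings. The n! of them
   that lie in the square with columns 1..n and rows n+1..2n are facets of K. The others are matched
   with placements of n+1 rooks, which again gives a collapsible subcomplex A. It contains the
   boundaries of the n! facets, so K/A is the wedge of n! spheres of dimension n-1 with L/A, where L
   is K without these facets. All faces of L with at most n vertices lie in A; since a map from a
   sphere of dimension i into a complex is homotopic to a map into its i-skeleton, L and therefore
   L/A are (n-1)-connected. *)

theory Submission
  imports Defs "HOL-Combinatorics.Permutations"
begin

section \<open>Geometric realizations and elementary collapses\<close>

text \<open>The theorem bounds dimensions and asks for no minimal complex, so discrete Morse theory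
  with its re-attached cells can be avoided: matchings are used only inside the subcomplex
  \<open>A\<close>, where they are complete and therefore yield contractibility. Acyclicity of the
  toggling is the monotonicity of \<open>diag_key\<close>: removing rooks only makes more indices
  available, so the least one cannot grow. The faces of the full diagonal may be added without
  spoiling this, since all of them have key 1 and so are matched among themselves. The spaces asked
  for live on \<open>nat \<Rightarrow> real\<close>; hence K/A is not formed abstractly but as the
  image of an explicit map, and compactness makes the maps involved quotient maps. For connectivity,
  simplicial approximation is replaced by a nerve map: a partition of unity on the boundary of a
  cube, with fine supports of which at most i + 1 meet in any point, sends each point into a simplex
  with at most i + 1 vertices.\<close>

definition finite_complex :: "'v set set \<Rightarrow> bool" where
  "finite_complex K \<longleftrightarrow> finite K \<and> (\<forall>\<sigma>\<in>K. finite \<sigma> \<and> Pow \<sigma> \<subseteq> K)"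

definition realization :: "'v set set \<Rightarrow> ('v \<Rightarrow> real) set" where
  "realization K = {x. (\<forall>v. 0 \<le> x v) \<and> finite {v. x v \<noteq> 0} \<and> {v. x v \<noteq> 0} \<in> K \<and>
                      (\<Sum>v | x v \<noteq> 0. x v) = 1}"

text \<open>For the empty face, and for an infinite set, the sum is 0 and the closed simplex is
  empty. So the empty face, which belongs to every nonempty complex, contributes no point.\<close>

definition closed_simplex :: "'v set \<Rightarrow> ('v \<Rightarrow> real) set" where
  "closed_simplex \<sigma> = {x. (\<forall>v. 0 \<le> x v) \<and> (\<forall>v. v \<notin> \<sigma> \<longrightarrow> x v = 0) \<and> sum x \<sigma> = 1}"

lemma geometric_realization_eq: "geometric_realization K = top_of_set (realization K)"
  by (simp add: geometric_realization_def realization_def euclidean_product_topology)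

lemma finite_complexD:
  assumes "finite_complex K"
  shows "finite K" "\<sigma> \<in> K \<Longrightarrow> finite \<sigma>" "\<sigma> \<in> K \<Longrightarrow> \<rho> \<subseteq> \<sigma> \<Longrightarrow> \<rho> \<in> K"
  using assms by (auto simp: finite_complex_def)

lemma closed_simplex_pos:
  assumes "x \<in> closed_simplex \<sigma>"
  shows "\<exists>v\<in>\<sigma>. 0 < x v"
proof (rule ccontr)
  assume "\<not> ?thesis"
  then have "sum x \<sigma> \<le> 0" by (intro sum_nonpos) (auto simp: not_less)
  then show False using assms by (auto simp: closed_simplex_def)
qed

lemma closed_simplex_support:
  assumes "finite \<sigma>" "x \<in> closed_simplex \<sigma>"
  shows "{v. x v \<noteq> 0} \<subseteq> \<sigma>" "(\<Sum>v | x v \<noteq> 0. x v) = 1" "x \<in> closed_simplex {v. x v \<noteq> 0}"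
proof -
  show 1: "{v. x v \<noteq> 0} \<subseteq> \<sigma>" using assms by (auto simp: closed_simplex_def)
  have "(\<Sum>v | x v \<noteq> 0. x v) = sum x \<sigma>"
    using assms 1 by (intro sum.mono_neutral_left) auto
  then show "(\<Sum>v | x v \<noteq> 0. x v) = 1" using assms by (simp add: closed_simplex_def)
  then show "x \<in> closed_simplex {v. x v \<noteq> 0}" using assms by (simp add: closed_simplex_def)
qed

lemma realization_iff:
  assumes "finite_complex K"
  shows "x \<in> realization K \<longleftrightarrow> (\<exists>\<sigma>\<in>K. x \<in> closed_simplex \<sigma>)"
proof
  assume "x \<in> realization K"
  then show "\<exists>\<sigma>\<in>K. x \<in> closed_simplex \<sigma>"
    by (intro bexI[of _ "{v. x v \<noteq> 0}"]) (auto simp: realization_def closed_simplex_def)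
next
  assume "\<exists>\<sigma>\<in>K. x \<in> closed_simplex \<sigma>"
  then obtain \<sigma> where s: "\<sigma> \<in> K" "x \<in> closed_simplex \<sigma>" by blast
  have "finite \<sigma>" using s finite_complexD(2)[OF assms] by blast
  note supp = closed_simplex_support[OF this s(2)]
  have "{v. x v \<noteq> 0} \<in> K" using finite_complexD(3)[OF assms s(1) supp(1)] .
  moreover have "\<forall>v. 0 \<le> x v" using s(2) by (simp add: closed_simplex_def)
  ultimately show "x \<in> realization K"
    using supp finite_subset[OF supp(1) \<open>finite \<sigma>\<close>] by (simp add: realization_def)
qed

lemma realization_eq_UN:
  assumes "finite_complex K"
  shows "realization K = (\<Union>\<sigma>\<in>K. closed_simplex \<sigma>)"
  using realization_iff[OF assms] by auto

lemma realization_mem_support: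
  assumes "x \<in> realization K"
  shows "{v. x v \<noteq> 0} \<in> K" "finite {v. x v \<noteq> 0}" "x \<in> closed_simplex {v. x v \<noteq> 0}" "0 \<le> x v"
  using assms by (auto simp: realization_def closed_simplex_def)

lemma realization_imp_closed_simplex:
  assumes "x \<in> realization K" "finite \<sigma>" "\<And>v. v \<notin> \<sigma> \<Longrightarrow> x v = 0"
  shows "x \<in> closed_simplex \<sigma>"
proof -
  have "(\<Sum>v | x v \<noteq> 0. x v) = sum x \<sigma>"
    using assms(2,3) by (intro sum.mono_neutral_left) auto
  then have "sum x \<sigma> = 1"
    using assms(1) by (simp add: realization_def)
  then show ?thesis
    using assms(3) realization_mem_support(4)[OF assms(1)] by (simp add: closed_simplex_def)
qed

lemma closed_simplex_sub_realization:
  assumes "finite_complex K" "\<sigma> \<in> K"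
  shows "closed_simplex \<sigma> \<subseteq> realization K"
  using assms by (auto simp: realization_iff)

lemma realization_mono: "K \<subseteq> L \<Longrightarrow> realization K \<subseteq> realization L"
  by (auto simp: realization_def)

lemma realization_le_1:
  assumes "x \<in> realization K" shows "x v \<le> 1"
proof (cases "x v = 0")
  case False
  have "x v \<le> (\<Sum>v | x v \<noteq> 0. x v)"
    using False assms by (intro member_le_sum) (auto simp: realization_def)
  then show ?thesis using assms by (simp add: realization_def)
qed simp

lemma continuous_on_eval: "continuous_on S (\<lambda>x. x v)"
  for v :: 'i and S :: "('i \<Rightarrow> 'a::topological_space) set"
  by (rule continuous_on_subset[OF continuous_on_product_coordinates]) simp

lemma closed_closed_simplex: "closed (closed_simplex \<sigma>)"
proof -
  have "closed_simplex \<sigma> = (\<Inter>v. {x. 0 \<le> x v}) \<inter> (\<Inter>v\<in>-\<sigma>. {x. x v = 0}) \<inter> {x. sum x \<sigma> = 1}"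
    by (auto simp: closed_simplex_def)
  also have "closed \<dots>"
    by (intro closed_Int closed_INT ballI closed_Collect_le closed_Collect_eq continuous_intros
        continuous_on_eval)
  finally show ?thesis .
qed

text \<open>Tychonoff's theorem: the box is a full product of intervals. Points are functions on all
  vertices, so compactness is obtained in this infinite product and inherited by closed
  subsets.\<close>

lemma compact_box:
  "compact {x :: 'i \<Rightarrow> real. \<forall>v. \<bar>x v\<bar> \<le> B}"
proof -
  have *: "{x :: 'i \<Rightarrow> real. \<forall>v. \<bar>x v\<bar> \<le> B} = PiE UNIV (\<lambda>_. {-B..B})"
    by (auto simp: PiE_def Pi_def abs_le_iff) (metis neg_le_iff_le add.inverse_inverse)+
  have "compactin (product_topology (\<lambda>i. euclidean) UNIV) (PiE (UNIV::'i set) (\<lambda>_. {-B..B}))"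
    by (subst compactin_PiE) auto
  then show ?thesis
    unfolding * by (simp add: euclidean_product_topology)
qed

lemma compact_closed_simplex:
  assumes "finite \<sigma>" shows "compact (closed_simplex \<sigma>)"
proof -
  have "x v \<le> 1" "0 \<le> x v" if "x \<in> closed_simplex \<sigma>" for x v
  proof -
    have "x \<in> realization (Pow \<sigma>)"
      using that assms by (subst realization_iff) (auto simp: finite_complex_def intro: finite_subset)
    then show "x v \<le> 1" "0 \<le> x v" by (rule realization_le_1 realization_mem_support(4))+
  qed
  then have "closed_simplex \<sigma> \<subseteq> {x. \<forall>v. \<bar>x v\<bar> \<le> 1}"
    by auto
  then have "closed_simplex \<sigma> = {x. \<forall>v. \<bar>x v\<bar> \<le> 1} \<inter> closed_simplex \<sigma>"
    by blast
  then show ?thesis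
    using compact_Int_closed[OF compact_box closed_closed_simplex] by metis
qed

lemma compact_realization:
  assumes "finite_complex K" shows "compact (realization K)"
  unfolding realization_eq_UN[OF assms]
  using finite_complexD[OF assms] by (intro compact_UN compact_closed_simplex) auto

lemma closed_realization:
  assumes "finite_complex K" shows "closed (realization K)"
  unfolding realization_eq_UN[OF assms]
  using finite_complexD[OF assms] by (intro closed_UN ballI closed_closed_simplex) auto

lemma closed_simplex_segment:
  assumes "x \<in> closed_simplex \<sigma>" "y \<in> closed_simplex \<sigma>" "0 \<le> t" "t \<le> 1"
  shows "(\<lambda>v. (1 - t) * x v + t * y v) \<in> closed_simplex \<sigma>"
  using assms by (auto simp: closed_simplex_def sum.distrib simp flip: sum_distrib_left)

lemma continuous_on_Min:
  fixes f :: "'i \<Rightarrow> 'a::topological_space \<Rightarrow> real"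
  assumes "finite I" "I \<noteq> {}" "\<And>i. i \<in> I \<Longrightarrow> continuous_on S (f i)"
  shows "continuous_on S (\<lambda>x. Min ((\<lambda>i. f i x) ` I))"
  using assms
proof (induction I rule: finite_ne_induct)
  case (insert i I)
  then have "(\<lambda>x. Min ((\<lambda>i. f i x) ` insert i I)) = (\<lambda>x. min (f i x) (Min ((\<lambda>i. f i x) ` I)))"
    by (auto simp: fun_eq_iff)
  with insert show ?case by (auto intro!: continuous_intros)
qed simp

lemma homotopic_with_top_of_set:
  assumes "continuous_on ({0..1::real} \<times> S) h" "h \<in> ({0..1} \<times> S) \<rightarrow> T"
    "\<And>x. x \<in> S \<Longrightarrow> h (0, x) = f x" "\<And>x. x \<in> S \<Longrightarrow> h (1, x) = g x"
  shows "homotopic_with (\<lambda>_. True) (top_of_set S) (top_of_set T) f g"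
proof (subst homotopic_with)
  show "\<exists>h. continuous_map (prod_topology (top_of_set {0..1::real}) (top_of_set S)) (top_of_set T) h \<and>
      (\<forall>x\<in>topspace (top_of_set S). h (0, x) = f x) \<and> (\<forall>x\<in>topspace (top_of_set S). h (1, x) = g x) \<and>
      (\<forall>t\<in>{0..1::real}. True)"
    using assms by (intro exI[of _ h]) auto
qed simp

text \<open>A segment with both ends in one closed simplex stays in it, so the straight-line
  homotopy never leaves the complex. Both the elementary collapse and the approximation into a
  skeleton use this.\<close>

lemma homotopic_with_realization_linear:
  assumes K: "finite_complex K"
    and f: "continuous_on S f" and g: "continuous_on S g"
    and fg: "\<And>x. x \<in> S \<Longrightarrow> \<exists>\<sigma>\<in>K. f x \<in> closed_simplex \<sigma> \<and> g x \<in> closed_simplex \<sigma>"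
  shows "homotopic_with (\<lambda>_. True) (top_of_set S) (top_of_set (realization K)) f g"
proof (rule homotopic_with_top_of_set)
  let ?h = "\<lambda>(t, x) v. (1 - t) * f x v + t * g x v"
  have *: "continuous_on ({0..1::real} \<times> S) (\<lambda>p. f (snd p))" "continuous_on ({0..1::real} \<times> S) (\<lambda>p. g (snd p))"
    by (rule continuous_on_compose2[OF f continuous_on_snd[OF continuous_on_id]] 
        continuous_on_compose2[OF g continuous_on_snd[OF continuous_on_id]]; force)+
  show "continuous_on ({0..1} \<times> S) ?h"
    unfolding case_prod_beta
    by (intro continuous_on_coordinatewise_then_product continuous_intros
        continuous_on_product_then_coordinatewise[OF *(1)] continuous_on_product_then_coordinatewise[OF *(2)])
  show "?h \<in> ({0..1} \<times> S) \<rightarrow> realization K"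
    using fg closed_simplex_segment K by (fastforce simp: realization_iff)
qed auto

text \<open>Within \<open>K\<close>, the set \<open>D\<close> consists exactly of the faces that
  contain \<open>\<sigma>\<close>. It is upward closed, so what remains is closed under taking
  subsets.\<close>

lemma finite_complex_remove:
  assumes "finite_complex K" "\<And>\<rho>. \<rho> \<in> K \<Longrightarrow> \<sigma> \<subseteq> \<rho> \<Longrightarrow> \<rho> \<in> D" "\<And>\<rho>. \<rho> \<in> D \<Longrightarrow> \<sigma> \<subseteq> \<rho>"
  shows "finite_complex (K - D)"
  unfolding finite_complex_def
proof (intro conjI ballI subsetI)
  show "finite (K - D)" using finite_complexD[OF assms(1)] by simp
  fix \<rho> assume \<rho>: "\<rho> \<in> K - D"
  then show "finite \<rho>" using finite_complexD[OF assms(1)] by simp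
  fix \<mu> assume "\<mu> \<in> Pow \<rho>"
  then show "\<mu> \<in> K - D"
    using \<rho> finite_complexD(3)[OF assms(1), of \<rho> \<mu>] assms(2)[of \<rho>] assms(3)[of \<mu>] by auto
qed

text \<open>The retraction moves mass from all vertices of the free face to the apex, at equal rates,
  until one vertex of the free face has weight 0.\<close>

lemma realization_elementary_collapse:
  assumes K: "finite_complex K" and \<sigma>: "\<sigma> \<noteq> {}" "v \<notin> \<sigma>" "insert v \<sigma> \<in> K"
    and free: "\<And>\<rho>. \<rho> \<in> K \<Longrightarrow> \<sigma> \<subseteq> \<rho> \<Longrightarrow> \<rho> = \<sigma> \<or> \<rho> = insert v \<sigma>"
  shows "geometric_realization K homotopy_equivalent_space
         geometric_realization (K - {\<sigma>, insert v \<sigma>})"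
proof -
  let ?\<tau> = "insert v \<sigma>" and ?L = "K - {\<sigma>, insert v \<sigma>}"
  have fin: "finite \<sigma>" using finite_complexD(2)[OF K \<sigma>(3)] by simp
  have L: "finite_complex ?L"
    by (rule finite_complex_remove[OF K, of \<sigma>]) (use free in auto)
  define m where "m x = Min (x ` \<sigma>)" for x :: "'a \<Rightarrow> real"
  define r where "r x = (\<lambda>u. x u - (if u \<in> \<sigma> then m x else 0) + (if u = v then card \<sigma> * m x else 0))"
    for x :: "'a \<Rightarrow> real"
  have m_le: "m x \<le> x u" if "u \<in> \<sigma>" for x u
    using that fin by (simp add: m_def)
  have m_nn: "0 \<le> m x" if "x \<in> realization K" for x
    using that fin \<sigma>(1) by (auto simp: m_def realization_mem_support)
  have cm: "continuous_on (realization K) m"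
    unfolding m_def using fin \<sigma>(1)
    by (intro continuous_on_Min[where f = "\<lambda>i x. x i"] continuous_on_eval) auto
  have cr: "continuous_on (realization K) r"
  proof (rule continuous_on_coordinatewise_then_product)
    fix u
    have "continuous_on (realization K) (\<lambda>x. if u \<in> \<sigma> then m x else 0)"
      by (cases "u \<in> \<sigma>") (simp_all add: cm)
    moreover have "continuous_on (realization K) (\<lambda>x. if u = v then card \<sigma> * m x else 0)"
      by (cases "u = v") (simp_all add: cm continuous_on_mult_left)
    ultimately show "continuous_on (realization K) (\<lambda>x. r x u)"
      unfolding r_def by (intro continuous_on_add continuous_on_diff continuous_on_eval)
  qed
  have m0: "m x = 0" if "x \<in> realization ?L" for x
  proof (rule ccontr)
    assume "m x \<noteq> 0"
    then have "0 < m x" using m_nn[of x] that realization_mono[of ?L K] by fastforce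
    then have "\<sigma> \<subseteq> {v. x v \<noteq> 0}" using m_le[of _ x] by force
    then show False
      using that free[of "{v. x v \<noteq> 0}"] by (auto simp: realization_def)
  qed
  have rid: "r x = x" if "m x = 0" for x
    using that by (auto simp: r_def)
  have key: "\<exists>\<rho>\<in>K. r x \<in> closed_simplex \<rho> \<and> x \<in> closed_simplex \<rho>" "r x \<in> realization ?L"
    if x: "x \<in> realization K" for x
  proof -
    have "(\<exists>\<rho>\<in>K. r x \<in> closed_simplex \<rho> \<and> x \<in> closed_simplex \<rho>) \<and> r x \<in> realization ?L"
    proof (cases "m x = 0")
      case True
      have "\<not> \<sigma> \<subseteq> {v. x v \<noteq> 0}"
      proof
        assume *: "\<sigma> \<subseteq> {v. x v \<noteq> 0}"
        have "m x \<in> x ` \<sigma>" unfolding m_def using fin \<sigma>(1) by (intro Min_in) auto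
        with * True show False by auto
      qed
      then have "{v. x v \<noteq> 0} \<in> ?L" using x by (auto simp: realization_def)
      then have "x \<in> realization ?L"
        using x by (simp add: realization_def)
      then show ?thesis
        using x realization_mem_support[OF x] by (auto simp: rid True)
    next
      case False
      then have pos: "0 < m x" using m_nn[OF x] by simp
      then have "\<sigma> \<subseteq> {v. x v \<noteq> 0}" using m_le[of _ x] by force
      then have "{v. x v \<noteq> 0} \<subseteq> ?\<tau>"
        using free[of "{v. x v \<noteq> 0}"] x by (auto simp: realization_def)
      then have xs: "x u = 0" if "u \<notin> ?\<tau>" for u
        using that by auto
      then have xt: "x \<in> closed_simplex ?\<tau>"
        using fin xs by (intro realization_imp_closed_simplex[OF x]) auto
      have sr: "sum (r x) ?\<tau> = 1"
      proof -
        have "sum (r x) \<sigma> = (\<Sum>u\<in>\<sigma>. x u - m x)"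
          using \<sigma>(2) by (intro sum.cong) (auto simp: r_def)
        then have "sum (r x) \<sigma> = sum x \<sigma> - card \<sigma> * m x"
          by (simp add: sum_subtractf)
        then have "sum (r x) ?\<tau> = sum x ?\<tau>"
          using \<sigma>(2) fin by (simp add: r_def)
        then show ?thesis using xt by (simp add: closed_simplex_def)
      qed
      have rt: "r x \<in> closed_simplex ?\<tau>"
        unfolding closed_simplex_def
      proof (intro CollectI conjI allI impI sr)
        fix u
        show "0 \<le> r x u"
          using m_le[of u x] realization_mem_support(4)[OF x, of u] \<sigma>(2) pos by (simp add: r_def)
        show "r x u = 0" if "u \<notin> ?\<tau>"
          using that xs[of u] by (simp add: r_def)
      qed
      have "m x \<in> x ` \<sigma>" unfolding m_def using fin \<sigma>(1) by (intro Min_in) auto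
      \<comment> \<open>A vertex of minimal weight drops to 0, so the support of the image contains
        not all of \<open>\<sigma>\<close>, and the image avoids both removed faces.\<close>
      then obtain u where u: "u \<in> \<sigma>" "x u = m x" by auto
      then have "r x u = 0" using \<sigma>(2) by (auto simp: r_def)
      have "r x \<in> realization K" using rt K \<sigma>(3) by (auto simp: realization_iff)
      moreover have "{v. r x v \<noteq> 0} \<noteq> \<sigma>" "{v. r x v \<noteq> 0} \<noteq> ?\<tau>" using u \<open>r x u = 0\<close> by auto
      ultimately have "r x \<in> realization ?L" by (auto simp: realization_def)
      then show ?thesis using rt xt \<sigma>(3) by blast
    qed
    then show "\<exists>\<rho>\<in>K. r x \<in> closed_simplex \<rho> \<and> x \<in> closed_simplex \<rho>" "r x \<in> realization ?L" by blast+
  qed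
  show ?thesis
    unfolding geometric_realization_eq
  proof (rule deformation_retract_imp_homotopy_equivalent_space)
    show "homotopic_with (\<lambda>x. True) (top_of_set (realization K)) (top_of_set (realization K)) r id"
      using key by (intro homotopic_with_realization_linear[OF K cr]) (auto intro: continuous_intros)
    show "retraction_maps (top_of_set (realization K)) (top_of_set (realization ?L)) r id"
      using cr key realization_mono[of ?L K] m0 rid
      by (auto simp: retraction_maps_def continuous_map_in_subtopology)
  qed
qed

section \<open>Homotopy extension and collapsing a contractible subcomplex\<close>

text \<open>The usual retraction of the cylinder over a simplex onto its bottom and its sides, by central
  projection from the point at height 2 above the barycentre: A is the part that is projected to the
  bottom (to the point a p), B the part projected to the sides (to the point y p at height s p).\<close>

lemma facet_homotopy_extension:
  fixes F :: "('v \<Rightarrow> real) \<Rightarrow> 'z::topological_space"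
  assumes K: "finite_complex K" and \<sigma>: "\<sigma> \<in> K" "\<sigma> \<noteq> {}"
    and facet: "\<And>\<rho>. \<rho> \<in> K \<Longrightarrow> \<sigma> \<subseteq> \<rho> \<Longrightarrow> \<rho> = \<sigma>"
    and F: "continuous_on (realization K) F" "F \<in> realization K \<rightarrow> Z"
    and H: "continuous_on ({0..1::real} \<times> realization (K - {\<sigma>})) H"
      "H \<in> ({0..1} \<times> realization (K - {\<sigma>})) \<rightarrow> Z"
    and HF: "\<And>x. x \<in> realization (K - {\<sigma>}) \<Longrightarrow> H (0, x) = F x"
  shows "\<exists>G. continuous_on ({0..1::real} \<times> realization K) G \<and> G \<in> ({0..1} \<times> realization K) \<rightarrow> Z \<and>
    (\<forall>x\<in>realization K. G (0, x) = F x) \<and>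
    (\<forall>t\<in>{0..1}. \<forall>x\<in>realization (K - {\<sigma>}). G (t, x) = H (t, x))"
proof -
  let ?L = "K - {\<sigma>}"
  have L: "finite_complex ?L"
    by (rule finite_complex_remove[OF K, of \<sigma>]) (use facet in auto)
  have fin: "finite \<sigma>" using finite_complexD(2)[OF K \<sigma>(1)] .
  define c where "c = real (card \<sigma>)"
  have c: "0 < c" using fin \<sigma>(2) by (simp add: c_def card_gt_0_iff)
  define m where "m x = Min (x ` \<sigma>)" for x :: "'v \<Rightarrow> real"
  have m_le: "m x \<le> x u" if "u \<in> \<sigma>" for x u
    using that fin by (simp add: m_def)
  have m_in: "\<exists>u\<in>\<sigma>. x u = m x" for x
  proof -
    have "m x \<in> x ` \<sigma>" unfolding m_def using fin \<sigma>(2) by (intro Min_in) auto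
    then show ?thesis by auto
  qed
  have cm: "continuous_on S m" for S
    unfolding m_def using fin \<sigma>(2)
    by (intro continuous_on_Min[where f = "\<lambda>i x. x i"] continuous_on_eval) auto
  have cm': "continuous_on S (\<lambda>p. m (snd p))" for S :: "(real \<times> ('v \<Rightarrow> real)) set"
    by (rule continuous_on_compose2[OF cm continuous_on_snd[OF continuous_on_id]]) auto
  have ce: "continuous_on S (\<lambda>p. snd p v)" for S :: "(real \<times> ('v \<Rightarrow> real)) set" and v
    by (rule continuous_on_compose2[OF continuous_on_eval[of UNIV] continuous_on_snd[OF continuous_on_id]]) auto
  have m0: "0 \<le> m x" if "x \<in> closed_simplex \<sigma>" for x
    using m_in[of x] that by (auto simp: closed_simplex_def) metis
  have mc: "c * m x \<le> 1" if "x \<in> closed_simplex \<sigma>" for x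
  proof -
    have "c * m x = (\<Sum>u\<in>\<sigma>. m x)" by (simp add: c_def)
    also have "\<dots> \<le> sum x \<sigma>" by (intro sum_mono m_le)
    finally show ?thesis using that by (simp add: closed_simplex_def)
  qed
  have mL: "x \<in> realization ?L \<longleftrightarrow> m x = 0" if x: "x \<in> closed_simplex \<sigma>" for x
  proof -
    have xK: "x \<in> realization K" using closed_simplex_sub_realization[OF K \<sigma>(1)] x by blast
    then have "x \<in> realization ?L \<longleftrightarrow> {v. x v \<noteq> 0} \<noteq> \<sigma>"
      by (auto simp: realization_def)
    also have "\<dots> \<longleftrightarrow> (\<exists>u\<in>\<sigma>. x u = 0)"
      using closed_simplex_support(1)[OF fin x] by auto
    also have "\<dots> \<longleftrightarrow> m x = 0"
      using m_in[of x] m_le[of _ x] m0[OF x] by (metis order_antisym)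
    finally show ?thesis .
  qed
  \<comment> \<open>The barycentre has all coordinates 1 / c. The ray from it at height 2 through
    (t, x) has the points 1 / c + l * (x - 1 / c) at height 2 - l * (2 - t). It meets the bottom at
    l = 2 / (2 - t), which gives \<open>a\<close>, and the sides, where the least coordinate
    vanishes, at l = 1 / (1 - c * m x), which gives \<open>y\<close> and \<open>s\<close>.
    \<open>A\<close> is the region where the bottom is not met after the sides. On \<open>B\<close>
    the divisor 1 - c * m x is positive because t is at most 1.\<close>
  define a where "a p = (\<lambda>v. if v \<in> \<sigma> then 1 / c + 2 / (2 - fst p) * (snd p v - 1 / c) else 0)"
    for p :: "real \<times> ('v \<Rightarrow> real)"
  define y where "y p = (\<lambda>v. if v \<in> \<sigma> then (snd p v - m (snd p)) / (1 - c * m (snd p)) else 0)"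
    for p :: "real \<times> ('v \<Rightarrow> real)"
  define s where "s p = 2 - (2 - fst p) / (1 - c * m (snd p))" for p :: "real \<times> ('v \<Rightarrow> real)"
  define A where "A = {p \<in> {0..1} \<times> closed_simplex \<sigma>. 1 - c * m (snd p) \<le> (2 - fst p) / 2}"
  define B where "B = {p \<in> {0..1} \<times> closed_simplex \<sigma>. (2 - fst p) / 2 \<le> 1 - c * m (snd p)}"
  define C where "C = {0..1::real} \<times> realization ?L"
  have cl: "closed ({0..1::real} \<times> closed_simplex \<sigma>)"
    by (intro closed_Times closed_closed_simplex) auto
  have "closed A"
  proof -
    have "A = {0..1} \<times> closed_simplex \<sigma> \<inter> {p. 1 - c * m (snd p) \<le> (2 - fst p) / 2}"
      by (auto simp: A_def)
    then show ?thesis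
      using cl by (auto intro!: closed_Int closed_Collect_le continuous_intros cm')
  qed
  have "closed B"
  proof -
    have "B = {0..1} \<times> closed_simplex \<sigma> \<inter> {p. (2 - fst p) / 2 \<le> 1 - c * m (snd p)}"
      by (auto simp: B_def)
    then show ?thesis
      using cl by (auto intro!: closed_Int closed_Collect_le continuous_intros cm')
  qed
  have "closed C" unfolding C_def by (intro closed_Times closed_realization L) auto
  have ABC: "A \<union> B \<union> C = {0..1} \<times> realization K"
  proof -
    have "A \<union> B = {0..1} \<times> closed_simplex \<sigma>"
      by (auto simp: A_def B_def)
    moreover have "realization K = closed_simplex \<sigma> \<union> realization ?L"
      using \<sigma>(1) by (auto simp: realization_eq_UN[OF K] realization_eq_UN[OF L])
    ultimately show ?thesis by (auto simp: C_def)
  qed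
  have aK: "a p \<in> closed_simplex \<sigma>" if "p \<in> A" for p
  proof -
    obtain t x where p: "p = (t, x)" by (cases p)
    have tx: "0 \<le> t" "t \<le> 1" "x \<in> closed_simplex \<sigma>" "1 - c * m x \<le> (2 - t) / 2"
      using that by (auto simp: A_def p)
    have 1: "0 \<le> 1 / c + 2 / (2 - t) * (x v - 1 / c)" if "v \<in> \<sigma>" for v
    proof -
      have "c * m x \<le> c * x v" using m_le[OF that, of x] c by simp
      then have "2 / (2 - t) * (1 - c * x v) \<le> 2 / (2 - t) * ((2 - t) / 2)"
        using tx by (intro mult_left_mono) auto
      also have "\<dots> = 1" using tx by (simp add: field_simps)
      finally have "0 \<le> (1 - 2 / (2 - t) * (1 - c * x v)) / c" using c by simp
      also have "\<dots> = 1 / c + 2 / (2 - t) * (x v - 1 / c)"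
        using c tx by (simp add: divide_simps)
      finally show ?thesis .
    qed
    have "sum (a p) \<sigma> = (\<Sum>v\<in>\<sigma>. 1 / c + 2 / (2 - t) * (x v - 1 / c))"
      by (intro sum.cong) (auto simp: a_def p)
    also have "\<dots> = 1 + 2 / (2 - t) * (sum x \<sigma> - 1)"
      using c by (simp only: sum.distrib sum_distrib_left[symmetric] sum_subtractf) (simp add: c_def)
    also have "\<dots> = 1" using tx by (simp add: closed_simplex_def)
    finally show ?thesis using 1 by (simp add: closed_simplex_def a_def p)
  qed
  have ys: "s p \<in> {0..1}" "y p \<in> realization ?L" "0 < 1 - c * m (snd p)" if "p \<in> B" for p
  proof -
    obtain t x where p: "p = (t, x)" by (cases p)
    have tx: "0 \<le> t" "t \<le> 1" "x \<in> closed_simplex \<sigma>" "(2 - t) / 2 \<le> 1 - c * m x"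
      using that by (auto simp: B_def p)
    define r where "r = 1 - c * m x"
    have r: "0 < r" "r \<le> 1" "(2 - t) / 2 \<le> r"
      using tx m0[OF tx(3)] c by (auto simp: r_def)
    show "0 < 1 - c * m (snd p)" using r by (simp add: r_def p)
    have "(2 - t) / r \<le> 2" "1 \<le> (2 - t) / r"
      using r tx by (auto simp: divide_simps)
    then show "s p \<in> {0..1}" by (auto simp: s_def p r_def)
    have "sum (y p) \<sigma> = (\<Sum>v\<in>\<sigma>. (x v - m x) / r)"
      by (intro sum.cong) (auto simp: y_def p r_def)
    also have "\<dots> = (sum x \<sigma> - c * m x) / r"
      by (simp add: sum_subtractf c_def flip: sum_divide_distrib)
    also have "\<dots> = 1" using tx r by (simp add: closed_simplex_def r_def)
    finally have yc: "y p \<in> closed_simplex \<sigma>"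
      using r m_le[of _ x] by (auto simp: closed_simplex_def y_def p r_def)
    obtain u where "u \<in> \<sigma>" "x u = m x" using m_in by blast
    then have "m (y p) \<le> 0" using m_le[of u "y p"] by (simp add: y_def p)
    then have "m (y p) = 0" using m0[OF yc] by simp
    then show "y p \<in> realization ?L" using mL[OF yc] by simp
  qed
  have cy: "continuous_on B (\<lambda>p. (s p, y p))"
  proof (intro continuous_on_Pair continuous_on_coordinatewise_then_product)
    show "continuous_on B s"
      unfolding s_def using ys(3) by (intro continuous_intros cm') force
    fix v
    show "continuous_on B (\<lambda>p. y p v)"
      unfolding y_def using ys(3)
      by (cases "v \<in> \<sigma>") (simp_all, intro continuous_intros cm' ce, force?)
  qed
  have ca: "continuous_on A a"
  proof (intro continuous_on_coordinatewise_then_product)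
    fix v
    show "continuous_on A (\<lambda>p. a p v)"
      unfolding a_def
      by (cases "v \<in> \<sigma>") (simp_all, intro continuous_intros ce, auto simp: A_def)
  qed
  have agree: "F (a p) = H (s p, y p)" if "p \<in> A" "p \<in> B" for p
  proof -
    obtain t x where p: "p = (t, x)" by (cases p)
    have r: "1 - c * m x = (2 - t) / 2" "0 \<le> t" "t \<le> 1" using that by (auto simp: A_def B_def p)
    have "s p = 2 - (2 - t) / ((2 - t) / 2)" by (simp only: s_def p fst_conv snd_conv r(1))
    moreover have "(2 - t) / ((2 - t) / 2) = 2" using r(2,3) by (simp add: field_simps)
    ultimately have "s p = 0" by simp
    moreover have "a p = y p"
    proof
      fix v show "a p v = y p v"
      proof (cases "v \<in> \<sigma>")
        case True
        define \<rho> where "\<rho> = (2 - t) / 2"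
        have \<rho>: "0 < \<rho>" "1 - c * m x = \<rho>" "2 / (2 - t) = 1 / \<rho>" using r by (auto simp: \<rho>_def)
        then have m: "m x = (1 - \<rho>) / c" using c by (simp add: field_simps)
        have "a p v = 1 / c + 1 / \<rho> * (x v - 1 / c)" using True by (simp add: a_def p \<rho>(3))
        moreover have "y p v = (x v - m x) / \<rho>" using True by (simp add: y_def p \<rho>(2))
        moreover have "1 / c + 1 / \<rho> * (x v - 1 / c) = (x v - (1 - \<rho>) / c) / \<rho>"
          using \<rho>(1) c by (simp add: field_simps)
        ultimately show ?thesis by (simp only: m)
      qed (simp add: a_def y_def)
    qed
    ultimately show ?thesis using HF ys(2)[OF that(2)] by simp
  qed
  define G1 where "G1 p = (if p \<in> A then F (a p) else H (s p, y p))" for p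
  have cG1: "continuous_on (A \<union> B) G1"
    unfolding G1_def
  proof (rule continuous_on_cases[OF \<open>closed A\<close> \<open>closed B\<close>])
    show "continuous_on A (\<lambda>p. F (a p))"
      by (rule continuous_on_compose2[OF F(1) ca]) (use aK closed_simplex_sub_realization[OF K \<sigma>(1)] in blast)
    show "continuous_on B (\<lambda>p. H (s p, y p))"
      by (rule continuous_on_compose2[OF H(1) cy]) (use ys in blast)
  qed (use agree in auto)
  define G where "G p = (if p \<in> C then H p else G1 p)" for p
  \<comment> \<open>Points of the sides are fixed by the projection: m x = 0 gives s p = t and y p =
    x, and a point of \<open>A\<close> with m x = 0 must have t = 0, where \<open>H\<close> agrees
    with \<open>F\<close>.\<close>
  have CG: "G1 p = H p" if "p \<in> C" "p \<in> A \<union> B" for p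
  proof -
    obtain t x where p: "p = (t, x)" by (cases p)
    have tx: "0 \<le> t" "t \<le> 1" "x \<in> closed_simplex \<sigma>" "x \<in> realization ?L"
      using that by (auto simp: A_def B_def C_def p)
    then have m: "m x = 0" using mL by simp
    have xs: "x v = 0" if "v \<notin> \<sigma>" for v using that tx by (simp add: closed_simplex_def)
    show ?thesis
    proof (cases "p \<in> A")
      case True
      then have "t = 0" using tx m by (auto simp: A_def p)
      then have "a p = x" using xs by (auto simp: a_def p)
      with True \<open>t = 0\<close> HF tx show ?thesis by (simp add: G1_def p)
    next
      case False
      have "s p = t" "y p = x" using m xs by (auto simp: s_def y_def p)
      with False show ?thesis by (simp add: G1_def p)
    qed
  qed
  show ?thesis
  proof (intro exI[of _ G] conjI ballI)
    have "continuous_on (C \<union> (A \<union> B)) G"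
      unfolding G_def
      by (rule continuous_on_cases) (use \<open>closed A\<close> \<open>closed B\<close> \<open>closed C\<close> cG1 H(1) CG in \<open>auto simp: C_def\<close>)
    then show "continuous_on ({0..1} \<times> realization K) G"
      using ABC by (simp add: Un_commute Un_assoc)
    show "G \<in> ({0..1} \<times> realization K) \<rightarrow> Z"
    proof (rule Pi_I)
      fix p assume p: "p \<in> {0..1::real} \<times> realization K"
      show "G p \<in> Z"
      proof (cases "p \<in> C")
        case True
        then show ?thesis using H(2) unfolding G_def C_def by auto
      next
        case False
        then have "p \<in> A \<union> B" using p ABC by blast
        then show ?thesis
          using False F(2) H(2) aK[of p] ys[of p] closed_simplex_sub_realization[OF K \<sigma>(1)]
          unfolding G_def G1_def by auto
      qed
    qed
    show "G (t, x) = H (t, x)" if "t \<in> {0..1}" "x \<in> realization ?L" for t x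
      using that by (simp add: G_def C_def)
    show "G (0, x) = F x" if x: "x \<in> realization K" for x
    proof (cases "(0, x) \<in> C")
      case True
      then show ?thesis using HF by (auto simp: G_def C_def)
    next
      case False
      have "(0, x) \<in> A \<union> B \<union> C" unfolding ABC using x by simp
      with False have "(0, x) \<in> A \<union> B" by blast
      then have xs: "x \<in> closed_simplex \<sigma>" by (auto simp: A_def B_def)
      then have "(0, x) \<in> A" using m0[OF xs] c by (simp add: A_def)
      moreover have "a (0, x) = x"
      proof
        fix v show "a (0, x) v = x v"
          using xs by (simp add: a_def closed_simplex_def)
      qed
      ultimately show ?thesis using False by (simp add: G_def G1_def)
    qed
  qed
qed

text \<open>Induction on the number of faces outside \<open>A\<close>. A face of largest size among
  them is a facet of the whole complex, since a larger face containing it would be outside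
  \<open>A\<close> as well; it is removed, and the homotopy on the rest is extended over it. As the
  empty face is in \<open>A\<close>, the removed face is nonempty, which
  \<open>facet_homotopy_extension\<close> requires.\<close>

lemma subcomplex_homotopy_extension:
  fixes F :: "('v \<Rightarrow> real) \<Rightarrow> 'z::topological_space"
  assumes K: "finite_complex K" and A: "finite_complex A" "A \<subseteq> K" "{} \<in> A"
    and F: "continuous_on (realization K) F" "F \<in> realization K \<rightarrow> Z"
    and H: "continuous_on ({0..1::real} \<times> realization A) H" "H \<in> ({0..1} \<times> realization A) \<rightarrow> Z"
    and HF: "\<And>x. x \<in> realization A \<Longrightarrow> H (0, x) = F x"
  shows "\<exists>G. continuous_on ({0..1::real} \<times> realization K) G \<and> G \<in> ({0..1} \<times> realization K) \<rightarrow> Z \<and>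
    (\<forall>x\<in>realization K. G (0, x) = F x) \<and> (\<forall>t\<in>{0..1}. \<forall>x\<in>realization A. G (t, x) = H (t, x))"
  using K A(2) F
proof (induction "card (K - A)" arbitrary: K)
  case 0
  then have "K = A" using finite_complexD(1)[OF 0(2)] by auto
  then show ?case using H HF by auto
next
  case (Suc n K)
  have fin: "finite (K - A)" using finite_complexD(1)[OF Suc(3)] by simp
  then have "K - A \<noteq> {}" using Suc(2) by force
  then have "Max (card ` (K - A)) \<in> card ` (K - A)"
    using fin by (intro Max_in) auto
  then obtain \<sigma> where "\<sigma> \<in> K - A" "card \<sigma> = Max (card ` (K - A))"
    by auto
  then have \<sigma>: "\<sigma> \<in> K - A" "\<And>\<rho>. \<rho> \<in> K - A \<Longrightarrow> card \<rho> \<le> card \<sigma>"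
    using fin by auto
  have facet: "\<rho> = \<sigma>" if "\<rho> \<in> K" "\<sigma> \<subseteq> \<rho>" for \<rho>
  proof -
    have "\<rho> \<notin> A" using finite_complexD(3)[OF A(1) _ that(2)] \<sigma>(1) by blast
    then have "card \<rho> \<le> card \<sigma>" using \<sigma>(2) that by simp
    moreover have "finite \<rho>" using finite_complexD(2)[OF Suc(3)] that by blast
    ultimately show ?thesis using that by (metis card_seteq)
  qed
  let ?L = "K - {\<sigma>}"
  have L: "finite_complex ?L"
    by (rule finite_complex_remove[OF Suc(3), of \<sigma>]) (use facet in auto)
  have "card (?L - A) = n"
    using Suc(2) \<sigma>(1) fin by (metis Diff_insert Diff_insert2 card_Diff_singleton diff_Suc_1)
  moreover have "A \<subseteq> ?L" using Suc(4) \<sigma>(1) by blast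
  moreover have LK: "realization ?L \<subseteq> realization K" by (rule realization_mono) auto
  moreover note continuous_on_subset[OF Suc(5) LK]
  moreover have "F \<in> realization ?L \<rightarrow> Z" using Suc(6) LK by auto
  ultimately obtain G1 where G1: "continuous_on ({0..1} \<times> realization ?L) G1"
    "G1 \<in> ({0..1} \<times> realization ?L) \<rightarrow> Z" "\<And>x. x \<in> realization ?L \<Longrightarrow> G1 (0, x) = F x"
    "\<And>t x. t \<in> {0..1} \<Longrightarrow> x \<in> realization A \<Longrightarrow> G1 (t, x) = H (t, x)"
    using Suc(1)[of ?L] L by blast
  have "\<sigma> \<in> K" "\<sigma> \<noteq> {}" using \<sigma>(1) A(3) by auto
  then obtain G where "continuous_on ({0..1} \<times> realization K) G" "G \<in> ({0..1} \<times> realization K) \<rightarrow> Z"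
    "\<And>x. x \<in> realization K \<Longrightarrow> G (0, x) = F x"
    "\<And>t x. t \<in> {0..1} \<Longrightarrow> x \<in> realization ?L \<Longrightarrow> G (t, x) = G1 (t, x)"
    using facet_homotopy_extension[OF Suc(3) _ _ facet Suc(5,6) G1(1,2,3)] by fast
  moreover have "realization A \<subseteq> realization ?L" using \<open>A \<subseteq> ?L\<close> by (rule realization_mono)
  ultimately show ?case using G1(4) by (intro exI[of _ G]) (auto simp: subset_iff)
qed

text \<open>The end map of \<open>h\<close> sends \<open>S\<close> to one point, so it factors
  through \<open>q\<close>, and the factor \<open>g\<close> is the homotopy inverse.
  \<open>h\<close> itself joins the identity to g \<circ> q. Since \<open>h\<close> keeps
  \<open>S\<close> inside \<open>S\<close>, the map q \<circ> h factors through the product of the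
  interval with \<open>q\<close>, which is a quotient map by compactness; this factor
  \<open>k\<close> joins the identity to q \<circ> g.\<close>

lemma homotopy_equivalent_space_collapse:
  assumes X: "compact_space X" and W: "Hausdorff_space W"
    and q: "continuous_map X W q" "q ` topspace X = topspace W"
    and fib: "\<And>x y. x \<in> topspace X \<Longrightarrow> y \<in> topspace X \<Longrightarrow> q x = q y \<longleftrightarrow> x = y \<or> x \<in> S \<and> y \<in> S"
    and S: "S \<subseteq> topspace X" "a \<in> S"
    and h: "continuous_map (prod_topology (top_of_set {0..1::real}) X) X h"
    and h0: "\<And>x. x \<in> topspace X \<Longrightarrow> h (0, x) = x"
    and hS: "\<And>t x. t \<in> {0..1} \<Longrightarrow> x \<in> S \<Longrightarrow> h (t, x) \<in> S"
    and h1: "\<And>x. x \<in> S \<Longrightarrow> h (1, x) = a"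
  shows "X homotopy_equivalent_space W"
proof -
  let ?I = "top_of_set {0..1::real}"
  have hX: "h (t, x) \<in> topspace X" if "t \<in> {0..1}" "x \<in> topspace X" for t x
    using continuous_map_image_subset_topspace[OF h] that by auto
  have qm: "quotient_map X W q"
    using continuous_imp_quotient_map[OF q(1) X W q(2)] .
  have h1c: "continuous_map X X (\<lambda>x. h (1, x))"
    using continuous_map_o_Pair[OF h, of 1] by (simp add: o_def)
  obtain g where g: "continuous_map W X g" "\<And>x. x \<in> topspace X \<Longrightarrow> g (q x) = h (1, x)"
  proof (rule quotient_map_lift_exists[OF qm h1c])
    show "h (1, x) = h (1, y)" if "x \<in> topspace X" "y \<in> topspace X" "q x = q y" for x y
      using fib[OF that(1,2)] that(3) h1 by auto
  qed auto
  let ?Q = "\<lambda>p. (fst p, q (snd p))"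
  have IX: "compact_space (prod_topology ?I X)"
    using X by (simp add: compact_space_prod_topology compact_space_subtopology)
  have IW: "Hausdorff_space (prod_topology ?I W)"
    using W by (simp add: Hausdorff_space_prod_topology Hausdorff_space_subtopology)
  have cQ: "continuous_map (prod_topology ?I X) (prod_topology ?I W) ?Q"
    by (intro continuous_map_pairedI continuous_map_fst continuous_map_compose[OF continuous_map_snd q(1), unfolded o_def])
  have "?Q ` topspace (prod_topology ?I X) = topspace (prod_topology ?I W)"
    using q(2) by (force simp: image_iff)
  then have Qm: "quotient_map (prod_topology ?I X) (prod_topology ?I W) ?Q"
    using continuous_imp_quotient_map[OF cQ IX IW] by blast
  have qh: "continuous_map (prod_topology ?I X) W (\<lambda>p. q (h p))"
    using continuous_map_compose[OF h q(1)] by (simp add: o_def)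
  obtain k where k: "continuous_map (prod_topology ?I W) W k"
    "\<And>p. p \<in> topspace (prod_topology ?I X) \<Longrightarrow> k (?Q p) = q (h p)"
  proof (rule quotient_map_lift_exists[OF Qm qh])
    show "q (h p) = q (h p')"
      if "p \<in> topspace (prod_topology ?I X)" "p' \<in> topspace (prod_topology ?I X)" and pp: "?Q p = ?Q p'" for p p'
    proof -
      obtain t x x' where p: "p = (t, x)" "p' = (t, x')" using pp by (cases p; cases p') auto
      then have *: "t \<in> {0..1}" "x \<in> topspace X" "x' \<in> topspace X" "q x = q x'" using that pp by auto
      then have "x = x' \<or> x \<in> S \<and> x' \<in> S" using fib by blast
      then show ?thesis
        using p fib[OF hX[OF *(1,2)] hX[OF *(1,3)]] hS[OF *(1)] by auto
    qed
  qed auto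
  have "homotopic_with (\<lambda>_. True) X X (g \<circ> q) id"
  proof (rule homotopic_with_symD)
    show "homotopic_with (\<lambda>_. True) X X id (g \<circ> q)"
      using h h0 g(2) by (subst homotopic_with) (auto intro!: exI[of _ h])
  qed
  moreover have "homotopic_with (\<lambda>_. True) W W (q \<circ> g) id"
  proof (rule homotopic_with_symD)
    have "k (0, w) = w \<and> k (1, w) = q (g w)" if w: "w \<in> topspace W" for w
    proof -
      obtain x where x: "x \<in> topspace X" "w = q x" using w q(2) by auto
      show ?thesis using x k(2)[of "(0, x)"] k(2)[of "(1, x)"] h0 g(2) by simp
    qed
    then show "homotopic_with (\<lambda>_. True) W W id (q \<circ> g)"
      using k(1) by (subst homotopic_with) (auto intro!: exI[of _ k])
  qed
  ultimately show ?thesis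
    unfolding homotopy_equivalent_space_def using q(1) g(1) by blast
qed

text \<open>The contraction of \<open>A\<close> extends to a homotopy of the whole complex that
  starts at the identity, and this is the \<open>h\<close> that
  \<open>homotopy_equivalent_space_collapse\<close> asks for.\<close>

lemma homotopy_equivalent_collapse_contractible_subcomplex:
  fixes q :: "('v \<Rightarrow> real) \<Rightarrow> 'w"
  assumes K: "finite_complex K" and A: "finite_complex A" "A \<subseteq> K" "{} \<in> A" "realization A \<noteq> {}"
    and con: "contractible_space (geometric_realization A)"
    and W: "Hausdorff_space W"
    and q: "continuous_map (geometric_realization K) W q" "q ` realization K = topspace W"
    and fib: "\<And>x y. x \<in> realization K \<Longrightarrow> y \<in> realization K \<Longrightarrow>
                q x = q y \<longleftrightarrow> x = y \<or> x \<in> realization A \<and> y \<in> realization A"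
  shows "geometric_realization K homotopy_equivalent_space W"
proof -
  obtain a where a: "a \<in> realization A" and
    "homotopic_with (\<lambda>_. True) (top_of_set (realization A)) (top_of_set (realization A)) id (\<lambda>_. a)"
  proof -
    have "top_of_set (realization A) \<noteq> trivial_topology"
      using A(4) by (metis topspace_euclidean_subtopology topspace_discrete_topology)
    then show thesis
      using con that by (auto simp: geometric_realization_eq contractible_space simp del: contractible_space_top_of_set)
  qed
  then obtain H where H: "continuous_on ({0..1::real} \<times> realization A) H"
    "H \<in> ({0..1} \<times> realization A) \<rightarrow> realization A"
    "\<And>x. x \<in> realization A \<Longrightarrow> H (0, x) = x" "\<And>x. x \<in> realization A \<Longrightarrow> H (1, x) = a"
    by (subst (asm) homotopic_with) auto
  have AK: "realization A \<subseteq> realization K" using A(2) by (rule realization_mono)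
  obtain G where G: "continuous_on ({0..1} \<times> realization K) G"
    "G \<in> ({0..1} \<times> realization K) \<rightarrow> realization K"
    "\<And>x. x \<in> realization K \<Longrightarrow> G (0, x) = x"
    "\<And>t x. t \<in> {0..1} \<Longrightarrow> x \<in> realization A \<Longrightarrow> G (t, x) = H (t, x)"
    using subcomplex_homotopy_extension[OF K A(1-3), of "\<lambda>x. x" "realization K" H] H AK
    by (auto simp: Pi_iff subset_iff continuous_on_id)
  show ?thesis
  proof (rule homotopy_equivalent_space_collapse[where S = "realization A" and a = a and h = G])
    show "compact_space (geometric_realization K)"
      using compact_realization[OF K] by (simp add: geometric_realization_eq compact_space_subtopology)
    show "continuous_map (prod_topology (top_of_set {0..1}) (geometric_realization K)) (geometric_realization K) G"
      using G(1,2) by (simp add: geometric_realization_eq)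
    show "G (t, x) \<in> realization A" if "t \<in> {0..1}" "x \<in> realization A" for t x
      using G(4)[OF that] H(2) that by auto
    show "G (1, x) = a" if "x \<in> realization A" for x
      using G(4)[OF _ that, of 1] H(4)[OF that] by simp
  qed (use W q fib G(3) a(1) AK in \<open>auto simp: geometric_realization_eq\<close>)
qed

section \<open>Connectivity of spaces and maps from spheres\<close>

definition sphere_set :: "nat \<Rightarrow> (nat \<Rightarrow> real) set" where
  "sphere_set i = {x. (\<Sum>k\<le>i. x k ^ 2) = 1 \<and> (\<forall>k>i. x k = 0)}"

lemma nsphere_eq: "nsphere i = top_of_set (sphere_set i)"
  by (simp add: nsphere sphere_set_def euclidean_product_topology)

lemma sphere_set_le_1:
  assumes "x \<in> sphere_set i" shows "\<bar>x k\<bar> \<le> 1"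
proof (cases "k \<le> i")
  case True
  have "x k ^ 2 \<le> (\<Sum>k\<le>i. x k ^ 2)" using True by (intro member_le_sum) auto
  then show ?thesis using assms by (simp add: sphere_set_def abs_square_le_1)
qed (use assms in \<open>auto simp: sphere_set_def\<close>)

lemma compact_sphere_set: "compact (sphere_set i)"
proof -
  have "sphere_set i = {x. \<forall>k. \<bar>x k\<bar> \<le> 1} \<inter> ({x. (\<Sum>k\<le>i. x k ^ 2) = 1} \<inter> (\<Inter>k\<in>{i<..}. {x. x k = 0}))"
    using sphere_set_le_1 by (auto simp: sphere_set_def)
  moreover have "closed ({x. (\<Sum>k\<le>i. x k ^ 2) = 1} \<inter> (\<Inter>k\<in>{i<..}. {x :: nat \<Rightarrow> real. x k = 0}))"
    by (intro closed_Int closed_INT ballI closed_Collect_eq continuous_on_sum continuous_on_power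
        continuous_on_const continuous_on_eval)
  ultimately show ?thesis using compact_Int_closed[OF compact_box] by simp
qed

lemma nsphere_base_in: "nsphere_base \<in> sphere_set i"
proof -
  have "(\<Sum>k\<le>i. nsphere_base k ^ 2) = (\<Sum>k\<in>{0}. nsphere_base k ^ 2)"
    by (intro sum.mono_neutral_right) (auto simp: nsphere_base_def)
  then show ?thesis by (simp add: sphere_set_def nsphere_base_def)
qed

lemma sphere_set_L2: "x \<in> sphere_set i \<Longrightarrow> L2_set x {..i} = 1"
  by (simp add: sphere_set_def L2_set_def)

text \<open>A free nullhomotopy amounts to an extension \<open>F\<close> of \<open>f\<close> over
  the ball. Moving each point of the sphere along its segment to the base point inside the ball
  leaves the base point where it is, so composing with \<open>F\<close> gives a pointed
  nullhomotopy.\<close>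

lemma nullhomotopic_rel_base:
  assumes f: "continuous_map (nsphere i) X f"
    and null: "homotopic_with (\<lambda>_. True) (nsphere i) X f (\<lambda>_. c)"
  shows "homotopic_with (\<lambda>g. g nsphere_base = f nsphere_base) (nsphere i) X f (\<lambda>_. f nsphere_base)"
proof -
  let ?I = "top_of_set {0..1::real}" and ?S = "sphere_set i"
  obtain h where h: "continuous_map (prod_topology ?I (nsphere i)) X h"
    "\<And>u. u \<in> ?S \<Longrightarrow> h (0, u) = f u" "\<And>u. u \<in> ?S \<Longrightarrow> h (1, u) = c"
    using null by (subst (asm) homotopic_with) (auto simp: nsphere_eq)
  define D where "D = {z :: nat \<Rightarrow> real. L2_set z {..i} \<le> 1 \<and> (\<forall>k>i. z k = 0)}"
  \<comment> \<open>\<open>Q\<close> maps the cylinder onto the ball and shrinks the end t = 1,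
    where \<open>h\<close> is constant, to the centre; so \<open>h\<close> descends to the
    ball.\<close>
  define Q where "Q p = (\<lambda>k. (1 - fst p) * snd p k)" for p :: "real \<times> (nat \<Rightarrow> real)"
  have L2Q: "L2_set (Q (t, u)) {..i} = 1 - t" if "t \<in> {0..1}" "u \<in> ?S" for t u
    using that sphere_set_L2[of u i] by (simp add: Q_def flip: L2_set_right_distrib)
  have ce: "continuous_on A (\<lambda>p. snd p v)" for A :: "(real \<times> (nat \<Rightarrow> real)) set" and v
    by (rule continuous_on_compose2[OF continuous_on_eval[of UNIV] continuous_on_snd[OF continuous_on_id]]) auto
  have QD: "Q p \<in> D" if "p \<in> {0..1} \<times> ?S" for p
    using that L2Q[of "fst p" "snd p"] by (auto simp: D_def) (auto simp: Q_def sphere_set_def)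
  have Qs: "Q ` ({0..1} \<times> ?S) = D"
  proof
    show "D \<subseteq> Q ` ({0..1} \<times> ?S)"
    proof
      fix z assume z: "z \<in> D"
      define n where "n = L2_set z {..i}"
      have n: "0 \<le> n" "n \<le> 1" using z by (auto simp: n_def D_def L2_set_nonneg)
      show "z \<in> Q ` ({0..1} \<times> ?S)"
      proof (cases "n = 0")
        case True
        then have "\<forall>k\<le>i. z k = 0" by (auto simp: n_def L2_set_eq_0_iff)
        then have "z k = 0" for k using z by (cases "k \<le> i") (auto simp: D_def)
        then have "Q (1, nsphere_base) = z" by (auto simp: Q_def)
        then show ?thesis using nsphere_base_in by force
      next
        case False
        have "(\<Sum>k\<le>i. z k ^ 2) = n ^ 2" by (simp add: n_def L2_set_def sum_nonneg)
        then have "(\<Sum>k\<le>i. (z k / n) ^ 2) = 1"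
          using False by (simp add: power_divide flip: sum_divide_distrib)
        then have "(\<lambda>k. z k / n) \<in> ?S" using z by (auto simp: sphere_set_def D_def)
        moreover have "z = Q (1 - n, \<lambda>k. z k / n)" using False by (auto simp: Q_def)
        ultimately show ?thesis using n by (intro image_eqI[of _ _ "(1 - n, \<lambda>k. z k / n)"]) auto
      qed
    qed
  qed (use QD in blast)
  have cQ: "continuous_map (prod_topology ?I (nsphere i)) (top_of_set D) Q"
  proof -
    have "continuous_on ({0..1} \<times> ?S) Q"
      unfolding Q_def by (intro continuous_on_coordinatewise_then_product continuous_intros ce)
    then show ?thesis using QD by (auto simp: nsphere_eq)
  qed
  have qm: "quotient_map (prod_topology ?I (nsphere i)) (top_of_set D) Q"
  proof (rule continuous_imp_quotient_map[OF cQ])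
    show "compact_space (prod_topology ?I (nsphere i))"
      by (simp add: nsphere_eq compact_space_subtopology compact_Times compact_sphere_set)
    show "Hausdorff_space (top_of_set D)"
      by (simp add: Hausdorff_space_subtopology)
  qed (use Qs in \<open>simp add: nsphere_eq\<close>)
  obtain F where F: "continuous_map (top_of_set D) X F"
    "\<And>p. p \<in> topspace (prod_topology ?I (nsphere i)) \<Longrightarrow> F (Q p) = h p"
  proof (rule quotient_map_lift_exists[OF qm h(1)])
    show "h p = h p'" if p: "p \<in> topspace (prod_topology ?I (nsphere i))"
      and p': "p' \<in> topspace (prod_topology ?I (nsphere i))" and eq: "Q p = Q p'" for p p'
    proof -
      obtain t u t' u' where [simp]: "p = (t, u)" "p' = (t', u')" by (cases p; cases p')
      have tu: "t \<in> {0..1}" "u \<in> ?S" "t' \<in> {0..1}" "u' \<in> ?S" using p p' by (auto simp: nsphere_eq)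
      have "t = t'" using L2Q[OF tu(1,2)] L2Q[OF tu(3,4)] eq by simp
      show ?thesis
      proof (cases "t = 1")
        case True
        then show ?thesis using h(3) tu \<open>t = t'\<close> by simp
      next
        case False
        have "u k = u' k" for k
          using fun_cong[OF eq, of k] False \<open>t = t'\<close> by (simp add: Q_def)
        then have "u = u'" by (rule ext)
        then show ?thesis using \<open>t = t'\<close> by simp
      qed
    qed
  qed auto
  let ?p = "nsphere_base"
  define G where "G p = F (\<lambda>k. (1 - fst p) * snd p k + fst p * ?p k)" for p :: "real \<times> (nat \<Rightarrow> real)"
  have GD: "(\<lambda>k. (1 - t) * u k + t * ?p k) \<in> D" if "t \<in> {0..1}" "u \<in> ?S" for t u
  proof -
    have "L2_set (\<lambda>k. (1 - t) * u k + t * ?p k) {..i} \<le>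
        L2_set (\<lambda>k. (1 - t) * u k) {..i} + L2_set (\<lambda>k. t * ?p k) {..i}"
      by (rule L2_set_triangle_ineq)
    also have "\<dots> = (1 - t) * L2_set u {..i} + t * L2_set ?p {..i}"
      using that by (simp flip: L2_set_right_distrib)
    also have "\<dots> = 1" using that sphere_set_L2 nsphere_base_in by simp
    finally show ?thesis using that nsphere_base_in[of i] by (auto simp: D_def sphere_set_def)
  qed
  have FS: "F u = f u" if "u \<in> ?S" for u
    using F(2)[of "(0, u)"] h(2)[OF that] that by (simp add: Q_def nsphere_eq)
  have cG: "continuous_map (prod_topology ?I (nsphere i)) X G"
  proof -
    have "continuous_map (prod_topology ?I (nsphere i)) (top_of_set D)
        (\<lambda>p k. (1 - fst p) * snd p k + fst p * ?p k)"
    proof -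
      have "continuous_on ({0..1} \<times> ?S) (\<lambda>p k. (1 - fst p) * snd p k + fst p * ?p k)"
        by (intro continuous_on_coordinatewise_then_product continuous_intros ce)
      then show ?thesis using GD by (auto simp: nsphere_eq)
    qed
    from continuous_map_compose[OF this F(1)] show ?thesis by (simp add: G_def[abs_def] o_def)
  qed
  show ?thesis
  proof (subst homotopic_with)
    show "\<exists>h. continuous_map (prod_topology ?I (nsphere i)) X h \<and>
       (\<forall>x\<in>topspace (nsphere i). h (0, x) = f x) \<and>
       (\<forall>x\<in>topspace (nsphere i). h (1, x) = f ?p) \<and> (\<forall>t\<in>{0..1}. h (t, ?p) = f ?p)"
    proof (intro exI[of _ G] conjI ballI cG)
      fix x assume "x \<in> topspace (nsphere i)"
      then have x: "x \<in> ?S" by (simp add: nsphere_eq)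
      show "G (0, x) = f x" using FS[OF x] by (simp add: G_def)
      show "G (1, x) = f ?p" using FS[OF nsphere_base_in] by (simp add: G_def)
    next
      fix t :: real
      have "(\<lambda>k. (1 - t) * ?p k + t * ?p k) = ?p" by (auto simp: algebra_simps)
      then show "G (t, ?p) = f ?p" using FS[OF nsphere_base_in] by (simp add: G_def)
    qed
  qed (use nsphere_base_in[of i] in \<open>auto simp: nsphere_eq\<close>)
qed

text \<open>Free nullhomotopies suffice: \<open>nullhomotopic_rel_base\<close> makes them pointed
  for positive i. For i = 0, any two points are the values of a map on the two-point sphere, and a
  nullhomotopy joins both of them to \<open>c\<close>.\<close>

lemma k_connected_spaceI:
  assumes ne: "topspace X \<noteq> {}"
    and null: "\<And>i f. i \<le> k \<Longrightarrow> continuous_map (nsphere i) X f \<Longrightarrow>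
                 \<exists>c. homotopic_with (\<lambda>_. True) (nsphere i) X f (\<lambda>_. c)"
  shows "k_connected_space k X"
  unfolding k_connected_space_def
proof (intro conjI ballI ne)
  fix i x0 assume "i \<in> {1..k}" "x0 \<in> topspace X"
  then show "trivial_homotopy_group i X x0"
    using null[of i] nullhomotopic_rel_base unfolding trivial_homotopy_group_def by fastforce
next
  have "path_component_of X x y" if xy: "x \<in> topspace X" "y \<in> topspace X" for x y
  proof -
    define f where "f u = (if 0 \<le> u (0::nat) then x else y)" for u :: "nat \<Rightarrow> real"
    have S: "u 0 = 1 \<or> u 0 = -1" if "u \<in> topspace (nsphere 0)" for u
      using that by (auto simp: nsphere_eq sphere_set_def power2_eq_1_iff)
    have u0: "continuous_map (nsphere 0) euclideanreal (\<lambda>u. u 0)"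
      by (simp add: nsphere_eq continuous_on_eval)
    have cf: "continuous_map (nsphere 0) X f"
      unfolding f_def
    proof (rule continuous_map_cases_le)
      show "continuous_map (nsphere 0) euclideanreal (\<lambda>_. 0::real)" by simp
      show "x = y" if "u \<in> topspace (nsphere 0)" "0 = u 0" for u :: "nat \<Rightarrow> real"
        using S[OF that(1)] that(2) by simp
    qed (use u0 xy in auto)
    then obtain c where c: "homotopic_with (\<lambda>_. True) (nsphere 0) X f (\<lambda>_. c)"
      using null[of 0] by auto
    have "path_component_of X (f s) c" if "s \<in> topspace (nsphere 0)" for s
    proof -
      have "homotopic_with (\<lambda>_. True) (nsphere 0) X (f \<circ> (\<lambda>_. s)) ((\<lambda>_. c) \<circ> (\<lambda>_. s))"
        by (rule homotopic_with_compose_continuous_map_right[OF c]) (use that in auto)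
      then have "homotopic_with (\<lambda>_. True) (nsphere 0) X (\<lambda>_. f s) (\<lambda>_. c)"
        by (simp add: o_def)
      then show ?thesis by (simp add: homotopic_constant_maps)
    qed
    note pc = this
    have "nsphere_base \<in> topspace (nsphere 0)" "(\<lambda>k. - nsphere_base k) \<in> topspace (nsphere 0)"
      using nsphere_base_in[of 0] by (auto simp: nsphere_eq sphere_set_def)
    then have "path_component_of X x c" "path_component_of X y c"
      using pc[of nsphere_base] pc[of "\<lambda>k. - nsphere_base k"] by (auto simp: f_def nsphere_base_def)
    then show ?thesis using path_component_of_sym path_component_of_trans by metis
  qed
  then show "path_connected_space X" by (simp add: path_connected_space_iff_path_component)
qed

text \<open>A map f into \<open>Y\<close> is homotopic to g \<circ> h \<circ> f. This lets
  connectivity be proved for a simplicial complex and then passed on to its quotient, which has no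
  simplicial structure.\<close>

lemma nullhomotopic_homotopy_equivalent:
  assumes "X homotopy_equivalent_space Y"
    and null: "\<And>f. continuous_map S X f \<Longrightarrow> \<exists>c. homotopic_with (\<lambda>_. True) S X f (\<lambda>_. c)"
    and f: "continuous_map S Y f"
  shows "\<exists>c. homotopic_with (\<lambda>_. True) S Y f (\<lambda>_. c)"
proof -
  obtain g h where g: "continuous_map X Y g" and h: "continuous_map Y X h"
    and gh: "homotopic_with (\<lambda>_. True) Y Y (g \<circ> h) id"
    using assms(1) by (auto simp: homotopy_equivalent_space_def)
  obtain c where c: "homotopic_with (\<lambda>_. True) S X (h \<circ> f) (\<lambda>_. c)"
    using null continuous_map_compose[OF f h] by blast
  have "homotopic_with (\<lambda>_. True) S Y (g \<circ> (h \<circ> f)) (g \<circ> (\<lambda>_. c))"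
    by (rule homotopic_with_compose_continuous_map_left[OF c g]) auto
  moreover have "homotopic_with (\<lambda>_. True) S Y ((g \<circ> h) \<circ> f) (id \<circ> f)"
    by (rule homotopic_with_compose_continuous_map_right[OF gh f]) auto
  ultimately have "homotopic_with (\<lambda>_. True) S Y f (\<lambda>_. g c)"
    using homotopic_with_trans homotopic_with_symD by (fastforce simp: o_def id_def)
  then show ?thesis by blast
qed

section \<open>Pushing maps from spheres into a skeleton\<close>

text \<open>The metric on functions weights the coordinates by powers of 1/2, and these weights add
  up to 2.\<close>

lemma dist_fun_le:
  fixes x y :: "'i::countable \<Rightarrow> 'a::metric_space"
  assumes "\<And>k. dist (x k) (y k) \<le> \<delta>"
  shows "dist x y \<le> 2 * \<delta>"
proof -
  have d: "0 \<le> \<delta>" using assms[of undefined] zero_le_dist order_trans by blast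
  have s: "summable (\<lambda>n. (1/2)^n * \<delta>)" by (intro summable_mult2 summable_geometric) simp
  have le: "(1/2)^n * min (dist (x (from_nat n)) (y (from_nat n))) 1 \<le> (1/2)^n * \<delta>" for n
    using assms[of "from_nat n"] by (intro mult_left_mono) auto
  have "summable (\<lambda>n. (1/2)^n * min (dist (x (from_nat n)) (y (from_nat n))) 1)"
    by (rule summable_comparison_test'[OF s, of 0]) (use le in \<open>simp add: abs_mult\<close>)
  then have "dist x y \<le> (\<Sum>n. (1/2)^n * \<delta>)"
    unfolding dist_fun_def using s le by (intro suminf_le)
  also have "\<dots> = (\<Sum>n. (1/2)^n) * \<delta>" by (rule suminf_mult2[symmetric]) (simp add: summable_geometric)
  also have "(\<Sum>n. (1/2::real)^n) = 2" by (subst suminf_geometric) auto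
  finally show ?thesis .
qed

section \<open>Hat functions of the Freudenthal triangulation\<close>

definition range_min :: "nat \<Rightarrow> (nat \<Rightarrow> real) \<Rightarrow> real" where
  "range_min i f = Min (f ` {..i})"

lemma range_min_le: "k \<le> i \<Longrightarrow> range_min i f \<le> f k"
  by (simp add: range_min_def)

lemma range_min_attained: "\<exists>k\<le>i. range_min i f = f k"
proof -
  have "range_min i f \<in> f ` {..i}" unfolding range_min_def by (intro Min_in) auto
  then show ?thesis by auto
qed

lemma continuous_on_range_min:
  assumes "\<And>k. continuous_on S (\<lambda>x. f x k)"
  shows "continuous_on S (\<lambda>x. range_min i (f x))"
  unfolding range_min_def by (rule continuous_on_Min) (use assms in auto)

text \<open>The hat functions of the Freudenthal triangulation of Euclidean space: up to endpoints, the
  interval from kuhn_lo to kuhn_hi consists of the parameters t between 0 and 1 such that a k is the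
  floor of x k + t for all k up to i.\<close>

definition kuhn_lo :: "nat \<Rightarrow> (nat \<Rightarrow> int) \<Rightarrow> (nat \<Rightarrow> real) \<Rightarrow> real" where
  "kuhn_lo i a x = max 0 (- range_min i (\<lambda>k. x k - a k))"

definition kuhn_hi :: "nat \<Rightarrow> (nat \<Rightarrow> int) \<Rightarrow> (nat \<Rightarrow> real) \<Rightarrow> real" where
  "kuhn_hi i a x = min 1 (1 + range_min i (\<lambda>k. a k - x k))"

definition kuhn_hat :: "nat \<Rightarrow> (nat \<Rightarrow> int) \<Rightarrow> (nat \<Rightarrow> real) \<Rightarrow> real" where
  "kuhn_hat i a x = max 0 (kuhn_hi i a x - kuhn_lo i a x)"

lemma kuhn_hat_nonneg: "0 \<le> kuhn_hat i a x"
  by (simp add: kuhn_hat_def)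

lemma continuous_on_kuhn_hat: "continuous_on S (kuhn_hat i a)"
proof -
  have "continuous_on S (\<lambda>x. range_min i (\<lambda>k. x k - real_of_int (a k)))"
       "continuous_on S (\<lambda>x. range_min i (\<lambda>k. real_of_int (a k) - x k))"
    by (intro continuous_on_range_min continuous_on_diff continuous_on_eval continuous_on_const)+
  then show ?thesis
    unfolding kuhn_hat_def kuhn_lo_def kuhn_hi_def
    by (intro continuous_on_max continuous_on_min continuous_on_diff continuous_on_add continuous_on_minus
        continuous_on_const)
qed

lemma kuhn_lo_cases:
  "kuhn_lo i a x = 0 \<or> (\<exists>k\<le>i. kuhn_lo i a x = a k - x k)"
  using range_min_attained[of i "\<lambda>k. x k - a k"] by (auto simp: kuhn_lo_def max_def)

text \<open>The parameter t = \<open>kuhn_lo i a x\<close> itself satisfies a k \<le> x k + t < a k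
  + 1 for all k up to i. Therefore \<open>a\<close> can be recovered from \<open>x\<close> and this
  one number, which makes the positive hats at \<open>x\<close> countable by their values of
  \<open>kuhn_lo\<close>. The last clause keeps the support of a hat near its lattice point.\<close>

lemma kuhn_hat_pos:
  assumes "0 < kuhn_hat i a x"
  shows "0 \<le> kuhn_lo i a x" "kuhn_lo i a x < 1"
    "k \<le> i \<Longrightarrow> a k = \<lfloor>x k + kuhn_lo i a x\<rfloor>"
    "k \<le> i \<Longrightarrow> \<bar>x k - a k\<bar> < 1"
proof -
  have lt: "kuhn_lo i a x < kuhn_hi i a x" using assms by (simp add: kuhn_hat_def)
  show 0: "0 \<le> kuhn_lo i a x" by (simp add: kuhn_lo_def)
  have "kuhn_hi i a x \<le> 1" by (simp add: kuhn_hi_def)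
  then show 1: "kuhn_lo i a x < 1" using lt by simp
  assume k: "k \<le> i"
  have "range_min i (\<lambda>k. x k - a k) \<le> x k - a k" "range_min i (\<lambda>k. a k - x k) \<le> a k - x k"
    using range_min_le[OF k] by auto
  then have 2: "a k - x k \<le> kuhn_lo i a x" "kuhn_hi i a x \<le> a k - x k + 1"
    by (auto simp: kuhn_lo_def kuhn_hi_def)
  show "a k = \<lfloor>x k + kuhn_lo i a x\<rfloor>" using 2 lt by linarith
  show "\<bar>x k - a k\<bar> < 1" using 0 1 2 lt by linarith
qed

text \<open>At t = 0 the floors of the coordinates are taken, and they do not change for small t, so
  their interval has positive length. Hence the hat functions never vanish simultaneously and can be
  normalized.\<close>

lemma kuhn_hat_exists:
  "0 < kuhn_hat i (\<lambda>k. if k \<le> i then \<lfloor>x k\<rfloor> else 0) x"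
proof -
  let ?a = "\<lambda>k. if k \<le> i then \<lfloor>x k\<rfloor> else 0"
  have "0 \<le> range_min i (\<lambda>k. x k - ?a k)"
    using range_min_attained[of i "\<lambda>k. x k - ?a k"] by auto
  moreover have "- 1 < range_min i (\<lambda>k. ?a k - x k)"
  proof -
    obtain l where l: "l \<le> i" "range_min i (\<lambda>k. ?a k - x k) = ?a l - x l"
      using range_min_attained[of i "\<lambda>k. ?a k - x k"] by auto
    have "- 1 < \<lfloor>x l\<rfloor> - x l" by linarith
    then show ?thesis using l by simp
  qed
  ultimately have "kuhn_lo i ?a x = 0" "0 < kuhn_hi i ?a x"
    unfolding kuhn_lo_def kuhn_hi_def by simp_all
  then show ?thesis by (simp add: kuhn_hat_def)
qed

text \<open>On the boundary of a cube some coordinate is an integer, which lowers the multiplicity of the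
  cover by one: it is bounded by the dimension of the boundary plus one.\<close>

lemma card_kuhn_hat_pos:
  assumes P: "\<And>a. a \<in> P \<Longrightarrow> 0 < kuhn_hat i a x \<and> (\<forall>k>i. a k = 0)"
    and k0: "k0 \<le> i" "x k0 = of_int z"
  shows "card P \<le> Suc i"
proof -
  \<comment> \<open>For a positive hat, \<open>kuhn_lo\<close> is 0 or the gap from some
    \<open>x k\<close> up to its ceiling. The gap at \<open>k0\<close> is 0, so besides 0 only i
    values remain.\<close>
  let ?T = "insert 0 ((\<lambda>k. of_int \<lceil>x k\<rceil> - x k) ` ({..i} - {k0}))"
  have "inj_on (\<lambda>a. kuhn_lo i a x) P"
  proof (rule inj_onI, rule ext)
    fix a b k assume "a \<in> P" "b \<in> P" "kuhn_lo i a x = kuhn_lo i b x"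
    then show "a k = b k"
      using P[of a] P[of b] kuhn_hat_pos(3)[of i a x k] kuhn_hat_pos(3)[of i b x k]
      by (cases "k \<le> i") auto
  qed
  moreover have "(\<lambda>a. kuhn_lo i a x) ` P \<subseteq> ?T"
  proof
    fix y assume "y \<in> (\<lambda>a. kuhn_lo i a x) ` P"
    then obtain a where a: "a \<in> P" "y = kuhn_lo i a x" by auto
    have pos: "0 < kuhn_hat i a x" using P a(1) by blast
    consider "y = 0" | k where "k \<le> i" "y = a k - x k" using kuhn_lo_cases[of i a x] a(2) by auto
    then show "y \<in> ?T"
    proof cases
      case 2
      have "0 \<le> y" "y < 1" using kuhn_hat_pos(1,2)[OF pos] a(2) by auto
      then have c: "a k = \<lceil>x k\<rceil>" using 2 by linarith
      show ?thesis
      proof (cases "k = k0")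
        case True
        then have "y = 0" using c 2 k0 by simp
        then show ?thesis by simp
      next
        case False
        then show ?thesis using c 2 by auto
      qed
    qed simp
  qed
  ultimately have "card P \<le> card ?T" by (intro card_inj_on_le) auto
  also have "\<dots> \<le> Suc (card ((\<lambda>k. of_int \<lceil>x k\<rceil> - x k) ` ({..i} - {k0})))" by (rule card_insert_le_m1) auto
  also have "\<dots> \<le> Suc (card ({..i} - {k0}))" by (simp add: card_image_le)
  also have "\<dots> = Suc i" using k0 by simp
  finally show ?thesis .
qed

section \<open>Cube boundaries and nerve maps\<close>

definition cube_boundary :: "nat \<Rightarrow> (nat \<Rightarrow> real) set" where
  "cube_boundary i = {w. (\<forall>k. \<bar>w k\<bar> \<le> 1) \<and> (\<exists>k\<le>i. \<bar>w k\<bar> = 1) \<and> (\<forall>k>i. w k = 0)}"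

lemma compact_cube_boundary: "compact (cube_boundary i)"
proof -
  have "cube_boundary i = {w. \<forall>k. \<bar>w k\<bar> \<le> 1} \<inter> ((\<Union>k\<in>{..i}. {w. \<bar>w k\<bar> = 1}) \<inter> (\<Inter>k\<in>{i<..}. {w. w k = 0}))"
    by (auto simp: cube_boundary_def)
  moreover have "closed ((\<Union>k\<in>{..i}. {w :: nat \<Rightarrow> real. \<bar>w k\<bar> = 1}) \<inter> (\<Inter>k\<in>{i<..}. {w. w k = 0}))"
    by (intro closed_Int closed_UN finite_atMost closed_INT ballI closed_Collect_eq continuous_on_rabs
        continuous_on_const continuous_on_eval)
  ultimately show ?thesis using compact_Int_closed[OF compact_box] by simp
qed

text \<open>Radial projection in both directions: division by the maximum norm \<open>M\<close> and
  by the Euclidean norm \<open>n\<close>. On the cube boundary some coordinate is 1 or -1, and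
  scaling by an integer makes it the integral coordinate that \<open>card_kuhn_hat_pos\<close>
  needs.\<close>

lemma sphere_set_homeomorphism_cube_boundary:
  "\<exists>c r. continuous_on (sphere_set i) c \<and> (\<forall>u\<in>sphere_set i. c u \<in> cube_boundary i) \<and>
    continuous_on (cube_boundary i) r \<and> (\<forall>w\<in>cube_boundary i. r w \<in> sphere_set i) \<and>
    (\<forall>u\<in>sphere_set i. r (c u) = u)"
proof -
  define M where "M u = - range_min i (\<lambda>k. - \<bar>u k\<bar>)" for u :: "nat \<Rightarrow> real"
  define n where "n w = sqrt (\<Sum>k\<le>i. w k ^ 2)" for w :: "nat \<Rightarrow> real"
  have cM: "continuous_on S M" for S
    unfolding M_def
    by (intro continuous_on_minus continuous_on_range_min continuous_on_rabs continuous_on_eval)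
  have cn: "continuous_on S n" for S
    unfolding n_def
    by (intro continuous_on_real_sqrt continuous_on_sum continuous_on_power continuous_on_eval)
  have M_ge: "\<bar>u k\<bar> \<le> M u" if "k \<le> i" for u k
    using range_min_le[OF that, of "\<lambda>k. - \<bar>u k\<bar>"] by (simp add: M_def)
  have M_eq: "\<exists>k\<le>i. \<bar>u k\<bar> = M u" for u
    using range_min_attained[of i "\<lambda>k. - \<bar>u k\<bar>"] by (auto simp: M_def)
  have M_pos: "0 < M u" if "u \<in> sphere_set i" for u
  proof (rule ccontr)
    assume "\<not> 0 < M u"
    then have "\<forall>k\<le>i. u k = 0" using M_ge[of _ u] by fastforce
    then show False using that by (simp add: sphere_set_def)
  qed
  have n_pos: "0 < n w" if w: "w \<in> cube_boundary i" for w
  proof -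
    obtain k where k: "k \<le> i" "\<bar>w k\<bar> = 1" using w by (auto simp: cube_boundary_def)
    have "w k ^ 2 \<le> (\<Sum>k\<le>i. w k ^ 2)" using k by (intro member_le_sum) auto
    moreover have "w k ^ 2 = 1" using k by (metis power2_abs one_power2)
    ultimately have "0 < (\<Sum>k\<le>i. w k ^ 2)" by linarith
    then show ?thesis by (simp add: n_def)
  qed
  show ?thesis
  proof (rule exI[of _ "\<lambda>u k. u k / M u"], rule exI[of _ "\<lambda>w k. w k / n w"], intro conjI ballI)
    show "continuous_on (sphere_set i) (\<lambda>u k. u k / M u)"
      by (intro continuous_on_coordinatewise_then_product continuous_on_divide continuous_on_eval cM)
        (use M_pos in force)
    show "continuous_on (cube_boundary i) (\<lambda>w k. w k / n w)"
      by (intro continuous_on_coordinatewise_then_product continuous_on_divide continuous_on_eval cn)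
        (use n_pos in force)
    show "(\<lambda>k. u k / M u) \<in> cube_boundary i" if u: "u \<in> sphere_set i" for u
    proof -
      have "\<bar>u k / M u\<bar> \<le> 1" for k
        using M_ge[of k u] M_pos[OF u] u by (cases "k \<le> i") (auto simp: sphere_set_def)
      moreover have "\<exists>k\<le>i. \<bar>u k / M u\<bar> = 1" using M_eq[of u] M_pos[OF u] by auto
      ultimately show ?thesis using u by (simp add: cube_boundary_def sphere_set_def)
    qed
    show "(\<lambda>k. w k / n w) \<in> sphere_set i" if w: "w \<in> cube_boundary i" for w
    proof -
      have "(\<Sum>k\<le>i. (w k / n w) ^ 2) = (\<Sum>k\<le>i. w k ^ 2) / n w ^ 2"
        by (simp add: power_divide sum_divide_distrib)
      also have "n w ^ 2 = (\<Sum>k\<le>i. w k ^ 2)" by (simp add: n_def sum_nonneg)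
      finally have "(\<Sum>k\<le>i. (w k / n w) ^ 2) = 1" using n_pos[OF w] by (simp add: n_def)
      then show ?thesis using w by (simp add: sphere_set_def cube_boundary_def)
    qed
    show "(\<lambda>k. u k / M u / n (\<lambda>k. u k / M u)) = u" if u: "u \<in> sphere_set i" for u
    proof -
      have "n (\<lambda>k. u k / M u) = sqrt ((\<Sum>k\<le>i. u k ^ 2) / M u ^ 2)"
        by (simp add: n_def power_divide sum_divide_distrib)
      also have "\<dots> = 1 / M u"
        using u M_pos[OF u] by (simp add: sphere_set_def real_sqrt_divide)
      finally show ?thesis using M_pos[OF u] by auto
    qed
  qed
qed

text \<open>On a fine lattice, \<open>f\<close> carries the support of each hat \<open>a\<close>
  into the open star of one vertex \<open>v a\<close>. The map \<open>g\<close> gives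
  \<open>v a\<close> the normalized value of the hat. At most i + 1 hats are positive at a point,
  and their vertices all lie in the support of \<open>f u\<close>; so \<open>g u\<close> lies in a
  face of that simplex with at most i + 1 vertices, and a straight-line homotopy joins
  \<open>f\<close> to \<open>g\<close>.\<close>

lemma sphere_map_homotopic_into_skeleton:
  fixes f :: "(nat \<Rightarrow> real) \<Rightarrow> 'v \<Rightarrow> real"
  assumes K: "finite_complex K"
    and f: "continuous_map (nsphere i) (geometric_realization K) f"
  obtains g where "homotopic_with (\<lambda>_. True) (nsphere i) (geometric_realization K) f g"
    "continuous_on (sphere_set i) g"
    "\<And>u. u \<in> sphere_set i \<Longrightarrow> \<exists>\<tau>\<in>K. card \<tau> \<le> Suc i \<and> g u \<in> closed_simplex \<tau>"
proof -
  let ?S = "sphere_set i" and ?C = "cube_boundary i"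
  have cf: "continuous_on ?S f" and fK: "\<And>u. u \<in> ?S \<Longrightarrow> f u \<in> realization K"
    using f by (auto simp: nsphere_eq geometric_realization_eq)
  obtain c r where c: "continuous_on ?S c" "\<And>u. u \<in> ?S \<Longrightarrow> c u \<in> ?C"
    and r: "continuous_on ?C r" "\<And>w. w \<in> ?C \<Longrightarrow> r w \<in> ?S" and rc: "\<And>u. u \<in> ?S \<Longrightarrow> r (c u) = u"
    using sphere_set_homeomorphism_cube_boundary[of i] by blast
  have "\<exists>A. open A \<and> A \<inter> ?C = (\<lambda>w. f (r w) v) -` {0<..} \<inter> ?C" for v
  proof -
    have "continuous_on ?C (\<lambda>w. f (r w))"
      by (rule continuous_on_compose2[OF cf r(1)]) (use r(2) in blast)
    then have "continuous_on ?C (\<lambda>w. f (r w) v)" by (rule continuous_on_product_then_coordinatewise)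
    then show ?thesis using open_greaterThan unfolding continuous_on_open_invariant by blast
  qed
  then obtain A where A: "\<And>v. open (A v)" "\<And>v. A v \<inter> ?C = (\<lambda>w. f (r w) v) -` {0<..} \<inter> ?C"
    by metis
  have "?C \<subseteq> \<Union>(range A)"
  proof
    fix w assume w: "w \<in> ?C"
    obtain v where "0 < f (r w) v"
      using closed_simplex_pos[OF realization_mem_support(3)[OF fK[OF r(2)[OF w]]]] by blast
    then have "w \<in> A v" using A(2)[of v] w by blast
    then show "w \<in> \<Union>(range A)" by blast
  qed
  \<comment> \<open>A Lebesgue number for the cover of the cube boundary by the preimages of the
    open vertex stars.\<close>
  then obtain \<epsilon> where \<epsilon>: "0 < \<epsilon>" "\<And>w. w \<in> ?C \<Longrightarrow> \<exists>G\<in>range A. ball w \<epsilon> \<subseteq> G"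
    using Heine_Borel_lemma[OF compact_cube_boundary, of i "range A"] A(1) by (metis imageE)
  \<comment> \<open>Two points in the support of one hat differ by at most 2 in each scaled
    coordinate, hence by at most 2 / N before scaling, and by at most 4 / N in the metric on
    functions (\<open>dist_fun_le\<close>).\<close>
  obtain N :: nat where N: "4 / \<epsilon> < real N" using reals_Archimedean2 by blast
  have N0: "0 < real N" using N \<epsilon>(1) by (smt (verit) divide_pos_pos)
  define x where "x u = (\<lambda>k. real N * c u k)" for u
  have cx: "continuous_on ?S x"
    unfolding x_def
    by (intro continuous_on_coordinatewise_then_product continuous_on_mult_left
        continuous_on_product_then_coordinatewise[OF c(1)])
  define I where "I = {a :: nat \<Rightarrow> int. \<forall>k. (k \<in> {..i} \<longrightarrow> a k \<in> {- int N - 1..int N + 1}) \<and> (k \<notin> {..i} \<longrightarrow> a k = 0)}"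
  have finI: "finite I" unfolding I_def by (intro finite_set_of_finite_funs) auto
  have xN: "\<bar>x u k\<bar> \<le> real N" if "u \<in> ?S" for u k
    using c(2)[OF that] N0 by (auto simp: x_def cube_boundary_def abs_mult mult_left_le)
  have "\<exists>v. \<forall>u\<in>?S. 0 < kuhn_hat i a (x u) \<longrightarrow> 0 < f u v" for a
  proof (cases "\<exists>u\<in>?S. 0 < kuhn_hat i a (x u)")
    case True
    then obtain u where u: "u \<in> ?S" "0 < kuhn_hat i a (x u)" by blast
    obtain v where v: "ball (c u) \<epsilon> \<subseteq> A v" using \<epsilon>(2)[OF c(2)[OF u(1)]] by blast
    show ?thesis
    proof (intro exI[of _ v] ballI impI)
      fix u' assume u': "u' \<in> ?S" "0 < kuhn_hat i a (x u')"
      have "dist (c u k) (c u' k) \<le> 2 / real N" for k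
      proof (cases "k \<le> i")
        case True
        have "\<bar>x u k - x u' k\<bar> \<le> 2"
          using kuhn_hat_pos(4)[OF u(2) True] kuhn_hat_pos(4)[OF u'(2) True] by linarith
        then have "real N * \<bar>c u k - c u' k\<bar> \<le> 2"
          using N0 by (simp add: x_def abs_mult flip: right_diff_distrib)
        then show ?thesis using N0 by (simp add: dist_real_def field_simps)
      next
        case False
        then show ?thesis using c(2)[OF u(1)] c(2)[OF u'(1)] N0 by (simp add: cube_boundary_def)
      qed
      then have "dist (c u) (c u') \<le> 2 * (2 / real N)" by (rule dist_fun_le)
      also have "\<dots> < \<epsilon>" using N N0 \<epsilon>(1) by (simp add: field_simps)
      finally have "c u' \<in> A v" using v by auto
      then have "c u' \<in> A v \<inter> ?C" using c(2)[OF u'(1)] by blast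
      then show "0 < f u' v" unfolding A(2) using rc[OF u'(1)] by simp
    qed
  qed blast
  then obtain v where v: "\<And>a u. u \<in> ?S \<Longrightarrow> 0 < kuhn_hat i a (x u) \<Longrightarrow> 0 < f u (v a)"
    by metis
  define W where "W u = (\<Sum>a\<in>I. kuhn_hat i a (x u))" for u
  define g where "g u = (\<lambda>w. (\<Sum>a\<in>I. if v a = w then kuhn_hat i a (x u) else 0) / W u)" for u
  have ch: "continuous_on ?S (\<lambda>u. kuhn_hat i a (x u))" for a
    by (rule continuous_on_compose2[OF continuous_on_kuhn_hat[of UNIV] cx]) auto
  have Wpos: "0 < W u" if u: "u \<in> ?S" for u
  proof -
    let ?a = "\<lambda>k. if k \<le> i then \<lfloor>x u k\<rfloor> else 0"
    have "?a \<in> I"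
    proof -
      have "- int N - 1 \<le> \<lfloor>x u k\<rfloor> \<and> \<lfloor>x u k\<rfloor> \<le> int N + 1" for k
        using xN[OF u, of k] by linarith
      then show ?thesis by (simp add: I_def)
    qed
    then have "kuhn_hat i ?a (x u) \<le> W u"
      unfolding W_def using finI kuhn_hat_nonneg by (intro member_le_sum) auto
    then show ?thesis using kuhn_hat_exists[of i "x u"] by linarith
  qed
  have cg: "continuous_on ?S g"
  proof (rule continuous_on_coordinatewise_then_product)
    fix w
    have "continuous_on ?S (\<lambda>u. if v a = w then kuhn_hat i a (x u) else 0)" for a
      using ch by (cases "v a = w") auto
    moreover have "continuous_on ?S W" unfolding W_def by (intro continuous_on_sum ch)
    ultimately show "continuous_on ?S (\<lambda>u. g u w)"
      unfolding g_def using Wpos by (intro continuous_on_divide continuous_on_sum) force+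
  qed
  have key: "\<exists>\<tau>\<in>K. card \<tau> \<le> Suc i \<and> g u \<in> closed_simplex \<tau> \<and> \<tau> \<subseteq> {v. f u v \<noteq> 0}" if u: "u \<in> ?S" for u
  proof -
    define P where "P = {a \<in> I. 0 < kuhn_hat i a (x u)}"
    have finP: "finite P" using finI by (simp add: P_def)
    obtain k0 where k0: "k0 \<le> i" "\<bar>c u k0\<bar> = 1" using c(2)[OF u] by (auto simp: cube_boundary_def)
    then have "x u k0 = of_int (int N) \<or> x u k0 = of_int (- int N)" by (auto simp: x_def abs_if split: if_splits)
    then obtain z where z: "x u k0 = of_int z" by blast
    have "card P \<le> Suc i"
      by (rule card_kuhn_hat_pos[where x = "x u", OF _ k0(1) z]) (auto simp: P_def I_def)
    then have "card (v ` P) \<le> Suc i" using card_image_le[OF finP, of v] by linarith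
    moreover have sub: "v ` P \<subseteq> {v. f u v \<noteq> 0}" using v[OF u] by (force simp: P_def)
    moreover have "v ` P \<in> K"
      using finite_complexD(3)[OF K realization_mem_support(1)[OF fK[OF u]] sub] .
    moreover have "g u \<in> closed_simplex (v ` P)"
    proof -
      have nn: "0 \<le> g u w" for w
        unfolding g_def using Wpos[OF u] kuhn_hat_nonneg by (intro divide_nonneg_pos sum_nonneg) auto
      have z: "kuhn_hat i a (x u) = 0" if "a \<in> I" "a \<notin> P" for a
        using that kuhn_hat_nonneg[of i a "x u"] by (auto simp: P_def)
      have off: "g u w = 0" if "w \<notin> v ` P" for w
      proof -
        have "(\<Sum>a\<in>I. if v a = w then kuhn_hat i a (x u) else 0) = 0"
          using that z by (intro sum.neutral) auto
        then show ?thesis by (simp add: g_def)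
      qed
      have "(\<Sum>w\<in>v ` P. \<Sum>a\<in>I. if v a = w then kuhn_hat i a (x u) else 0)
          = (\<Sum>a\<in>I. \<Sum>w\<in>v ` P. if v a = w then kuhn_hat i a (x u) else 0)"
        by (rule sum.swap)
      also have "\<dots> = (\<Sum>a\<in>I. if v a \<in> v ` P then kuhn_hat i a (x u) else 0)"
        using finP by (intro sum.cong) (auto simp: sum.delta')
      also have "\<dots> = W u"
        unfolding W_def using z by (intro sum.cong) auto
      finally have "sum (g u) (v ` P) = 1"
        using Wpos[OF u] by (simp add: g_def flip: sum_divide_distrib)
      then show ?thesis using nn off by (simp add: closed_simplex_def)
    qed
    ultimately show ?thesis by blast
  qed
  show thesis
  proof (rule that[OF _ cg])
    show "homotopic_with (\<lambda>_. True) (nsphere i) (geometric_realization K) f g"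
      unfolding nsphere_eq geometric_realization_eq
    proof (rule homotopic_with_realization_linear[OF K cf cg])
      fix u assume u: "u \<in> ?S"
      let ?\<sigma> = "{v. f u v \<noteq> 0}"
      note fs = realization_mem_support[OF fK[OF u]]
      obtain \<tau> where \<tau>: "\<tau> \<in> K" "g u \<in> closed_simplex \<tau>" "\<tau> \<subseteq> ?\<sigma>" using key[OF u] by blast
      have "g u \<in> realization K" using \<tau> K by (auto simp: realization_iff)
      then have "g u \<in> closed_simplex ?\<sigma>"
        by (rule realization_imp_closed_simplex[OF _ fs(2)]) (use \<tau> in \<open>auto simp: closed_simplex_def\<close>)
      then show "\<exists>\<sigma>\<in>K. f u \<in> closed_simplex \<sigma> \<and> g u \<in> closed_simplex \<sigma>" using fs by blast
    qed
    show "\<exists>\<tau>\<in>K. card \<tau> \<le> Suc i \<and> g u \<in> closed_simplex \<tau>" if "u \<in> ?S" for u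
      using key[OF that] by blast
  qed
qed

lemma sphere_map_nullhomotopic:
  assumes K: "finite_complex K" and A: "finite_complex A" "A \<subseteq> K"
    and con: "contractible_space (geometric_realization A)"
    and skel: "\<And>\<tau>. \<tau> \<in> K \<Longrightarrow> card \<tau> \<le> Suc i \<Longrightarrow> \<tau> \<in> A"
    and f: "continuous_map (nsphere i) (geometric_realization K) f"
  shows "\<exists>c. homotopic_with (\<lambda>_. True) (nsphere i) (geometric_realization K) f (\<lambda>_. c)"
proof -
  obtain g where g: "homotopic_with (\<lambda>_. True) (nsphere i) (geometric_realization K) f g"
    "continuous_on (sphere_set i) g"
    "\<And>u. u \<in> sphere_set i \<Longrightarrow> \<exists>\<tau>\<in>K. card \<tau> \<le> Suc i \<and> g u \<in> closed_simplex \<tau>"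
    using sphere_map_homotopic_into_skeleton[OF K f] by blast
  have "g u \<in> realization A" if "u \<in> sphere_set i" for u
    using g(3)[OF that] skel realization_iff[OF A(1)] by blast
  then have gA: "continuous_map (nsphere i) (geometric_realization A) g"
    using g(2) by (auto simp: nsphere_eq geometric_realization_eq)
  obtain c where "homotopic_with (\<lambda>_. True) (nsphere i) (geometric_realization A) g (\<lambda>_. c)"
    using nullhomotopic_into_contractible_space[OF gA con] by blast
  moreover have "continuous_map (geometric_realization A) (geometric_realization K) id"
    using realization_mono[OF A(2)] by (auto simp: geometric_realization_eq)
  ultimately have "homotopic_with (\<lambda>_. True) (nsphere i) (geometric_realization K) (id \<circ> g) (id \<circ> (\<lambda>_. c))"
    by (rule homotopic_with_compose_continuous_map_left) auto
  then have "homotopic_with (\<lambda>_. True) (nsphere i) (geometric_realization K) g (\<lambda>_. c)"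
    by (simp add: o_def)
  then show ?thesis using homotopic_with_trans[OF g(1)] by blast
qed

section \<open>Disks, simplices and spheres\<close>

lemma disk_eq: "disk d = top_of_set {u. (\<forall>i\<ge>d. u i = 0) \<and> (\<Sum>i<d. u i ^ 2) \<le> 1}"
  by (simp add: disk_def Euclidean_space_def subtopology_subtopology euclidean_product_topology Collect_conj_eq)

lemma disk_interior_eq: "disk_interior d = {u. (\<forall>i\<ge>d. u i = 0) \<and> (\<Sum>i<d. u i ^ 2) < 1}"
  by (auto simp: disk_interior_def topspace_Euclidean_space)

lemma disk_boundary_eq: "disk_boundary d = {u. (\<forall>i\<ge>d. u i = 0) \<and> (\<Sum>i<d. u i ^ 2) = 1}"
  by (auto simp: disk_boundary_def topspace_Euclidean_space)

definition open_simplex :: "'v set \<Rightarrow> ('v \<Rightarrow> real) set" where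
  "open_simplex \<sigma> = {x \<in> closed_simplex \<sigma>. \<forall>v\<in>\<sigma>. 0 < x v}"

text \<open>Radial from the barycentre: the gauge g of the simplex becomes the Euclidean norm. At the
  barycentre itself the formula for the map is 0/0 = 0.\<close>

lemma disk_closed_simplex_homeomorphic:
  fixes \<sigma> :: "'v set"
  assumes fin: "finite \<sigma>" and card: "card \<sigma> = Suc d"
  shows "\<exists>\<Phi> \<Psi>. homeomorphic_maps (disk d) (top_of_set (closed_simplex \<sigma>)) \<Phi> \<Psi> \<and>
    (\<forall>x\<in>closed_simplex \<sigma>. \<Psi> x \<in> disk_interior d \<longleftrightarrow> x \<in> open_simplex \<sigma>)"
proof -
  let ?D = "{u. (\<forall>i\<ge>d. u i = 0) \<and> (\<Sum>i<d. u i ^ 2) \<le> (1::real)}" and ?S = "closed_simplex \<sigma>"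
  obtain e where "bij_betw e {0..<card \<sigma>} \<sigma>"
    using ex_bij_betw_nat_finite[OF fin] by blast
  then have e: "bij_betw e {..d} \<sigma>"
    by (simp add: card atLeast0LessThan lessThan_Suc_atMost)
  have e\<sigma>: "e i \<in> \<sigma>" if "i \<le> d" for i using e that by (auto simp: bij_betw_def)
  have \<sigma>e: "\<exists>i\<le>d. v = e i" if "v \<in> \<sigma>" for v using e that by (auto simp: bij_betw_def)
  have sum_e: "sum f \<sigma> = (\<Sum>i<d. f (e i)) + f (e d)" for f :: "'v \<Rightarrow> real"
    by (simp add: sum.reindex_bij_betw[OF e, symmetric] lessThan_Suc_atMost[symmetric])
  define s where "s = real (Suc d)"
  define c where "c = 1 / s"
  have s: "0 < s" "real (card \<sigma>) = s" by (auto simp: s_def card)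
  have c: "0 < c" "s * c = 1" using s by (auto simp: c_def)
  define m where "m x = Min (x ` \<sigma>)" for x :: "'v \<Rightarrow> real"
  have \<sigma>0: "\<sigma> \<noteq> {}" using card by auto
  have m_le: "m x \<le> x v" if "v \<in> \<sigma>" for x v
    using that fin by (simp add: m_def)
  have m_in: "\<exists>v\<in>\<sigma>. x v = m x" for x
  proof -
    have "m x \<in> x ` \<sigma>" unfolding m_def using fin \<sigma>0 by (intro Min_in) auto
    then show ?thesis by auto
  qed
  \<comment> \<open>Along each ray, \<open>g\<close> grows linearly from 0 at the barycentre, whose
    coordinates are all c, to 1 on the boundary. The vector \<open>w\<close> omits the last
    coordinate of x - c, which is determined by the others because they all sum to 0;
    \<open>\<Psi>\<close> rescales \<open>w\<close> to the length g x.\<close>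
  define g where "g x = 1 - s * m x" for x
  define w where "w x i = (if i < d then x (e i) - c else 0)" for x :: "'v \<Rightarrow> real" and i
  define n where "n x = sqrt (\<Sum>i<d. w x i ^ 2)" for x :: "'v \<Rightarrow> real"
  define \<Psi> where "\<Psi> x i = w x i * g x / n x" for x i
  have cm: "continuous_on ?S m"
    unfolding m_def using fin \<sigma>0
    by (intro continuous_on_Min[where f = "\<lambda>i x. x i"] continuous_on_eval) auto
  have cw: "continuous_on ?S (\<lambda>x. w x i)" for i
  proof (cases "i < d")
    case True
    then show ?thesis by (simp add: w_def) (intro continuous_on_diff continuous_on_eval continuous_on_const)
  qed (simp add: w_def)
  have cn: "continuous_on ?S n"
    unfolding n_def by (intro continuous_on_real_sqrt continuous_on_sum continuous_on_power cw)
  have cg: "continuous_on ?S g"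
    unfolding g_def by (intro continuous_on_diff continuous_on_mult_left continuous_on_const cm)
  have smc: "(\<Sum>v\<in>\<sigma>. x v - c) = 0" if "x \<in> ?S" for x
    using that s(2) c by (simp add: sum_subtractf closed_simplex_def)
  have g0: "0 \<le> g x" if "x \<in> ?S" for x
  proof -
    have "s * m x = (\<Sum>v\<in>\<sigma>. m x)" using s by simp
    also have "\<dots> \<le> sum x \<sigma>" by (intro sum_mono m_le)
    finally show ?thesis using that by (simp add: g_def closed_simplex_def)
  qed
  have m0: "0 \<le> m x" if "x \<in> ?S" for x
    using m_in[of x] that by (auto simp: closed_simplex_def) metis
  have g1: "g x \<le> 1" if "x \<in> ?S" for x using m0[OF that] s by (simp add: g_def)
  have gc: "x v = c" if x: "x \<in> ?S" "g x = 0" "v \<in> \<sigma>" for x v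
  proof -
    have "m x = c" using x(2) s by (simp add: g_def c_def field_simps)
    then have "\<forall>v\<in>\<sigma>. 0 \<le> x v - c" using m_le[of _ x] by simp
    then show ?thesis using smc[OF x(1)] sum_nonneg_eq_0_iff[OF fin, of "\<lambda>v. x v - c"] x(3) by auto
  qed
  have ng: "g x = 0" if x: "x \<in> ?S" "n x = 0" for x
  proof -
    have "\<forall>i<d. w x i = 0" using x(2) by (simp add: n_def sum_nonneg_eq_0_iff)
    then have 1: "\<forall>i<d. x (e i) - c = 0" by (simp add: w_def)
    then have "x (e d) - c = 0" using smc[OF x(1)] unfolding sum_e by simp
    then have "\<forall>i\<le>d. x (e i) = c" using 1 by (auto simp: le_less)
    then have "m x = c" using m_in[of x] \<sigma>e by metis
    then show ?thesis using c by (simp add: g_def)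
  qed
  have n0: "0 \<le> n x" for x by (simp add: n_def sum_nonneg)
  have wn: "\<bar>w x i\<bar> \<le> n x" for x i
  proof (cases "i < d")
    case True
    then have "w x i ^ 2 \<le> (\<Sum>i<d. w x i ^ 2)" by (intro member_le_sum) auto
    then have "sqrt (w x i ^ 2) \<le> n x" unfolding n_def by (rule real_sqrt_le_mono)
    then show ?thesis by simp
  qed (simp add: w_def n0)
  have \<Psi>g: "\<bar>\<Psi> x i\<bar> \<le> g x" if x: "x \<in> ?S" for x i
  proof (cases "n x = 0")
    case False
    then have "0 < n x" using n0[of x] by simp
    then have "\<bar>w x i\<bar> * g x \<le> n x * g x" using wn g0[OF x] by (intro mult_right_mono) auto
    then show ?thesis using \<open>0 < n x\<close> g0[OF x] by (simp add: \<Psi>_def abs_mult field_simps)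
  qed (simp add: \<Psi>_def g0[OF x])
  have \<Psi>n: "(\<Sum>i<d. \<Psi> x i ^ 2) = g x ^ 2" if x: "x \<in> ?S" for x
  proof (cases "n x = 0")
    case False
    have n2: "(\<Sum>i<d. w x i ^ 2) = n x ^ 2" by (simp add: n_def sum_nonneg)
    have "(\<Sum>i<d. \<Psi> x i ^ 2) = (\<Sum>i<d. w x i ^ 2) * (g x ^ 2 / n x ^ 2)"
      unfolding sum_distrib_right by (intro sum.cong) (auto simp: \<Psi>_def power_mult_distrib power_divide)
    then show ?thesis using False unfolding n2 by simp
  qed (simp add: \<Psi>_def ng[OF x])
  have \<Psi>d: "\<Psi> x i = 0" if "d \<le> i" for x i using that by (simp add: \<Psi>_def w_def)
  have c\<Psi>: "continuous_on ?S \<Psi>"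
  proof (rule continuous_on_coordinatewise_then_product)
    fix i
    show "continuous_on ?S (\<lambda>x. \<Psi> x i)"
      unfolding continuous_on_def
    proof
      fix x0 assume x0: "x0 \<in> ?S"
      show "((\<lambda>x. \<Psi> x i) \<longlongrightarrow> \<Psi> x0 i) (at x0 within ?S)"
      proof (cases "n x0 = 0")
        case False
        then show ?thesis
          unfolding \<Psi>_def using cw cg cn x0
          by (intro tendsto_divide tendsto_mult) (auto simp: continuous_on_def)
      next
        \<comment> \<open>Continuity at the barycentre cannot come from the quotient formula; it
          comes from the bound of \<open>\<Psi>\<close> by \<open>g\<close>, which tends to 0
          there.\<close>
        case True
        have "(g \<longlongrightarrow> g x0) (at x0 within ?S)" using cg x0 by (simp add: continuous_on_def)
        then have "(g \<longlongrightarrow> 0) (at x0 within ?S)" using ng[OF x0 True] by simp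
        then have "((\<lambda>x. \<Psi> x i) \<longlongrightarrow> 0) (at x0 within ?S)"
          by (rule Lim_null_comparison[rotated]) (simp add: eventually_at_filter \<Psi>g)
        moreover have "\<Psi> x0 i = 0" using True by (simp add: \<Psi>_def)
        ultimately show ?thesis by simp
      qed
    qed
  qed
  have \<Psi>D: "\<Psi> x \<in> ?D" if "x \<in> ?S" for x
    using \<Psi>n[OF that] \<Psi>d g0[OF that] g1[OF that] by (simp add: abs_square_le_1)
  have inj: "inj_on \<Psi> ?S"
  proof (rule inj_onI)
    fix x y assume x: "x \<in> ?S" and y: "y \<in> ?S" and eq: "\<Psi> x = \<Psi> y"
    have off: "x v = 0" "y v = 0" if "v \<notin> \<sigma>" for v
      using x y that by (auto simp: closed_simplex_def)
    have "g x ^ 2 = g y ^ 2" using \<Psi>n[OF x] \<Psi>n[OF y] eq by simp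
    then have gg: "g x = g y" using g0[OF x] g0[OF y] by (simp add: power2_eq_iff_nonneg)
    show "x = y"
    proof (cases "g x = 0")
      case True
      then have "x v = y v" for v
        using gc[OF x True] gc[OF y] gg off by (cases "v \<in> \<sigma>") auto
      then show ?thesis by (rule ext)
    next
      case False
      have nn: "0 < n x" "0 < n y"
        using False ng[OF x] ng[OF y] gg n0[of x] n0[of y] by (auto simp: less_le)
      \<comment> \<open>Equal images put x and y on one ray from the barycentre, so x - c = l * (y -
        c). Their least coordinates agree because \<open>g\<close> does, and comparing these gives l
        = 1.\<close>
      define l where "l = n x / n y"
      have l: "0 < l" using nn by (simp add: l_def)
      have wl: "w x i = l * w y i" for i
      proof -
        have "w x i * g x / n x = w y i * g x / n y" using fun_cong[OF eq, of i] gg by (simp add: \<Psi>_def)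
        then show ?thesis using False nn by (simp add: l_def field_simps)
      qed
      have xl: "x (e i) - c = l * (y (e i) - c)" if "i < d" for i
        using wl[of i] that by (simp add: w_def)
      have "x (e d) - c = - (\<Sum>i<d. x (e i) - c)" using smc[OF x] unfolding sum_e by simp
      also have "\<dots> = - (\<Sum>i<d. l * (y (e i) - c))" using xl by simp
      also have "\<dots> = l * (y (e d) - c)"
      proof -
        have "(\<Sum>i<d. y (e i) - c) = - (y (e d) - c)" using smc[OF y] unfolding sum_e by linarith
        then show ?thesis by (simp only: sum_distrib_left[symmetric] mult_minus_right minus_minus)
      qed
      finally have "x (e i) - c = l * (y (e i) - c)" if "i \<le> d" for i
        using xl that by (cases "i = d") auto
      then have xy: "x v - c = l * (y v - c)" if "v \<in> \<sigma>" for v using \<sigma>e[OF that] by auto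
      obtain u u' where u: "u \<in> \<sigma>" "x u = m x" "u' \<in> \<sigma>" "y u' = m y" using m_in by metis
      have "l * (m y - c) \<le> l * (y u - c)" using l m_le[OF u(1), of y] by simp
      then have "l * (m y - c) \<le> m x - c" using xy[OF u(1)] u by simp
      moreover have "m x - c \<le> l * (m y - c)" using xy[OF u(3)] m_le[OF u(3), of x] u by simp
      ultimately have "m x - c = l * (m y - c)" by simp
      moreover have "m x = m y" using gg s by (simp add: g_def)
      moreover have "m x - c \<noteq> 0" using False c by (auto simp: g_def)
      ultimately have "l = 1" by simp
      then have "x v = y v" for v using xy[of v] off by (cases "v \<in> \<sigma>") auto
      then show ?thesis by (rule ext)
    qed
  qed
  have surj: "\<exists>x\<in>?S. \<Psi> x = u" if u: "u \<in> ?D" for u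
  proof -
    define N where "N = sqrt (\<Sum>i<d. u i ^ 2)"
    have N: "0 \<le> N" "N \<le> 1" using u by (auto simp: N_def sum_nonneg)
    have N2: "(\<Sum>i<d. u i ^ 2) = N ^ 2" by (simp add: N_def sum_nonneg)
    show ?thesis
    proof (cases "N = 0")
      case True
      then have "\<forall>i<d. u i = 0" by (simp add: N_def sum_nonneg_eq_0_iff)
      then have u0: "u i = 0" for i using u by (cases "i < d") auto
      define x where "x v = (if v \<in> \<sigma> then c else 0)" for v
      have "x \<in> ?S" using c s by (auto simp: closed_simplex_def x_def)
      moreover have "\<Psi> x = u"
        using e\<sigma> by (auto simp: fun_eq_iff \<Psi>_def w_def x_def u0)
      ultimately show ?thesis by blast
    next
      case False
      then have N0: "0 < N" using N by simp
      define e' where "e' = inv_into {..d} e"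
      have e'e: "e' (e i) = i" if "i \<le> d" for i
        using e that unfolding e'_def by (auto simp: bij_betw_def inv_into_f_f)
      define z where "z v = (if e' v < d then u (e' v) else - (\<Sum>i<d. u i))" for v
      have ze: "z (e i) = u i" if "i < d" for i using e'e[of i] that by (simp add: z_def)
      have sz: "sum z \<sigma> = 0" unfolding sum_e using ze e'e[of d] by (simp add: z_def)
      have mz: "m z < 0"
      proof (rule ccontr)
        assume "\<not> m z < 0"
        then have "\<forall>v\<in>\<sigma>. 0 \<le> z v" using m_le[of _ z] by fastforce
        then have "\<forall>v\<in>\<sigma>. z v = 0" using sz sum_nonneg_eq_0_iff[OF fin, of z] by blast
        then have "\<forall>i<d. u i = 0" using ze e\<sigma> by (metis less_imp_le)
        then show False using False by (simp add: N_def)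
      qed
      \<comment> \<open>\<open>z\<close> completes u to a vector with sum 0, and
        \<open>\<gamma>\<close> is the value of the formula for \<open>g\<close> at c + z. Scaling
        \<open>z\<close> by N / \<open>\<gamma>\<close> gives a point whose gauge is the norm N of
        u.\<close>
      define \<gamma> where "\<gamma> = - s * m z"
      have \<gamma>: "0 < \<gamma>" using mz s by (simp add: \<gamma>_def mult_pos_neg)
      have m\<gamma>: "m z * N / \<gamma> = - (N * c)" using mz s by (simp add: \<gamma>_def c_def field_simps)
      define x where "x v = (if v \<in> \<sigma> then c + z v * N / \<gamma> else 0)" for v
      have xge: "c - N * c \<le> c + z v * N / \<gamma>" if "v \<in> \<sigma>" for v
      proof -
        have "m z * N / \<gamma> \<le> z v * N / \<gamma>"
          using m_le[OF that, of z] N \<gamma> by (intro divide_right_mono mult_right_mono) auto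
        then show ?thesis using m\<gamma> by simp
      qed
      have Nc: "0 \<le> c - N * c" using N c by (simp add: mult_left_le_one_le)
      have xS: "x \<in> ?S"
      proof -
        have "sum x \<sigma> = (\<Sum>v\<in>\<sigma>. c + z v * (N / \<gamma>))" by (intro sum.cong) (auto simp: x_def)
        also have "\<dots> = (\<Sum>v\<in>\<sigma>. c) + sum z \<sigma> * (N / \<gamma>)" by (simp only: sum.distrib sum_distrib_right)
        also have "\<dots> = 1" using sz c s(2) by simp
        finally show ?thesis using xge Nc by (force simp: closed_simplex_def x_def)
      qed
      moreover have "\<Psi> x = u"
      proof
        fix i
        have wx: "w x i = u i * (N / \<gamma>)" for i
          using ze e\<sigma> u by (auto simp: w_def x_def)
        have "(\<Sum>i<d. w x i ^ 2) = (N / \<gamma>) ^ 2 * N ^ 2"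
          unfolding wx N2[symmetric] sum_distrib_left by (intro sum.cong) (simp_all add: power_mult_distrib power_divide)
        then have "n x = N / \<gamma> * N" using N \<gamma> by (simp add: n_def real_sqrt_mult)
        moreover have "m x = c - N * c"
        proof (rule antisym)
          obtain v where "v \<in> \<sigma>" "z v = m z" using m_in by blast
          then show "m x \<le> c - N * c" using m_le[of v x] m\<gamma> by (simp add: x_def)
          obtain v where "v \<in> \<sigma>" "x v = m x" using m_in by blast
          then show "c - N * c \<le> m x" using xge[of v] by (simp add: x_def)
        qed
        then have "g x = N" using c(2) by (simp add: g_def right_diff_distrib mult.left_commute)
        ultimately show "\<Psi> x i = u i" using wx[of i] N0 \<gamma> by (simp add: \<Psi>_def)
      qed
      ultimately show ?thesis by blast
    qed
  qed
  have int: "\<Psi> x \<in> disk_interior d \<longleftrightarrow> x \<in> open_simplex \<sigma>" if x: "x \<in> ?S" for x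
  proof -
    have "\<Psi> x \<in> disk_interior d \<longleftrightarrow> g x ^ 2 < 1" using \<Psi>n[OF x] \<Psi>d by (simp add: disk_interior_eq)
    also have "\<dots> \<longleftrightarrow> g x < 1" using g0[OF x] by (simp add: abs_square_less_1)
    also have "\<dots> \<longleftrightarrow> 0 < m x" using s by (simp add: g_def zero_less_mult_iff)
    also have "\<dots> \<longleftrightarrow> (\<forall>v\<in>\<sigma>. 0 < x v)" using m_in[of x] m_le[of _ x] by fastforce
    finally show ?thesis using x by (simp add: open_simplex_def)
  qed
  have "homeomorphic_map (top_of_set ?S) (top_of_set ?D) \<Psi>"
  proof (rule continuous_imp_homeomorphic_map)
    show "continuous_map (top_of_set ?S) (top_of_set ?D) \<Psi>" using c\<Psi> \<Psi>D by auto
    show "compact_space (top_of_set ?S)"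
      using compact_closed_simplex[OF fin] by (simp add: compact_space_subtopology)
    have "\<Psi> ` ?S = ?D"
    proof (rule subset_antisym)
      show "\<Psi> ` ?S \<subseteq> ?D" using \<Psi>D by (rule image_subsetI)
      show "?D \<subseteq> \<Psi> ` ?S"
      proof
        fix u assume "u \<in> ?D"
        from surj[OF this] obtain x where "x \<in> ?S" "\<Psi> x = u" ..
        then show "u \<in> \<Psi> ` ?S" by (metis imageI)
      qed
    qed
    then show "\<Psi> ` topspace (top_of_set ?S) = topspace (top_of_set ?D)" by simp
  qed (use inj in \<open>auto simp: Hausdorff_space_subtopology\<close>)
  then obtain \<Phi> where "homeomorphic_maps (top_of_set ?S) (top_of_set ?D) \<Psi> \<Phi>"
    by (auto simp: homeomorphic_map_maps)
  then show ?thesis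
    unfolding disk_eq using int homeomorphic_maps_sym by blast
qed

section \<open>The CW structure on the quotient by a subcomplex\<close>

definition outer_weight :: "'v set set \<Rightarrow> 'v set set \<Rightarrow> ('v \<Rightarrow> real) \<Rightarrow> real" where
  "outer_weight K A x = (\<Sum>\<sigma>\<in>K - A. \<Prod>v\<in>\<sigma>. x v)"

text \<open>The quotient of the realization of K by that of A is realized as the image of this map: the
  factor outer_weight vanishes exactly on A, and away from A it can be divided out.\<close>

definition collapse_map :: "'v::countable set set \<Rightarrow> 'v set set \<Rightarrow> ('v \<Rightarrow> real) \<Rightarrow> nat \<Rightarrow> real" where
  "collapse_map K A x j = outer_weight K A x * (case j of 0 \<Rightarrow> 1 | Suc k \<Rightarrow> x (from_nat k))"

lemma open_simplex_support:
  assumes "x \<in> open_simplex \<sigma>" shows "{v. x v \<noteq> 0} = \<sigma>"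
  using assms by (force simp: open_simplex_def closed_simplex_def)

lemma realization_open_simplex: "x \<in> realization K \<Longrightarrow> x \<in> open_simplex {v. x v \<noteq> 0}"
  using realization_mem_support[of x K] by (auto simp: open_simplex_def less_le)

lemma open_simplex_nonempty:
  assumes "finite \<sigma>" "\<sigma> \<noteq> {}" shows "open_simplex \<sigma> \<noteq> {}"
proof -
  have "(\<lambda>v. if v \<in> \<sigma> then 1 / card \<sigma> else 0) \<in> open_simplex \<sigma>"
    using assms by (auto simp: open_simplex_def closed_simplex_def card_gt_0_iff)
  then show ?thesis by blast
qed

locale subcomplex_pair =
  fixes K A :: "'v::countable set set"
  assumes complex: "finite_complex K" and sub: "finite_complex A" "A \<subseteq> K" "{} \<in> A" "realization A \<noteq> {}"
begin

abbreviation "q \<equiv> collapse_map K A"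

lemma outer_weight_eq_0_iff:
  assumes x: "x \<in> realization K"
  shows "outer_weight K A x = 0 \<longleftrightarrow> x \<in> realization A"
proof
  assume "x \<in> realization A"
  have "(\<Prod>v\<in>\<sigma>. x v) = 0" if "\<sigma> \<in> K - A" for \<sigma>
  proof -
    have "\<not> \<sigma> \<subseteq> {v. x v \<noteq> 0}"
      using finite_complexD(3)[OF sub(1) realization_mem_support(1)[OF \<open>x \<in> realization A\<close>]] that by blast
    moreover have "finite \<sigma>" using finite_complexD(2)[OF complex] that by blast
    ultimately show ?thesis by (auto simp: prod_zero_iff)
  qed
  then show "outer_weight K A x = 0" by (simp add: outer_weight_def)
next
  assume 0: "outer_weight K A x = 0"
  let ?\<sigma> = "{v. x v \<noteq> 0}"
  show "x \<in> realization A"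
  proof (rule ccontr)
    assume "x \<notin> realization A"
    then have \<sigma>: "?\<sigma> \<in> K - A" using x by (auto simp: realization_def)
    have "0 < (\<Prod>v\<in>?\<sigma>. x v)"
      using realization_mem_support(4)[OF x] by (intro prod_pos) (auto simp: less_le)
    also have "\<dots> \<le> outer_weight K A x"
      unfolding outer_weight_def
      using \<sigma> finite_complexD(1)[OF complex] realization_mem_support(4)[OF x]
      by (intro member_le_sum[where f = "\<lambda>\<sigma>. \<Prod>v\<in>\<sigma>. x v"] prod_nonneg) auto
    finally show False using 0 by simp
  qed
qed

lemma continuous_on_collapse_map: "continuous_on S q"
proof (rule continuous_on_coordinatewise_then_product)
  fix j
  have "continuous_on S (outer_weight K A)"
    unfolding outer_weight_def[abs_def] by (intro continuous_on_sum continuous_on_prod continuous_on_eval)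
  moreover have "continuous_on S (\<lambda>x. case j of 0 \<Rightarrow> 1 | Suc k \<Rightarrow> x (from_nat k))"
    by (cases j) (simp_all add: continuous_on_eval)
  ultimately show "continuous_on S (\<lambda>x. q x j)"
    unfolding collapse_map_def by (rule continuous_on_mult)
qed

lemma collapse_map_0: "q x 0 = outer_weight K A x"
  by (simp add: collapse_map_def)

lemma collapse_map_Suc: "q x (Suc (to_nat v)) = q x 0 * x v"
  by (simp add: collapse_map_def)

lemma collapse_map_eq_0_iff: "x \<in> realization K \<Longrightarrow> q x = (\<lambda>_. 0) \<longleftrightarrow> x \<in> realization A"
proof -
  assume x: "x \<in> realization K"
  have "q x = (\<lambda>_. 0) \<longleftrightarrow> outer_weight K A x = 0"
  proof
    assume "q x = (\<lambda>_. 0)"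
    then have "q x 0 = 0" by simp
    then show "outer_weight K A x = 0" by (simp add: collapse_map_0)
  qed (simp add: collapse_map_def fun_eq_iff)
  then show "q x = (\<lambda>_. 0) \<longleftrightarrow> x \<in> realization A" using outer_weight_eq_0_iff[OF x] by simp
qed

lemma collapse_map_eq_iff:
  assumes "x \<in> realization K" "y \<in> realization K"
  shows "q x = q y \<longleftrightarrow> x = y \<or> x \<in> realization A \<and> y \<in> realization A"
proof
  assume eq: "q x = q y"
  show "x = y \<or> x \<in> realization A \<and> y \<in> realization A"
  proof (cases "q x 0 = 0")
    case True
    then show ?thesis
      using eq assms outer_weight_eq_0_iff by (metis collapse_map_0)
  next
    case False
    have "x v = y v" for v
      using False fun_cong[OF eq, of "Suc (to_nat v)"] fun_cong[OF eq, of 0]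
      by (simp add: collapse_map_Suc)
    then show ?thesis by blast
  qed
next
  assume "x = y \<or> x \<in> realization A \<and> y \<in> realization A"
  then show "q x = q y" using collapse_map_eq_0_iff assms by metis
qed

lemma homotopy_equivalent_collapse_map:
  assumes "contractible_space (geometric_realization A)"
  shows "geometric_realization K homotopy_equivalent_space top_of_set (q ` realization K)"
  by (rule homotopy_equivalent_collapse_contractible_subcomplex[OF complex sub assms])
    (auto simp: geometric_realization_eq Hausdorff_space_subtopology continuous_on_collapse_map collapse_map_eq_iff)

definition open_cell :: "'v set \<Rightarrow> (nat \<Rightarrow> real) set" where
  "open_cell \<sigma> = q ` open_simplex \<sigma>"

definition cells :: "(nat \<Rightarrow> real) set set" where
  "cells = insert {\<lambda>_. 0} (open_cell ` (K - A))"

text \<open>In \<open>cw_complex\<close> the dimension is a function of the cell as a point set, so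
  the face has to be recovered from it. It is unique because cells of different faces outside
  \<open>A\<close> are disjoint and nonempty.\<close>

definition cell_dim :: "(nat \<Rightarrow> real) set \<Rightarrow> nat" where
  "cell_dim e = (if e = {\<lambda>_. 0} then 0 else card (THE \<sigma>. \<sigma> \<in> K - A \<and> e = open_cell \<sigma>) - 1)"

lemma open_simplex_outer:
  assumes "\<sigma> \<in> K - A" "x \<in> open_simplex \<sigma>"
  shows "x \<in> realization K" "x \<notin> realization A" "q x 0 \<noteq> 0"
proof -
  show 1: "x \<in> realization K"
    using closed_simplex_sub_realization[OF complex, of \<sigma>] assms by (auto simp: open_simplex_def)
  show 2: "x \<notin> realization A"
    using realization_mem_support(1)[of x A] open_simplex_support[OF assms(2)] assms(1) by auto
  show "q x 0 \<noteq> 0" using outer_weight_eq_0_iff[OF 1] 2 by (simp add: collapse_map_0)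
qed

lemma open_cell_eq:
  assumes "\<sigma> \<in> K - A" "\<rho> \<in> K - A" "y \<in> open_cell \<sigma>" "y \<in> open_cell \<rho>"
  shows "\<sigma> = \<rho>"
proof -
  obtain x x' where x: "x \<in> open_simplex \<sigma>" "x' \<in> open_simplex \<rho>" "q x = q x'"
    using assms by (auto simp: open_cell_def)
  then have "x = x'"
    using collapse_map_eq_iff open_simplex_outer assms(1,2) by blast
  then show ?thesis using x open_simplex_support by metis
qed

lemma zero_notin_open_cell: "\<sigma> \<in> K - A \<Longrightarrow> (\<lambda>_. 0) \<notin> open_cell \<sigma>"
proof
  assume \<sigma>: "\<sigma> \<in> K - A" and "(\<lambda>_. 0) \<in> open_cell \<sigma>"
  then obtain x where x: "x \<in> open_simplex \<sigma>" "q x = (\<lambda>_. 0)" unfolding open_cell_def by (metis imageE)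
  then have "q x 0 = 0" by simp
  then show False using open_simplex_outer(3)[OF \<sigma> x(1)] by simp
qed

lemma outer_face: "\<sigma> \<in> K - A \<Longrightarrow> finite \<sigma> \<and> \<sigma> \<noteq> {} \<and> card \<sigma> = Suc (card \<sigma> - 1)"
  using finite_complexD(2)[OF complex] sub(3) by (metis DiffD1 DiffD2 Suc_pred card_gt_0_iff diff_Suc_1' Suc_diff_1)

lemma cell_dim_open_cell:
  assumes \<sigma>: "\<sigma> \<in> K - A" shows "cell_dim (open_cell \<sigma>) = card \<sigma> - 1"
proof -
  have ne: "open_cell \<sigma> \<noteq> {}"
    using open_simplex_nonempty[of \<sigma>] outer_face[OF \<sigma>] by (simp add: open_cell_def)
  have "open_cell \<sigma> \<noteq> {\<lambda>_. 0}" using zero_notin_open_cell[OF \<sigma>] by blast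
  moreover have "(THE \<rho>. \<rho> \<in> K - A \<and> open_cell \<sigma> = open_cell \<rho>) = \<sigma>"
  proof (rule the_equality)
    fix \<rho> assume "\<rho> \<in> K - A \<and> open_cell \<sigma> = open_cell \<rho>"
    then show "\<rho> = \<sigma>" using open_cell_eq[OF \<sigma>] ne by blast
  qed (use \<sigma> in simp)
  ultimately show ?thesis by (simp add: cell_dim_def)
qed

lemma Union_cells: "\<Union>cells = q ` realization K"
proof
  have "(\<lambda>_. 0) \<in> q ` realization K"
    using sub(4) realization_mono[OF sub(2)] collapse_map_eq_0_iff by (metis ex_in_conv image_eqI subsetD)
  moreover have "open_cell \<sigma> \<subseteq> q ` realization K" if "\<sigma> \<in> K - A" for \<sigma>
    using open_simplex_outer(1)[OF that] by (auto simp: open_cell_def)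
  ultimately show "\<Union>cells \<subseteq> q ` realization K" by (auto simp: cells_def)
  show "q ` realization K \<subseteq> \<Union>cells"
  proof clarify
    fix x assume x: "x \<in> realization K"
    show "q x \<in> \<Union>cells"
    proof (cases "x \<in> realization A")
      case True
      then show ?thesis using collapse_map_eq_0_iff[OF x] by (simp add: cells_def)
    next
      case False
      then have "{v. x v \<noteq> 0} \<in> K - A" using x by (auto simp: realization_def)
      moreover have "q x \<in> open_cell {v. x v \<noteq> 0}"
        using realization_open_simplex[OF x] by (auto simp: open_cell_def)
      ultimately show ?thesis unfolding cells_def by blast
    qed
  qed
qed

lemma finite_cells: "finite cells"
  using finite_complexD(1)[OF complex] by (simp add: cells_def)

lemma homeomorphic_map_open_cell:
  assumes \<sigma>: "\<sigma> \<in> K - A"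
  shows "homeomorphic_map (top_of_set (open_simplex \<sigma>)) (top_of_set (open_cell \<sigma>)) q"
proof -
  define p where "p y v = y (Suc (to_nat v)) / y 0" for y :: "nat \<Rightarrow> real" and v :: 'v
  have pq: "p (q x) = x" if "x \<in> open_simplex \<sigma>" for x
    using open_simplex_outer(3)[OF \<sigma> that] by (simp add: p_def collapse_map_Suc fun_eq_iff)
  have "continuous_on (open_cell \<sigma>) p"
  proof (rule continuous_on_coordinatewise_then_product)
    fix v
    have "y 0 \<noteq> 0" if "y \<in> open_cell \<sigma>" for y
      using that open_simplex_outer(3)[OF \<sigma>] by (auto simp: open_cell_def)
    then show "continuous_on (open_cell \<sigma>) (\<lambda>y. p y v)"
      unfolding p_def by (intro continuous_on_divide continuous_on_eval) blast
  qed
  then have "homeomorphic_maps (top_of_set (open_simplex \<sigma>)) (top_of_set (open_cell \<sigma>)) q p"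
    using pq continuous_on_collapse_map by (auto simp: homeomorphic_maps_def open_cell_def)
  then show ?thesis by (auto simp: homeomorphic_map_maps)
qed

text \<open>The homeomorphism of the disk with the closed simplex is followed by \<open>q\<close>. A
  boundary point of the simplex has a smaller support: either this is a face in \<open>A\<close>,
  and the point goes to the base point, or it is another face outside \<open>A\<close>, with a cell
  of lower dimension.\<close>

lemma characteristic_map:
  assumes \<sigma>: "\<sigma> \<in> K - A"
  shows "\<exists>\<Phi>. continuous_map (disk (card \<sigma> - 1)) (top_of_set (q ` realization K)) \<Phi> \<and>
    homeomorphic_map (subtopology (disk (card \<sigma> - 1)) (disk_interior (card \<sigma> - 1)))
      (subtopology (top_of_set (q ` realization K)) (open_cell \<sigma>)) \<Phi> \<and>
    \<Phi> ` disk_boundary (card \<sigma> - 1) \<subseteq> \<Union>{e \<in> cells. cell_dim e < card \<sigma> - 1}"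
proof -
  let ?d = "card \<sigma> - 1" and ?S = "closed_simplex \<sigma>"
  have fin: "finite \<sigma>" "card \<sigma> = Suc ?d" using outer_face[OF \<sigma>] by auto
  have \<sigma>K: "\<sigma> \<in> K" using \<sigma> by blast
  obtain \<Phi> \<Psi> where h: "homeomorphic_maps (disk ?d) (top_of_set ?S) \<Phi> \<Psi>"
    and int: "\<forall>x\<in>?S. \<Psi> x \<in> disk_interior ?d \<longleftrightarrow> x \<in> open_simplex \<sigma>"
    using disk_closed_simplex_homeomorphic[OF fin] by blast
  have \<Phi>: "continuous_map (disk ?d) (top_of_set ?S) \<Phi>" "homeomorphic_map (disk ?d) (top_of_set ?S) \<Phi>"
    using h by (simp add: homeomorphic_maps_def, unfold homeomorphic_map_maps, blast)
  have \<Psi>\<Phi>: "\<Psi> (\<Phi> u) = u" "\<Phi> u \<in> ?S" if "u \<in> topspace (disk ?d)" for u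
    using h that continuous_map_image_subset_topspace[OF \<Phi>(1)] by (auto simp: homeomorphic_maps_def)
  have \<Phi>\<Psi>: "\<Phi> (\<Psi> x) = x" "\<Psi> x \<in> topspace (disk ?d)" if "x \<in> ?S" for x
    using h that continuous_map_image_subset_topspace[of "top_of_set ?S" "disk ?d" \<Psi>]
    by (auto simp: homeomorphic_maps_def)
  have SK: "?S \<subseteq> realization K" using closed_simplex_sub_realization[OF complex \<sigma>K] .
  have OS: "open_simplex \<sigma> \<subseteq> ?S" by (auto simp: open_simplex_def)
  have 1: "continuous_map (disk ?d) (top_of_set (q ` realization K)) (q \<circ> \<Phi>)"
  proof (rule continuous_map_compose[OF \<Phi>(1)])
    show "continuous_map (top_of_set ?S) (top_of_set (q ` realization K)) q"
      using SK continuous_on_collapse_map by auto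
  qed
  have "\<Phi> ` (topspace (disk ?d) \<inter> disk_interior ?d) = topspace (top_of_set ?S) \<inter> open_simplex \<sigma>"
  proof (intro equalityI subsetI)
    fix x assume "x \<in> \<Phi> ` (topspace (disk ?d) \<inter> disk_interior ?d)"
    then obtain u where u: "u \<in> topspace (disk ?d)" "u \<in> disk_interior ?d" "x = \<Phi> u" by blast
    have "x \<in> open_simplex \<sigma>" using bspec[OF int \<Psi>\<Phi>(2)[OF u(1)]] \<Psi>\<Phi>(1)[OF u(1)] u(2,3) by simp
    then show "x \<in> topspace (top_of_set ?S) \<inter> open_simplex \<sigma>" using \<Psi>\<Phi>(2)[OF u(1)] u(3) by simp
  next
    fix x assume "x \<in> topspace (top_of_set ?S) \<inter> open_simplex \<sigma>"
    then have x: "x \<in> ?S" "x \<in> open_simplex \<sigma>" by auto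
    then have "\<Psi> x \<in> topspace (disk ?d) \<inter> disk_interior ?d"
      using bspec[OF int x(1)] \<Phi>\<Psi>(2)[OF x(1)] by simp
    then show "x \<in> \<Phi> ` (topspace (disk ?d) \<inter> disk_interior ?d)"
      by (rule image_eqI[rotated]) (simp add: \<Phi>\<Psi>(1)[OF x(1)])
  qed
  then have "homeomorphic_map (subtopology (disk ?d) (disk_interior ?d))
      (subtopology (top_of_set ?S) (open_simplex \<sigma>)) \<Phi>"
    by (rule homeomorphic_map_subtopologies[OF \<Phi>(2)])
  moreover have "subtopology (top_of_set ?S) (open_simplex \<sigma>) = top_of_set (open_simplex \<sigma>)"
    using OS by (simp add: subtopology_subtopology Int_absorb1)
  moreover have "subtopology (top_of_set (q ` realization K)) (open_cell \<sigma>) = top_of_set (open_cell \<sigma>)"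
  proof -
    have "open_cell \<sigma> \<subseteq> q ` realization K" using OS SK by (auto simp: open_cell_def)
    then show ?thesis by (simp add: subtopology_subtopology Int_absorb1)
  qed
  ultimately have 2: "homeomorphic_map (subtopology (disk ?d) (disk_interior ?d))
      (subtopology (top_of_set (q ` realization K)) (open_cell \<sigma>)) (q \<circ> \<Phi>)"
    using homeomorphic_map_compose[OF _ homeomorphic_map_open_cell[OF \<sigma>]] by simp
  have 3: "(q \<circ> \<Phi>) ` disk_boundary ?d \<subseteq> \<Union>{e \<in> cells. cell_dim e < ?d}"
  proof
    fix y assume "y \<in> (q \<circ> \<Phi>) ` disk_boundary ?d"
    then obtain u where u: "u \<in> disk_boundary ?d" "y = q (\<Phi> u)" by auto
    then have "u \<in> topspace (disk ?d)" "u \<notin> disk_interior ?d"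
      by (auto simp: disk_eq disk_boundary_eq disk_interior_eq)
    then have x: "\<Phi> u \<in> ?S" "\<Phi> u \<notin> open_simplex \<sigma>"
      using \<Psi>\<Phi>[of u] bspec[OF int, of "\<Phi> u"] by simp_all
    let ?\<rho> = "{v. \<Phi> u v \<noteq> 0}"
    have xK: "\<Phi> u \<in> realization K" using x SK by blast
    have "?\<rho> \<noteq> \<sigma>" using x realization_open_simplex[OF xK] by auto
    moreover have "?\<rho> \<subseteq> \<sigma>" using closed_simplex_support(1)[OF fin(1) x(1)] .
    ultimately have "card ?\<rho> < card \<sigma>" using fin(1) by (intro psubset_card_mono) auto
    \<comment> \<open>The support of a boundary point is a nonempty proper face, so the simplex has
      at least two vertices, and the base point, of dimension 0, really is of lower
      dimension.\<close>
    moreover have "?\<rho> \<noteq> {}" using closed_simplex_pos[OF x(1)] by fastforce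
    then have "0 < card ?\<rho>" using \<open>?\<rho> \<subseteq> \<sigma>\<close> fin(1) finite_subset by (auto simp: card_gt_0_iff)
    ultimately have d: "card ?\<rho> - 1 < ?d" by linarith
    show "y \<in> \<Union>{e \<in> cells. cell_dim e < ?d}"
    proof (cases "\<Phi> u \<in> realization A")
      case True
      then have "y \<in> {\<lambda>_. 0}" using collapse_map_eq_0_iff[OF xK] u(2) by simp
      moreover have "{\<lambda>_. 0} \<in> cells" "cell_dim {\<lambda>_. 0} < ?d" using d by (auto simp: cells_def cell_dim_def)
      ultimately show ?thesis by blast
    next
      case False
      then have \<rho>: "?\<rho> \<in> K - A" using xK by (auto simp: realization_def)
      moreover have "y \<in> open_cell ?\<rho>" using realization_open_simplex[OF xK] u(2) by (auto simp: open_cell_def)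
      moreover have "cell_dim (open_cell ?\<rho>) < ?d" using cell_dim_open_cell[OF \<rho>] d by simp
      ultimately show ?thesis unfolding cells_def by blast
    qed
  qed
  show ?thesis using 1 2 3 by blast
qed

text \<open>There are finitely many cells, so a set is the finite union of its intersections with
  their closures; this gives the weak topology.\<close>

lemma cw_complex_quotient: "cw_complex (top_of_set (q ` realization K)) cells cell_dim"
proof -
  let ?W = "top_of_set (q ` realization K)"
  have dis: "disjoint cells"
  proof (rule disjointI)
    fix e e' assume e: "e \<in> cells" "e' \<in> cells" "e \<noteq> e'"
    show "e \<inter> e' = {}"
    proof (rule ccontr)
      assume "e \<inter> e' \<noteq> {}"
      then obtain y where y: "y \<in> e" "y \<in> e'" by blast
      have "e = {\<lambda>_. 0} \<or> (\<exists>\<sigma>\<in>K - A. e = open_cell \<sigma>)" "e' = {\<lambda>_. 0} \<or> (\<exists>\<sigma>\<in>K - A. e' = open_cell \<sigma>)"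
        using e by (auto simp: cells_def)
      then show False using y e(3) open_cell_eq zero_notin_open_cell by (metis singletonD)
    qed
  qed
  have char: "\<exists>\<Phi>. continuous_map (disk (cell_dim e)) ?W \<Phi> \<and>
        homeomorphic_map (subtopology (disk (cell_dim e)) (disk_interior (cell_dim e))) (subtopology ?W e) \<Phi> \<and>
        (\<exists>F \<subseteq> {e' \<in> cells. cell_dim e' < cell_dim e}. finite F \<and> \<Phi> ` disk_boundary (cell_dim e) \<subseteq> \<Union>F)"
    if e: "e \<in> cells" for e
  proof (cases "e = {\<lambda>_. 0}")
    case True
    then have 0: "cell_dim e = 0" "(\<lambda>_. 0) \<in> q ` realization K"
      using Union_cells e by (auto simp: cell_dim_def cells_def)
    have d0: "disk_interior 0 = {\<lambda>_. 0}" "disk_boundary 0 = {}" "topspace (disk 0) = {\<lambda>_. 0}"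
      by (auto simp: disk_interior_eq disk_boundary_eq disk_eq)
    let ?\<Phi> = "\<lambda>u :: nat \<Rightarrow> real. (\<lambda>_. 0) :: nat \<Rightarrow> real"
    have "homeomorphic_maps (subtopology (disk 0) (disk_interior 0)) (subtopology ?W e) ?\<Phi> ?\<Phi>"
      unfolding homeomorphic_maps_def using 0 True d0
      by (auto simp: continuous_map_in_subtopology)
    then have "homeomorphic_map (subtopology (disk 0) (disk_interior 0)) (subtopology ?W e) ?\<Phi>"
      by (auto simp: homeomorphic_map_maps)
    then show ?thesis unfolding 0(1) using 0(2) d0 by (intro exI[of _ ?\<Phi>]) auto
  next
    case False
    then obtain \<sigma> where \<sigma>: "\<sigma> \<in> K - A" "e = open_cell \<sigma>" using e by (auto simp: cells_def)
    obtain \<Phi> where "continuous_map (disk (cell_dim e)) ?W \<Phi>"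
      "homeomorphic_map (subtopology (disk (cell_dim e)) (disk_interior (cell_dim e))) (subtopology ?W e) \<Phi>"
      "\<Phi> ` disk_boundary (cell_dim e) \<subseteq> \<Union>{e' \<in> cells. cell_dim e' < cell_dim e}"
      using characteristic_map[OF \<sigma>(1)] cell_dim_open_cell[OF \<sigma>(1)] \<sigma>(2) by auto
    then show ?thesis
      using finite_cells
      by (intro exI[of _ \<Phi>] conjI exI[of _ "{e' \<in> cells. cell_dim e' < cell_dim e}"]) auto
  qed
  have weak: "closedin ?W C \<longleftrightarrow> (\<forall>e\<in>cells. closedin ?W (C \<inter> ?W closure_of e))" if C: "C \<subseteq> topspace ?W" for C
  proof
    assume "\<forall>e\<in>cells. closedin ?W (C \<inter> ?W closure_of e)"
    then have "closedin ?W (\<Union>e\<in>cells. C \<inter> ?W closure_of e)"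
      using finite_cells by (intro closedin_Union) auto
    moreover have "(\<Union>e\<in>cells. C \<inter> ?W closure_of e) = C"
    proof (intro equalityI subsetI)
      fix y assume y: "y \<in> C"
      then have "y \<in> \<Union>cells" using C Union_cells by auto
      then obtain e where e: "e \<in> cells" "y \<in> e" by (rule UnionE)
      then have "e \<subseteq> topspace ?W" using Union_cells by auto
      then have "y \<in> ?W closure_of e" using e(2) closure_of_subset by (metis subsetD)
      then show "y \<in> (\<Union>e\<in>cells. C \<inter> ?W closure_of e)" using e(1) y by (intro UN_I) auto
    qed simp
    ultimately show "closedin ?W C" by simp
  qed (simp add: closedin_Int)
  show ?thesis
    unfolding cw_complex_def
    using dis char weak Union_cells by (auto simp: Hausdorff_space_subtopology)
qed

end

section \<open>Matchings on the Stirling complex\<close>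

text \<open>Among the pairs with the largest key, one with a lower member of largest size is free.\<close>

lemma contractible_realization_matching:
  fixes key :: "'v set \<Rightarrow> nat" and e :: "nat \<Rightarrow> 'v"
  assumes "finite_complex A" "{} \<in> A"
    and "\<And>\<sigma>. \<sigma> \<in> A \<Longrightarrow> insert (e (key \<sigma>)) \<sigma> \<in> A"
    and "\<And>\<sigma>. \<sigma> \<in> A \<Longrightarrow> key (insert (e (key \<sigma>)) \<sigma>) = key \<sigma>"
    and "\<And>\<sigma>. \<sigma> \<in> A \<Longrightarrow> key (\<sigma> - {e (key \<sigma>)}) = key \<sigma>"
    and "\<And>\<sigma> \<rho>. \<rho> \<in> A \<Longrightarrow> \<sigma> \<subseteq> \<rho> \<Longrightarrow> key \<sigma> \<le> key \<rho>"
  shows "contractible_space (geometric_realization A)"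
  using assms
proof (induction "card A" arbitrary: A rule: less_induct)
  case less
  note fc = finite_complexD[OF less(2)]
  define r where "r = Max (key ` A)"
  have r_le: "key \<sigma> \<le> r" if "\<sigma> \<in> A" for \<sigma>
    using that fc(1) by (simp add: r_def)
  have "r \<in> key ` A" unfolding r_def using fc(1) less(3) by (intro Max_in) auto
  then obtain \<sigma>0 where \<sigma>0: "\<sigma>0 \<in> A" "key \<sigma>0 = r" by auto
  define B where "B = {\<sigma> \<in> A. key \<sigma> = r \<and> e r \<notin> \<sigma>}"
  have inB: "\<rho> - {e r} \<in> B" if "\<rho> \<in> A" "key \<rho> = r" for \<rho>
    using that fc(3)[OF that(1), of "\<rho> - {e r}"] less(6)[OF that(1)] by (auto simp: B_def)
  have "finite B" using fc(1) by (simp add: B_def)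
  moreover have "B \<noteq> {}" using inB \<sigma>0 by blast
  ultimately have "Max (card ` B) \<in> card ` B" by (intro Max_in) auto
  then obtain \<sigma> where "\<sigma> \<in> B" "card \<sigma> = Max (card ` B)" by auto
  then have \<sigma>: "\<sigma> \<in> B" "\<And>\<rho>. \<rho> \<in> B \<Longrightarrow> card \<rho> \<le> card \<sigma>"
    using \<open>finite B\<close> by auto
  then have \<sigma>A: "\<sigma> \<in> A" "key \<sigma> = r" "e r \<notin> \<sigma>" by (auto simp: B_def)
  let ?\<tau> = "insert (e r) \<sigma>"
  have \<tau>: "?\<tau> \<in> A" "key ?\<tau> = r" using less(4,5)[OF \<sigma>A(1)] \<sigma>A by auto
  have free: "\<rho> = \<sigma> \<or> \<rho> = ?\<tau>" if "\<rho> \<in> A" "\<sigma> \<subseteq> \<rho>" for \<rho>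
  proof -
    have "key \<rho> = r" using less(7)[OF that] r_le[OF that(1)] \<sigma>A by simp
    then have "\<rho> - {e r} \<in> B" using inB that by blast
    then have "card (\<rho> - {e r}) \<le> card \<sigma>" using \<sigma> by blast
    moreover have "\<sigma> \<subseteq> \<rho> - {e r}" using that \<sigma>A by blast
    moreover have "finite (\<rho> - {e r})" using fc(2) that by blast
    ultimately have "\<sigma> = \<rho> - {e r}" by (intro card_seteq)
    then show ?thesis by blast
  qed
  show ?case
  proof (cases "\<sigma> = {}")
    \<comment> \<open>If the free face is empty, every face lies in {e r}. The realization is a
      single point, and the collapsing ends here.\<close>
    case True
    have "\<rho> \<subseteq> {e r}" if "\<rho> \<in> A" for \<rho> using free[OF that] True by auto
    then have "realization A \<subseteq> {\<lambda>v. if v = e r then 1 else 0}"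
    proof (intro subsetI)
      fix x assume x: "x \<in> realization A"
      have "x \<in> closed_simplex {e r}"
        using \<open>\<And>\<rho>. \<rho> \<in> A \<Longrightarrow> \<rho> \<subseteq> {e r}\<close>[OF realization_mem_support(1)[OF x]]
        by (intro realization_imp_closed_simplex[OF x]) auto
      then show "x \<in> {\<lambda>v. if v = e r then 1 else 0}" by (auto simp: closed_simplex_def)
    qed
    then show ?thesis
      by (intro contractible_space_subset_singleton) (auto simp: geometric_realization_eq)
  next
    case False
    let ?A = "A - {\<sigma>, ?\<tau>}"
    have fA: "finite_complex ?A"
      by (rule finite_complex_remove[OF less(2), of \<sigma>]) (use free in auto)
    have "contractible_space (geometric_realization ?A)"
    proof (rule less(1)[OF _ fA])
      show "card ?A < card A" using fc(1) \<sigma>A(1) by (intro psubset_card_mono) auto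
      show "{} \<in> ?A" using less(3) False by auto
      fix \<rho> assume \<rho>: "\<rho> \<in> ?A"
      show "key (insert (e (key \<rho>)) \<rho>) = key \<rho>" "key (\<rho> - {e (key \<rho>)}) = key \<rho>"
        "\<And>\<sigma>. \<sigma> \<subseteq> \<rho> \<Longrightarrow> key \<sigma> \<le> key \<rho>"
        using less(5,6,7) \<rho> by auto
      \<comment> \<open>The remaining faces stay completely matched: a face whose partner belongs to
        the removed pair has key r, and so belongs to the pair itself.\<close>
      have "insert (e (key \<rho>)) \<rho> \<noteq> \<sigma>"
      proof
        assume "insert (e (key \<rho>)) \<rho> = \<sigma>"
        then have "key \<rho> = r" using less(5)[of \<rho>] \<rho> \<sigma>A by simp
        then show False using \<open>insert (e (key \<rho>)) \<rho> = \<sigma>\<close> \<sigma>A by blast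
      qed
      moreover have "insert (e (key \<rho>)) \<rho> \<noteq> ?\<tau>"
      proof
        assume *: "insert (e (key \<rho>)) \<rho> = ?\<tau>"
        then have "key \<rho> = r" using less(5)[of \<rho>] \<rho> \<tau> by simp
        then have "\<rho> = \<sigma> \<or> \<rho> = ?\<tau>" using * \<sigma>A(3) by (metis Diff_insert_absorb insert_absorb)
        then show False using \<rho> by blast
      qed
      ultimately show "insert (e (key \<rho>)) \<rho> \<in> ?A" using less(4)[of \<rho>] \<rho> by blast
    qed
    moreover have "geometric_realization A homotopy_equivalent_space geometric_realization ?A"
      by (rule realization_elementary_collapse[OF less(2) False \<sigma>A(3) \<tau>(1) free])
    ultimately show ?thesis using homotopy_equivalent_space_contractibility by blast
  qed
qed

text \<open>Apart from the pair itself, all faces of an added pair lie in \<open>A\<close>. So the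
  pairs do not interfere: in whatever order they are added, the lower member is contained in no
  other face than its partner, and each addition is an elementary collapse read backwards.\<close>

lemma contractible_realization_add_free_pairs:
  assumes A: "finite_complex A" "contractible_space (geometric_realization A)" and "finite N"
    and N: "\<And>\<sigma>. \<sigma> \<in> N \<Longrightarrow> finite \<sigma> \<and> \<sigma> \<noteq> {} \<and> e \<sigma> \<notin> \<sigma> \<and> \<sigma> \<notin> A"
      "\<And>\<sigma> \<rho>. \<sigma> \<in> N \<Longrightarrow> \<rho> \<subseteq> insert (e \<sigma>) \<sigma> \<Longrightarrow> \<rho> \<noteq> \<sigma> \<Longrightarrow> \<rho> \<noteq> insert (e \<sigma>) \<sigma> \<Longrightarrow> \<rho> \<in> A"
  shows "finite_complex (A \<union> N \<union> (\<lambda>\<sigma>. insert (e \<sigma>) \<sigma>) ` N) \<and>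
    contractible_space (geometric_realization (A \<union> N \<union> (\<lambda>\<sigma>. insert (e \<sigma>) \<sigma>) ` N))"
  using \<open>finite N\<close> N
proof (induction N rule: finite_induct)
  case empty
  then show ?case using A by simp
next
  case (insert \<sigma> N)
  let ?\<mu> = "\<lambda>\<sigma>. insert (e \<sigma>) \<sigma>"
  let ?K = "A \<union> N \<union> ?\<mu> ` N" and ?K' = "A \<union> insert \<sigma> N \<union> ?\<mu> ` (insert \<sigma> N)"
  have IH: "finite_complex ?K" "contractible_space (geometric_realization ?K)"
    using insert.IH insert.prems by blast+
  have \<sigma>: "finite \<sigma>" "\<sigma> \<noteq> {}" "e \<sigma> \<notin> \<sigma>" "\<sigma> \<notin> A" using insert.prems(1)[of \<sigma>] by auto
  have below: "\<rho> \<in> A" if "\<sigma>' \<in> insert \<sigma> N" "\<rho> \<subseteq> ?\<mu> \<sigma>'" "\<rho> \<noteq> \<sigma>'" "\<rho> \<noteq> ?\<mu> \<sigma>'" for \<sigma>' \<rho>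
    using insert.prems(2) that by blast
  have nsub: "\<not> \<sigma> \<subseteq> \<rho>" if \<rho>K: "\<rho> \<in> ?K" for \<rho>
  proof
    assume *: "\<sigma> \<subseteq> \<rho>"
    consider "\<rho> \<in> A" | "\<rho> \<in> N" | \<sigma>' where "\<sigma>' \<in> N" "\<rho> = ?\<mu> \<sigma>'" using \<rho>K by blast
    then show False
    proof cases
      case 1
      then show False using finite_complexD(3)[OF A(1) _ *] \<sigma> by blast
    next
      case 2
      have "\<sigma> \<noteq> \<rho>" using insert.hyps 2 by blast
      moreover have "\<sigma> \<noteq> ?\<mu> \<rho>" using * \<open>\<sigma> \<noteq> \<rho>\<close> by blast
      ultimately show False using below[of \<rho> \<sigma>] 2 * \<sigma>(4) by blast
    next
      case 3
      have "\<sigma> \<noteq> \<sigma>'" using insert.hyps 3 by blast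
      moreover have "\<sigma> \<noteq> ?\<mu> \<sigma>'"
      proof
        assume "\<sigma> = ?\<mu> \<sigma>'"
        moreover have "\<sigma>' \<noteq> ?\<mu> \<sigma>" using \<sigma>(3) calculation by blast
        ultimately have "\<sigma>' \<in> A" using below[of \<sigma> \<sigma>'] \<open>\<sigma> \<noteq> \<sigma>'\<close> by blast
        then show False using insert.prems(1)[of \<sigma>'] 3 by blast
      qed
      ultimately show False using below[of \<sigma>' \<sigma>] 3 * \<sigma>(4) by blast
    qed
  qed
  have K': "?K' = insert \<sigma> (insert (?\<mu> \<sigma>) ?K)" by blast
  have fc: "finite_complex ?K'"
    unfolding finite_complex_def
  proof (intro conjI ballI)
    show "finite ?K'" using finite_complexD(1)[OF IH(1)] K' by simp
    fix \<rho> assume \<rho>: "\<rho> \<in> ?K'"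
    show "finite \<rho>" using \<rho> finite_complexD(2)[OF IH(1)] \<sigma>(1) unfolding K' by auto
    show "Pow \<rho> \<subseteq> ?K'"
    proof
      fix \<nu> assume "\<nu> \<in> Pow \<rho>"
      then have \<nu>: "\<nu> \<subseteq> \<rho>" by blast
      show "\<nu> \<in> ?K'"
      proof (cases "\<rho> \<in> ?K")
        case True
        then have "\<nu> \<in> ?K" using finite_complexD(3)[OF IH(1) True \<nu>] by blast
        then show ?thesis by blast
      next
        case False
        then have "\<nu> \<subseteq> ?\<mu> \<sigma>" using \<nu> \<rho> by blast
        then show ?thesis using below[of \<sigma> \<nu>] by blast
      qed
    qed
  qed
  have "geometric_realization ?K' homotopy_equivalent_space
        geometric_realization (?K' - {\<sigma>, ?\<mu> \<sigma>})"
  proof (rule realization_elementary_collapse[OF fc \<sigma>(2,3)])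
    show "\<rho> = \<sigma> \<or> \<rho> = ?\<mu> \<sigma>" if "\<rho> \<in> ?K'" "\<sigma> \<subseteq> \<rho>" for \<rho>
      using that nsub[of \<rho>] by blast
  qed blast
  moreover have "\<sigma> \<notin> ?K" using nsub[of \<sigma>] by blast
  moreover have "?\<mu> \<sigma> \<notin> ?K" using nsub[of "?\<mu> \<sigma>"] by blast
  ultimately have "geometric_realization ?K' homotopy_equivalent_space geometric_realization ?K"
    unfolding K' by (simp add: insert_Diff_if)
  then show ?case using fc IH(2) homotopy_equivalent_space_contractibility by blast
qed

section \<open>Rook placements and diagonal toggling\<close>

lemma finite_stirling_squares: "finite (stirling_squares m)"
  by (rule finite_subset[of _ "{1..m} \<times> {1..m}"]) (auto simp: stirling_squares_def)

lemma finite_complex_stirling: "finite_complex (stirling_complex m)"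
  unfolding finite_complex_def
proof (intro conjI ballI)
  show "finite (stirling_complex m)"
    by (rule finite_subset[of _ "Pow (stirling_squares m)"])
      (auto simp: stirling_complex_def finite_stirling_squares)
  fix \<sigma> assume "\<sigma> \<in> stirling_complex m"
  then have \<sigma>: "\<And>p. p \<in> \<sigma> \<Longrightarrow> p \<in> stirling_squares m"
    "\<And>p q. p \<in> \<sigma> \<Longrightarrow> q \<in> \<sigma> \<Longrightarrow> p \<noteq> q \<Longrightarrow> fst p \<noteq> fst q \<and> snd p \<noteq> snd q"
    by (auto simp only: stirling_complex_def mem_Collect_eq subset_iff)
  show "Pow \<sigma> \<subseteq> stirling_complex m"
  proof
    fix \<rho> assume "\<rho> \<in> Pow \<sigma>"
    then have "\<And>p. p \<in> \<rho> \<Longrightarrow> p \<in> \<sigma>" by blast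
    then show "\<rho> \<in> stirling_complex m"
      using \<sigma> by (simp only: stirling_complex_def mem_Collect_eq subset_iff) blast
  qed
  have "\<sigma> \<subseteq> stirling_squares m" using \<open>\<sigma> \<in> stirling_complex m\<close> by (simp add: stirling_complex_def)
  then show "finite \<sigma>" using finite_stirling_squares by (rule finite_subset)
qed

lemma stirling_complexD:
  assumes "\<sigma> \<in> stirling_complex m"
  shows "finite \<sigma>" "inj_on fst \<sigma>" "inj_on snd \<sigma>" "fst ` \<sigma> \<subseteq> {1..m}" "snd ` \<sigma> \<subseteq> {1..m}"
    "p \<in> \<sigma> \<Longrightarrow> fst p \<le> snd p"
proof -
  show "finite \<sigma>" using finite_complexD(2)[OF finite_complex_stirling assms] .
  show "inj_on fst \<sigma>" "inj_on snd \<sigma>" using assms unfolding stirling_complex_def inj_on_def by blast+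
  have "\<And>p. p \<in> \<sigma> \<Longrightarrow> p \<in> stirling_squares m" using assms by (auto simp: stirling_complex_def)
  then show "fst ` \<sigma> \<subseteq> {1..m}" "snd ` \<sigma> \<subseteq> {1..m}" "p \<in> \<sigma> \<Longrightarrow> fst p \<le> snd p"
    by (fastforce simp: stirling_squares_def)+
qed

lemma stirling_complex_insert:
  assumes "\<sigma> \<in> stirling_complex m" "i \<notin> fst ` \<sigma>" "j \<notin> snd ` \<sigma>" "1 \<le> i" "i \<le> j" "j \<le> m"
  shows "insert (i, j) \<sigma> \<in> stirling_complex m"
proof -
  have 1: "\<And>p. p \<in> \<sigma> \<Longrightarrow> fst p \<noteq> i \<and> snd p \<noteq> j" using assms(2,3) by auto
  have "insert (i, j) \<sigma> \<subseteq> stirling_squares m"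
    using assms by (auto simp: stirling_complex_def stirling_squares_def)
  moreover have "\<forall>p\<in>insert (i, j) \<sigma>. \<forall>q\<in>insert (i, j) \<sigma>. p \<noteq> q \<longrightarrow> fst p \<noteq> fst q \<and> snd p \<noteq> snd q"
    using assms(1) 1 unfolding stirling_complex_def by (auto; metis fst_conv snd_conv)
  ultimately show ?thesis by (simp add: stirling_complex_def)
qed

text \<open>The matching toggles the diagonal square (r, r) for the least r for which this is possible.\<close>

definition diag_free :: "(nat \<times> nat) set \<Rightarrow> nat \<Rightarrow> bool" where
  "diag_free \<sigma> r \<longleftrightarrow> (\<forall>p\<in>\<sigma>. p = (r, r) \<or> fst p \<noteq> r \<and> snd p \<noteq> r)"

definition diag_key :: "(nat \<times> nat) set \<Rightarrow> nat" where
  "diag_key \<sigma> = (LEAST r. 1 \<le> r \<and> diag_free \<sigma> r)"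

definition diagonal :: "nat \<Rightarrow> (nat \<times> nat) set" where
  "diagonal m = (\<lambda>i. (i, i)) ` {1..m}"

definition noncritical :: "nat \<Rightarrow> (nat \<times> nat) set \<Rightarrow> bool" where
  "noncritical m \<sigma> \<longleftrightarrow> (\<exists>r\<in>{1..m}. diag_free \<sigma> r)"

lemma diag_free_mono: "diag_free \<rho> r \<Longrightarrow> \<sigma> \<subseteq> \<rho> \<Longrightarrow> diag_free \<sigma> r"
  by (auto simp: diag_free_def)

lemma diag_free_insert [simp]: "diag_free (insert (r, r) \<sigma>) s \<longleftrightarrow> diag_free \<sigma> s"
  by (auto simp: diag_free_def)

lemma diag_free_remove [simp]: "diag_free (\<sigma> - {(r, r)}) s \<longleftrightarrow> diag_free \<sigma> s"
  by (auto simp: diag_free_def)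

lemma diag_key_insert [simp]: "diag_key (insert (r, r) \<sigma>) = diag_key \<sigma>"
  by (simp add: diag_key_def)

lemma diag_key_remove [simp]: "diag_key (\<sigma> - {(r, r)}) = diag_key \<sigma>"
  by (simp add: diag_key_def)

lemma noncritical_mono: "noncritical m \<rho> \<Longrightarrow> \<sigma> \<subseteq> \<rho> \<Longrightarrow> noncritical m \<sigma>"
  unfolding noncritical_def by (blast intro: diag_free_mono)

lemma diag_key:
  assumes "noncritical m \<sigma>"
  shows "diag_key \<sigma> \<in> {1..m}" "diag_free \<sigma> (diag_key \<sigma>)"
proof -
  obtain r where r: "1 \<le> r" "r \<le> m" "diag_free \<sigma> r"
    using assms by (auto simp: noncritical_def)
  then have "1 \<le> diag_key \<sigma> \<and> diag_free \<sigma> (diag_key \<sigma>)"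
    unfolding diag_key_def by (intro LeastI[of "\<lambda>r. 1 \<le> r \<and> diag_free \<sigma> r" r]) auto
  moreover have "diag_key \<sigma> \<le> r"
    unfolding diag_key_def using r by (intro Least_le) auto
  ultimately show "diag_key \<sigma> \<in> {1..m}" "diag_free \<sigma> (diag_key \<sigma>)" using r by auto
qed

lemma diag_key_mono:
  assumes "noncritical m \<rho>" "\<sigma> \<subseteq> \<rho>"
  shows "diag_key \<sigma> \<le> diag_key \<rho>"
  unfolding diag_key_def[of \<sigma>]
  using diag_key[OF assms(1)] diag_free_mono[OF _ assms(2)] by (intro Least_le) auto

lemma stirling_complex_insert_diag:
  assumes "\<sigma> \<in> stirling_complex m" "r \<in> {1..m}" "diag_free \<sigma> r"
  shows "insert (r, r) \<sigma> \<in> stirling_complex m"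
proof (cases "(r, r) \<in> \<sigma>")
  case True
  then show ?thesis using assms by (simp add: insert_absorb)
next
  case False
  then have "r \<notin> fst ` \<sigma>" "r \<notin> snd ` \<sigma>" using assms(3) by (auto simp: diag_free_def)
  then show ?thesis using assms by (intro stirling_complex_insert) auto
qed

lemma critical_cover:
  assumes "\<not> noncritical m \<sigma>"
  shows "{1..m} \<subseteq> fst ` \<sigma> \<union> snd ` \<sigma>"
proof
  fix r assume "r \<in> {1..m}"
  then obtain p where "p \<in> \<sigma>" "fst p = r \<or> snd p = r"
    using assms unfolding noncritical_def diag_free_def by blast
  then show "r \<in> fst ` \<sigma> \<union> snd ` \<sigma>" by blast
qed

lemma critical_card:
  assumes "finite \<sigma>" "\<not> noncritical m \<sigma>"
  shows "m \<le> 2 * card \<sigma>"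
proof -
  have "m = card {1..m}" by simp
  also have "\<dots> \<le> card (fst ` \<sigma> \<union> snd ` \<sigma>)"
    using assms by (intro card_mono critical_cover) auto
  also have "\<dots> \<le> card (fst ` \<sigma>) + card (snd ` \<sigma>)" by (rule card_Un_le)
  also have "\<dots> \<le> card \<sigma> + card \<sigma>" using assms(1) by (intro add_mono card_image_le)
  finally show ?thesis by simp
qed

text \<open>For 2 * k < m, a placement of at most k rooks is automatically
  \<open>noncritical\<close> (\<open>critical_card\<close>). The condition has an effect for m = 2 *
  k, where it leaves out the perfect matchings, which are treated separately.\<close>

definition stirling_core :: "nat \<Rightarrow> nat \<Rightarrow> (nat \<times> nat) set set" where
  "stirling_core m k =
     {\<sigma> \<in> stirling_complex m. noncritical m \<sigma> \<and>
        (card \<sigma> \<le> k \<or> card \<sigma> = Suc k \<and> (diag_key \<sigma>, diag_key \<sigma>) \<in> \<sigma>)} \<union> Pow (diagonal m)"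

lemma diagonal_subset:
  assumes "\<sigma> \<subseteq> diagonal m" "1 \<le> m"
  shows "\<sigma> \<in> stirling_complex m" "noncritical m \<sigma>" "diag_key \<sigma> = 1"
proof -
  show "\<sigma> \<in> stirling_complex m"
  proof (rule finite_complexD(3)[OF finite_complex_stirling _ assms(1)])
    show "diagonal m \<in> stirling_complex m"
      by (auto simp: stirling_complex_def stirling_squares_def diagonal_def)
  qed
  have 1: "diag_free \<sigma> 1" using assms by (auto simp: diag_free_def diagonal_def)
  then show "noncritical m \<sigma>" using assms by (auto simp: noncritical_def)
  show "diag_key \<sigma> = 1" unfolding diag_key_def using 1 by (intro Least_equality) auto
qed

lemma stirling_coreD:
  assumes "\<sigma> \<in> stirling_core m k" "1 \<le> m"
  shows "\<sigma> \<in> stirling_complex m" "noncritical m \<sigma>"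
  using assms diagonal_subset[of \<sigma> m] by (auto simp: stirling_core_def)

text \<open>A proper subset of a non-diagonal member has at most k rooks, which gives closure under
  faces. The partner of a non-diagonal member has at most k + 1 rooks and, if a rook was added,
  contains its key square, as the definition demands.\<close>

lemma stirling_core:
  assumes m: "1 \<le> m"
  shows "finite_complex (stirling_core m k)" "{} \<in> stirling_core m k"
    "realization (stirling_core m k) \<noteq> {}"
    "contractible_space (geometric_realization (stirling_core m k))"
proof -
  let ?A = "stirling_core m k"
  have sub: "?A \<subseteq> stirling_complex m" using stirling_coreD m by blast
  show fc: "finite_complex ?A"
    unfolding finite_complex_def
  proof (intro conjI ballI subsetI)
    show "finite ?A" using sub finite_complexD(1)[OF finite_complex_stirling] by (rule finite_subset)
    fix \<sigma> assume \<sigma>: "\<sigma> \<in> ?A"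
    then show fin: "finite \<sigma>" using sub stirling_complexD(1) by blast
    fix \<rho> assume "\<rho> \<in> Pow \<sigma>"
    then have \<rho>: "\<rho> \<subseteq> \<sigma>" by blast
    show "\<rho> \<in> ?A"
    proof (cases "\<sigma> \<subseteq> diagonal m \<or> \<rho> = \<sigma>")
      case True
      then show ?thesis using \<rho> \<sigma> by (auto simp: stirling_core_def)
    next
      case False
      then have "card \<rho> < card \<sigma>" using \<rho> fin by (intro psubset_card_mono) auto
      then have "card \<rho> \<le> k" using False \<sigma> by (auto simp: stirling_core_def)
      moreover have "\<rho> \<in> stirling_complex m"
        using finite_complexD(3)[OF finite_complex_stirling _ \<rho>] \<sigma> sub by blast
      moreover have "noncritical m \<rho>" using noncritical_mono[OF _ \<rho>] stirling_coreD[OF \<sigma> m] by blast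
      ultimately show ?thesis by (simp add: stirling_core_def)
    qed
  qed
  show e: "{} \<in> ?A" by (simp add: stirling_core_def)
  have "{(1, 1)} \<in> ?A" using m by (auto simp: stirling_core_def diagonal_def)
  moreover have "(\<lambda>v. if v = (1, 1) then 1 else 0) \<in> closed_simplex {(1::nat, 1::nat)}"
    by (simp add: closed_simplex_def)
  ultimately show "realization ?A \<noteq> {}" using realization_iff[OF fc] by blast
  show "contractible_space (geometric_realization ?A)"
  proof (rule contractible_realization_matching[OF fc e, where key = diag_key and e = "\<lambda>r. (r, r)"])
    fix \<sigma> assume \<sigma>: "\<sigma> \<in> ?A"
    note nc = stirling_coreD[OF \<sigma> m]
    let ?r = "diag_key \<sigma>"
    show "insert (?r, ?r) \<sigma> \<in> ?A"
    proof (cases "\<sigma> \<subseteq> diagonal m")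
      case True
      then have "insert (?r, ?r) \<sigma> \<subseteq> diagonal m"
        using diagonal_subset[OF True m] m by (auto simp: diagonal_def)
      then show ?thesis by (simp add: stirling_core_def)
    next
      case False
      show ?thesis
      proof (cases "(?r, ?r) \<in> \<sigma>")
        case True
        then show ?thesis using \<sigma> by (simp add: insert_absorb)
      next
        case new: False
        then have "card (insert (?r, ?r) \<sigma>) \<le> Suc k"
          using False \<sigma> stirling_complexD(1)[OF nc(1)] by (auto simp: stirling_core_def)
        moreover have "insert (?r, ?r) \<sigma> \<in> stirling_complex m"
          using stirling_complex_insert_diag[OF nc(1) diag_key[OF nc(2)]] .
        moreover have "noncritical m (insert (?r, ?r) \<sigma>)" using nc(2) by (simp add: noncritical_def)
        ultimately show ?thesis by (auto simp: stirling_core_def)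
      qed
    qed
  next
    fix \<sigma> \<rho> assume "\<rho> \<in> ?A" "\<sigma> \<subseteq> \<rho>"
    then show "diag_key \<sigma> \<le> diag_key \<rho>" using diag_key_mono stirling_coreD m by blast
  qed auto
qed

text \<open>With m rooks, both the columns and the rows exhaust 1..m, so column and row indices have
  equal sums. As no column index exceeds its row index, they agree for every rook.\<close>

lemma stirling_card_le:
  assumes "\<sigma> \<in> stirling_complex m"
  shows "card \<sigma> \<le> m" "card \<sigma> = m \<Longrightarrow> \<sigma> \<subseteq> diagonal m"
proof -
  note \<sigma> = stirling_complexD[OF assms]
  have c: "card (snd ` \<sigma>) = card \<sigma>" "card (fst ` \<sigma>) = card \<sigma>"
    using \<sigma>(2,3) by (auto simp: card_image)
  show "card \<sigma> \<le> m" using card_mono[OF _ \<sigma>(5)] c by simp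
  assume "card \<sigma> = m"
  then have "fst ` \<sigma> = {1..m}" "snd ` \<sigma> = {1..m}"
    using card_subset_eq[OF _ \<sigma>(4)] card_subset_eq[OF _ \<sigma>(5)] c by auto
  then have "sum fst \<sigma> = sum snd \<sigma>"
    using sum.reindex[OF \<sigma>(2), of "\<lambda>x. x"] sum.reindex[OF \<sigma>(3), of "\<lambda>x. x"] by (simp add: o_def)
  have "fst p = snd p" if "p \<in> \<sigma>" for p
  proof (rule ccontr)
    assume "fst p \<noteq> snd p"
    then have "fst p < snd p" using \<sigma>(6)[OF that] by simp
    then have "sum fst \<sigma> < sum snd \<sigma>"
      by (intro sum_strict_mono_ex1[OF \<sigma>(1)] ballI bexI[OF _ that] \<sigma>(6))
    then show False using \<open>sum fst \<sigma> = sum snd \<sigma>\<close> by simp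
  qed
  then show "\<sigma> \<subseteq> diagonal m" using \<sigma>(4) by (force simp: diagonal_def image_subset_iff)
qed

lemma stirling_core_complement:
  assumes "1 \<le> m" "2 * k < m" "\<sigma> \<in> stirling_complex m - stirling_core m k"
  shows "k < card \<sigma>" "card \<sigma> < m"
proof -
  have s: "\<sigma> \<in> stirling_complex m" "\<sigma> \<notin> stirling_core m k" using assms by auto
  show "k < card \<sigma>"
    using s critical_card[OF stirling_complexD(1)[OF s(1)], of m] assms(2)
    by (cases "noncritical m \<sigma>") (auto simp: stirling_core_def)
  show "card \<sigma> < m"
    using stirling_card_le[OF s(1)] s(2) by (fastforce simp: stirling_core_def)
qed

section \<open>Perfect matchings and the case m = 2n\<close>

definition square_facets :: "nat \<Rightarrow> (nat \<times> nat) set set" where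
  "square_facets n = {\<sigma> \<in> stirling_complex (2 * n). card \<sigma> = n \<and> \<sigma> \<subseteq> {1..n} \<times> {n + 1..2 * n}}"

lemma square_facetsD:
  assumes "\<sigma> \<in> square_facets n"
  shows "\<sigma> \<in> stirling_complex (2 * n)" "card \<sigma> = n" "fst ` \<sigma> = {1..n}" "snd ` \<sigma> = {n + 1..2 * n}"
    "\<not> noncritical (2 * n) \<sigma>"
proof -
  show s: "\<sigma> \<in> stirling_complex (2 * n)" "card \<sigma> = n"
    using assms by (auto simp: square_facets_def)
  note \<sigma> = stirling_complexD[OF s(1)]
  have "fst ` \<sigma> \<subseteq> {1..n}" "snd ` \<sigma> \<subseteq> {n + 1..2 * n}"
    using assms by (auto simp: square_facets_def)
  moreover have "card (fst ` \<sigma>) = n" "card (snd ` \<sigma>) = n"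
    using card_image[OF \<sigma>(2)] card_image[OF \<sigma>(3)] s(2) by auto
  ultimately show f: "fst ` \<sigma> = {1..n}" "snd ` \<sigma> = {n + 1..2 * n}"
    by (intro card_subset_eq; simp)+
  show "\<not> noncritical (2 * n) \<sigma>"
  proof
    assume "noncritical (2 * n) \<sigma>"
    then obtain r where r: "r \<in> {1..2 * n}" "diag_free \<sigma> r" by (auto simp: noncritical_def)
    then have "r \<in> fst ` \<sigma> \<union> snd ` \<sigma>" unfolding f by auto
    then have "(r, r) \<in> \<sigma>" using r(2) by (auto simp: diag_free_def)
    then have "r \<in> fst ` \<sigma>" "r \<in> snd ` \<sigma>" by force+
    then show False unfolding f by auto
  qed
qed

text \<open>The columns up to n and the rows above n are all occupied, so a further rook would have
  a column above n and a row of at most n, which lies outside the board.\<close>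

lemma square_facets_maximal:
  assumes "\<sigma> \<in> square_facets n" "\<tau> \<in> stirling_complex (2 * n)" "\<sigma> \<subseteq> \<tau>"
  shows "\<tau> = \<sigma>"
proof (rule ccontr)
  assume "\<tau> \<noteq> \<sigma>"
  then obtain p where p: "p \<in> \<tau>" "p \<notin> \<sigma>" using assms by blast
  note \<tau> = stirling_complexD[OF assms(2)] and \<sigma> = square_facetsD[OF assms(1)]
  have "fst p \<notin> fst ` \<sigma>" "snd p \<notin> snd ` \<sigma>"
    using p assms(3) inj_onD[OF \<tau>(2)] inj_onD[OF \<tau>(3)] by blast+
  moreover have "fst p \<in> {1..2 * n}" "snd p \<in> {1..2 * n}" using \<tau>(4,5) p(1) by blast+
  ultimately have "n < fst p" "snd p \<le> n" unfolding \<sigma> by (simp_all add: not_le)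
  then show False using \<tau>(6)[OF p(1)] by simp
qed

text \<open>A permutation \<open>\<pi>\<close> of 1..n gives the rooks (i, n + \<pi> i). Every
  square of this region is on the board, so \<open>\<pi>\<close> is arbitrary.\<close>

lemma card_square_facets: "card (square_facets n) = fact n"
proof -
  define \<Phi> where "\<Phi> \<pi> = (\<lambda>i. (i, n + \<pi> i)) ` {1..n}" for \<pi> :: "nat \<Rightarrow> nat"
  have "inj_on \<Phi> {\<pi>. \<pi> permutes {1..n}}"
  proof (rule inj_onI)
    fix \<pi> \<rho> assume a: "\<pi> \<in> {\<pi>. \<pi> permutes {1..n}}" "\<rho> \<in> {\<pi>. \<pi> permutes {1..n}}" "\<Phi> \<pi> = \<Phi> \<rho>"
    show "\<pi> = \<rho>"
    proof
      fix i show "\<pi> i = \<rho> i"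
      proof (cases "i \<in> {1..n}")
        case True
        then have "(i, n + \<pi> i) \<in> \<Phi> \<pi>" unfolding \<Phi>_def by (rule imageI)
        then have "(i, n + \<pi> i) \<in> \<Phi> \<rho>" unfolding a(3) .
        then show ?thesis by (auto simp: \<Phi>_def)
      qed (use a in \<open>auto simp: permutes_def\<close>)
    qed
  qed
  moreover have "\<Phi> ` {\<pi>. \<pi> permutes {1..n}} = square_facets n"
  proof
    show "\<Phi> ` {\<pi>. \<pi> permutes {1..n}} \<subseteq> square_facets n"
    proof safe
      fix \<pi> assume \<pi>: "\<pi> permutes {1..n}"
      have r: "\<pi> i \<in> {1..n}" if "i \<in> {1..n}" for i using permutes_in_image[OF \<pi>] that by blast
      have "inj \<pi>" using permutes_inj[OF \<pi>] .
      have "\<Phi> \<pi> \<subseteq> {1..n} \<times> {n + 1..2 * n}" using r by (fastforce simp: \<Phi>_def)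
      moreover have "card (\<Phi> \<pi>) = n"
        unfolding \<Phi>_def by (subst card_image) (auto simp: inj_on_def)
      moreover have "\<Phi> \<pi> \<subseteq> stirling_squares (2 * n)"
        using \<open>\<Phi> \<pi> \<subseteq> {1..n} \<times> {n + 1..2 * n}\<close> by (fastforce simp: stirling_squares_def)
      moreover have "\<forall>p\<in>\<Phi> \<pi>. \<forall>q\<in>\<Phi> \<pi>. p \<noteq> q \<longrightarrow> fst p \<noteq> fst q \<and> snd p \<noteq> snd q"
        using injD[OF \<open>inj \<pi>\<close>] by (auto simp: \<Phi>_def)
      ultimately show "\<Phi> \<pi> \<in> square_facets n" by (simp add: square_facets_def stirling_complex_def)
    qed
    show "square_facets n \<subseteq> \<Phi> ` {\<pi>. \<pi> permutes {1..n}}"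
    proof
      fix \<sigma> assume \<sigma>: "\<sigma> \<in> square_facets n"
      note f = square_facetsD[OF \<sigma>] and s = stirling_complexD[OF square_facetsD(1)[OF \<sigma>]]
      have "\<forall>i\<in>{1..n}. \<exists>p\<in>\<sigma>. fst p = i" using f(3) by (metis imageE)
      then obtain g where g: "\<And>i. i \<in> {1..n} \<Longrightarrow> g i \<in> \<sigma> \<and> fst (g i) = i" by metis
      define \<pi> where "\<pi> i = (if i \<in> {1..n} then snd (g i) - n else i)" for i
      have g2: "snd (g i) \<in> {n + 1..2 * n}" if "i \<in> {1..n}" for i
        using g[OF that] f(4) by auto
      have gp: "g i = (i, n + \<pi> i)" if "i \<in> {1..n}" for i
        using g[OF that] g2[OF that] that by (intro prod_eqI) (auto simp: \<pi>_def)
      have "inj_on \<pi> {1..n}"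
      proof (rule inj_onI)
        fix i j assume "i \<in> {1..n}" "j \<in> {1..n}" "\<pi> i = \<pi> j"
        then have "snd (g i) = snd (g j)" using gp[of i] gp[of j] by simp
        then have "g i = g j"
          by (rule inj_onD[OF s(3)]) (use g \<open>i \<in> {1..n}\<close> \<open>j \<in> {1..n}\<close> in blast)+
        then show "i = j" using gp[OF \<open>i \<in> {1..n}\<close>] gp[OF \<open>j \<in> {1..n}\<close>] by simp
      qed
      moreover have "\<pi> ` {1..n} \<subseteq> {1..n}" using g2 by (force simp: \<pi>_def)
      ultimately have "bij_betw \<pi> {1..n} {1..n}"
        by (simp add: bij_betw_def endo_inj_surj)
      then have "\<pi> permutes {1..n}" by (intro bij_imp_permutes) (auto simp: \<pi>_def)
      moreover have "\<Phi> \<pi> = \<sigma>"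
      proof (rule card_subset_eq[OF s(1)])
        show "\<Phi> \<pi> \<subseteq> \<sigma>" using gp g by (force simp: \<Phi>_def)
        show "card (\<Phi> \<pi>) = card \<sigma>"
          unfolding \<Phi>_def f(2) by (subst card_image) (auto simp: inj_on_def)
      qed
      ultimately show "\<sigma> \<in> \<Phi> ` {\<pi>. \<pi> permutes {1..n}}" by blast
    qed
  qed
  ultimately have "card (square_facets n) = card {\<pi>. \<pi> permutes {1..n}}"
    using card_image by fastforce
  also have "\<dots> = fact n" by (rule card_permutations) auto
  finally show ?thesis .
qed

text \<open>At most n columns and n rows have to cover 2n indices, so both bounds are attained and
  no index occurs as both. If, moreover, every column index were smaller than every row index,
  counting would force the columns to be 1..n and the rows n + 1..2n, and the placement would be a
  square facet.\<close>

lemma perfect_matching: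
  assumes \<sigma>: "\<sigma> \<in> stirling_complex (2 * n)" "\<not> noncritical (2 * n) \<sigma>" "card \<sigma> \<le> n"
  shows "card \<sigma> = n" "fst ` \<sigma> \<inter> snd ` \<sigma> = {}"
    "\<sigma> \<notin> square_facets n \<Longrightarrow> \<exists>p. fst p \<in> snd ` \<sigma> \<and> snd p \<in> fst ` \<sigma> \<and> fst p < snd p"
proof -
  note s = stirling_complexD[OF \<sigma>(1)]
  show c: "card \<sigma> = n" using critical_card[OF s(1) \<sigma>(2)] \<sigma>(3) by simp
  have cf: "card (fst ` \<sigma>) = n" "card (snd ` \<sigma>) = n" using s(2,3) c by (auto simp: card_image)
  have "2 * n \<le> card (fst ` \<sigma> \<union> snd ` \<sigma>)"
    using card_mono[OF _ critical_cover[OF \<sigma>(2)]] s(1) by simp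
  moreover have "card (fst ` \<sigma>) + card (snd ` \<sigma>) = card (fst ` \<sigma> \<union> snd ` \<sigma>) + card (fst ` \<sigma> \<inter> snd ` \<sigma>)"
    using s(1) by (intro card_Un_Int) auto
  ultimately have "card (fst ` \<sigma> \<inter> snd ` \<sigma>) = 0"
    using cf by linarith
  then show d: "fst ` \<sigma> \<inter> snd ` \<sigma> = {}" using s(1) by simp
  assume nf: "\<sigma> \<notin> square_facets n"
  show "\<exists>p. fst p \<in> snd ` \<sigma> \<and> snd p \<in> fst ` \<sigma> \<and> fst p < snd p"
  proof (rule ccontr)
    assume "\<not> ?thesis"
    then have sep: "k < j" if "j \<in> snd ` \<sigma>" "k \<in> fst ` \<sigma>" for j k
      using that d by (metis IntI empty_iff fst_conv linorder_neqE_nat snd_conv)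
    have "k \<le> n" if "k \<in> fst ` \<sigma>" for k
    proof -
      have "snd ` \<sigma> \<subseteq> {k<..2 * n}" using sep[OF _ that] s(5) by fastforce
      then have "n \<le> card {k<..2 * n}" using card_mono[of "{k<..2 * n}" "snd ` \<sigma>"] cf by simp
      moreover have "k \<le> 2 * n" using that s(4) by auto
      ultimately show ?thesis by simp
    qed
    moreover have "n + 1 \<le> j" if "j \<in> snd ` \<sigma>" for j
    proof -
      have "fst ` \<sigma> \<subseteq> {1..<j}" using sep[OF that] s(4) by fastforce
      then have "n \<le> card {1..<j}" using card_mono[of "{1..<j}" "fst ` \<sigma>"] cf by simp
      moreover have "1 \<le> j" using that s(5) by auto
      ultimately show ?thesis by simp
    qed
    moreover have "1 \<le> k" if "k \<in> fst ` \<sigma>" for k using that s(4) by auto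
    moreover have "j \<le> 2 * n" if "j \<in> snd ` \<sigma>" for j using that s(5) by auto
    ultimately have "\<sigma> \<subseteq> {1..n} \<times> {n + 1..2 * n}"
      by (intro subsetI) (simp add: mem_Times_iff)
    then show False using nf \<sigma>(1) c by (simp add: square_facets_def)
  qed
qed

text \<open>The critical placements of size n that are not facets are perfect matchings of the numbers up to
  2 n in which some row index j (a closing element) is smaller than some column index k (an opening
  element). Such a placement is matched with the one obtained by adding the square (j, k), which
  can be recovered from it as the middle edge of the only path with three edges.\<close>

lemma stirling_core_even:
  assumes n: "1 \<le> n"
  shows "\<exists>A. finite_complex A \<and> {} \<in> A \<and> A \<subseteq> stirling_complex (2 * n) - square_facets n \<and>
    realization A \<noteq> {} \<and> contractible_space (geometric_realization A) \<and>
    (\<forall>\<sigma>\<in>stirling_complex (2 * n) - square_facets n. card \<sigma> \<le> n \<longrightarrow> \<sigma> \<in> A) \<and>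
    (\<forall>\<sigma>\<in>square_facets n. \<forall>\<rho>. \<rho> \<subset> \<sigma> \<longrightarrow> \<rho> \<in> A)"
proof -
  let ?C = "stirling_core (2 * n) n" and ?S = "stirling_complex (2 * n)"
  have m: "1 \<le> 2 * n" using n by simp
  note core = stirling_core[OF m, of n]
  define N where "N = {\<sigma> \<in> ?S. \<not> noncritical (2 * n) \<sigma> \<and> card \<sigma> \<le> n \<and> \<sigma> \<notin> square_facets n}"
  define e where "e \<sigma> = (SOME p. fst p \<in> snd ` \<sigma> \<and> snd p \<in> fst ` \<sigma> \<and> fst p < snd p)"
    for \<sigma> :: "(nat \<times> nat) set"
  let ?\<mu> = "\<lambda>\<sigma>. insert (e \<sigma>) \<sigma>"
  let ?A = "?C \<union> N \<union> ?\<mu> ` N"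
  have low: "\<rho> \<in> ?C" if "\<rho> \<in> ?S" "card \<rho> \<le> n" "noncritical (2 * n) \<rho>" for \<rho>
    using that by (simp add: stirling_core_def)
  have N: "\<sigma> \<in> ?S" "\<not> noncritical (2 * n) \<sigma>" "card \<sigma> = n" "fst ` \<sigma> \<inter> snd ` \<sigma> = {}" "finite \<sigma>"
    "fst (e \<sigma>) \<in> snd ` \<sigma>" "snd (e \<sigma>) \<in> fst ` \<sigma>" "fst (e \<sigma>) < snd (e \<sigma>)"
    "e \<sigma> \<notin> \<sigma>" "?\<mu> \<sigma> \<in> ?S" if "\<sigma> \<in> N" for \<sigma>
  proof -
    show s: "\<sigma> \<in> ?S" "\<not> noncritical (2 * n) \<sigma>" using that by (auto simp: N_def)
    have s': "card \<sigma> \<le> n" "\<sigma> \<notin> square_facets n" using that by (auto simp: N_def)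
    note pm = perfect_matching[OF s s'(1)]
    show "card \<sigma> = n" and d: "fst ` \<sigma> \<inter> snd ` \<sigma> = {}" using pm by auto
    show "finite \<sigma>" using stirling_complexD(1)[OF s(1)] .
    have *: "fst (e \<sigma>) \<in> snd ` \<sigma> \<and> snd (e \<sigma>) \<in> fst ` \<sigma> \<and> fst (e \<sigma>) < snd (e \<sigma>)"
      unfolding e_def by (rule someI_ex[OF pm(3)[OF s'(2)]])
    then show e: "fst (e \<sigma>) \<in> snd ` \<sigma>" "snd (e \<sigma>) \<in> fst ` \<sigma>" "fst (e \<sigma>) < snd (e \<sigma>)" by auto
    show "e \<sigma> \<notin> \<sigma>" using e(1) d by blast
    have "insert (fst (e \<sigma>), snd (e \<sigma>)) \<sigma> \<in> ?S"
      using e d stirling_complexD(4,5)[OF s(1)]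
      by (intro stirling_complex_insert[OF s(1)]) (auto simp: disjoint_iff dest: subsetD)
    then show "?\<mu> \<sigma> \<in> ?S" by simp
  qed
  have below: "\<rho> \<in> ?C" if \<sigma>: "\<sigma> \<in> N" and \<rho>: "\<rho> \<subseteq> ?\<mu> \<sigma>" "\<rho> \<noteq> \<sigma>" "\<rho> \<noteq> ?\<mu> \<sigma>" for \<sigma> \<rho>
  proof -
    note s = N[OF \<sigma>]
    have \<rho>S: "\<rho> \<in> ?S" using finite_complexD(3)[OF finite_complex_stirling s(10) \<rho>(1)] .
    have "card \<rho> < card (?\<mu> \<sigma>)" using \<rho> s(5) by (intro psubset_card_mono) auto
    then have c: "card \<rho> \<le> n" using s(3,5,9) by simp
    have "noncritical (2 * n) \<rho>"
    proof (rule ccontr)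
      \<comment> \<open>Such a face would be a perfect matching with n rooks. It contains e
        \<sigma>, since otherwise it would be an n-element subset of \<open>\<sigma>\<close>, hence
        \<open>\<sigma>\<close>. But then both rooks of \<open>\<sigma>\<close> that share an index
        with e \<sigma> must be missing, and only n - 1 rooks remain.\<close>
      assume nc: "\<not> noncritical (2 * n) \<rho>"
      note pm = perfect_matching[OF \<rho>S nc c]
      have "e \<sigma> \<in> \<rho>"
      proof (rule ccontr)
        assume "e \<sigma> \<notin> \<rho>"
        then have "\<rho> \<subseteq> \<sigma>" using \<rho>(1) by blast
        then show False using \<rho>(2) card_subset_eq[OF s(5)] pm(1) s(3) by auto
      qed
      obtain p q where pq: "p \<in> \<sigma>" "q \<in> \<sigma>" "snd p = fst (e \<sigma>)" "fst q = snd (e \<sigma>)"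
        using s(6,7) by (metis imageE)
      have "p \<notin> \<rho>"
        using \<open>e \<sigma> \<in> \<rho>\<close> pm(2) pq(3) by (metis IntI emptyE imageI)
      moreover have "q \<notin> \<rho>"
        using \<open>e \<sigma> \<in> \<rho>\<close> pm(2) pq(4) by (metis IntI emptyE imageI)
      moreover have "p \<noteq> q" using stirling_complexD(6)[OF s(1) pq(1)] s(8) pq by auto
      ultimately have "\<rho> \<subseteq> ?\<mu> \<sigma> - {p, q}" using \<rho>(1) by blast
      then have "card \<rho> \<le> card (?\<mu> \<sigma> - {p, q})" using s(5) by (intro card_mono) auto
      also have "\<dots> = Suc n - 2"
        using pq \<open>p \<noteq> q\<close> s(3,5,9) by (subst card_Diff_subset) auto
      finally show False using pm(1) n by simp
    qed
    then show ?thesis using low \<rho>S c by blast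
  qed
  have NC: "\<sigma> \<notin> ?C" if "\<sigma> \<in> N" for \<sigma> using N(2)[OF that] stirling_coreD(2)[OF _ m] by blast
  have "finite N" using finite_complexD(1)[OF finite_complex_stirling] by (simp add: N_def)
  have "finite_complex ?A \<and> contractible_space (geometric_realization ?A)"
  proof (rule contractible_realization_add_free_pairs[OF core(1,4) \<open>finite N\<close>])
    fix \<sigma> assume "\<sigma> \<in> N"
    then show "finite \<sigma> \<and> \<sigma> \<noteq> {} \<and> e \<sigma> \<notin> \<sigma> \<and> \<sigma> \<notin> ?C"
      using N(3,5,9)[of \<sigma>] NC n by auto
  qed (rule below)
  moreover have "{} \<in> ?A" using core(2) by blast
  moreover have "?A \<subseteq> ?S - square_facets n"
  proof
    fix \<sigma> assume "\<sigma> \<in> ?A"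
    then consider "\<sigma> \<in> ?C" | "\<sigma> \<in> N" | \<rho> where "\<rho> \<in> N" "\<sigma> = ?\<mu> \<rho>" by blast
    then show "\<sigma> \<in> ?S - square_facets n"
    proof cases
      case 1
      then show ?thesis using stirling_coreD[OF 1 m] square_facetsD(5) by blast
    next
      case 2
      then show ?thesis by (simp add: N_def)
    next
      case 3
      then have "card \<sigma> = Suc n" using N(3,5,9)[of \<rho>] by simp
      then show ?thesis using N(10)[OF 3(1)] 3(2) square_facetsD(2)[of \<sigma> n] by auto
    qed
  qed
  moreover have "realization ?A \<noteq> {}" using core(3) realization_mono[of ?C ?A] by blast
  moreover have "\<forall>\<sigma>\<in>?S - square_facets n. card \<sigma> \<le> n \<longrightarrow> \<sigma> \<in> ?A"
    using low by (auto simp: N_def)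
  moreover have "\<forall>\<sigma>\<in>square_facets n. \<forall>\<rho>. \<rho> \<subset> \<sigma> \<longrightarrow> \<rho> \<in> ?A"
  proof (intro ballI allI impI)
    fix \<sigma> \<rho> assume \<sigma>: "\<sigma> \<in> square_facets n" "\<rho> \<subset> \<sigma>"
    have "\<rho> \<in> ?S" using finite_complexD(3)[OF finite_complex_stirling square_facetsD(1)[OF \<sigma>(1)]] \<sigma>(2) by blast
    moreover have "finite \<sigma>" using stirling_complexD(1) square_facetsD(1)[OF \<sigma>(1)] by blast
    then have "card \<rho> < n" using \<sigma> square_facetsD(2)[OF \<sigma>(1)] by (metis psubset_card_mono)
    moreover have "noncritical (2 * n) \<rho>"
      using critical_card[OF stirling_complexD(1)[OF \<open>\<rho> \<in> ?S\<close>], of "2 * n"] \<open>card \<rho> < n\<close> by fastforce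
    ultimately show "\<rho> \<in> ?A" using low by simp
  qed
  ultimately show ?thesis by blast
qed

section \<open>Wedges of spheres\<close>

lemma continuous_map_sum_topology:
  "continuous_map (sum_topology X I) Y f \<longleftrightarrow> (\<forall>i\<in>I. continuous_map (X i) Y (\<lambda>x. f (i, x)))"
proof
  assume f: "continuous_map (sum_topology X I) Y f"
  show "\<forall>i\<in>I. continuous_map (X i) Y (\<lambda>x. f (i, x))"
    using continuous_map_compose[OF continuous_map_component_injection f] by (auto simp: o_def)
next
  assume f: "\<forall>i\<in>I. continuous_map (X i) Y (\<lambda>x. f (i, x))"
  show "continuous_map (sum_topology X I) Y f"
    unfolding continuous_map_def openin_sum_topology
  proof (intro conjI allI impI ballI)
    show "f \<in> topspace (sum_topology X I) \<rightarrow> topspace Y"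
      using f by (force simp: continuous_map_def)
    fix U assume "openin Y U"
    show "{x \<in> topspace (sum_topology X I). f x \<in> U} \<subseteq> Sigma I (topspace \<circ> X)" by auto
    fix i assume i: "i \<in> I"
    have "{x. (i, x) \<in> {x \<in> topspace (sum_topology X I). f x \<in> U}} = {x \<in> topspace (X i). f (i, x) \<in> U}"
      using i by auto
    then show "openin (X i) {x. (i, x) \<in> {x \<in> topspace (sum_topology X I). f x \<in> U}}"
      using openin_continuous_map_preimage[OF bspec[OF f i] \<open>openin Y U\<close>] by simp
  qed
qed

definition wedge_class :: "('i \<Rightarrow> 'a) \<Rightarrow> 'i set \<Rightarrow> 'i \<times> 'a \<Rightarrow> ('i \<times> 'a) set" where
  "wedge_class b I p = (if p \<in> (\<lambda>i. (i, b i)) ` I then (\<lambda>i. (i, b i)) ` I else {p})"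

lemma wedge_sum_eq: "wedge_sum X b I = quotient_topology (sum_topology X I) (wedge_class b I)"
  by (simp add: wedge_sum_def wedge_class_def[abs_def] Let_def)

lemma quotient_map_wedge_class: "quotient_map (sum_topology X I) (wedge_sum X b I) (wedge_class b I)"
  unfolding wedge_sum_eq by (rule quotient_map_quotient_topology)

lemma wedge_class_eq_iff:
  assumes "i \<in> I" "j \<in> I"
  shows "wedge_class b I (i, x) = wedge_class b I (j, y) \<longleftrightarrow> i = j \<and> x = y \<or> x = b i \<and> y = b j"
proof -
  have "(i, x) \<in> (\<lambda>i. (i, b i)) ` I \<longleftrightarrow> x = b i" "(j, y) \<in> (\<lambda>i. (i, b i)) ` I \<longleftrightarrow> y = b j"
    using assms by auto
  then show ?thesis unfolding wedge_class_def by auto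
qed

lemma continuous_map_wedge_class: "i \<in> I \<Longrightarrow> continuous_map (X i) (wedge_sum X b I) (\<lambda>x. wedge_class b I (i, x))"
  using continuous_map_compose[OF continuous_map_component_injection
      quotient_imp_continuous_map[OF quotient_map_wedge_class]]
  by (auto simp: o_def)

text \<open>The wedge maps continuously and injectively into the product of its summands, as the set
  of points with at most one coordinate off the base point; the Hausdorff property pulls back along
  such a map.\<close>

lemma Hausdorff_wedge_sum:
  assumes X: "\<And>i. i \<in> I \<Longrightarrow> Hausdorff_space (X i)" and b: "\<And>i. i \<in> I \<Longrightarrow> b i \<in> topspace (X i)"
  shows "Hausdorff_space (wedge_sum X b I)"
proof -
  let ?P = "product_topology X I"
  define \<iota> where "\<iota> p = restrict (\<lambda>j. if j = fst p then snd p else b j) I" for p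
  have c\<iota>: "continuous_map (sum_topology X I) ?P \<iota>"
    unfolding continuous_map_sum_topology
  proof
    fix i assume i: "i \<in> I"
    show "continuous_map (X i) ?P (\<lambda>x. \<iota> (i, x))"
      unfolding continuous_map_componentwise
    proof (intro conjI ballI)
      fix j assume j: "j \<in> I"
      then show "continuous_map (X i) (X j) (\<lambda>x. \<iota> (i, x) j)"
        using b by (cases "j = i") (auto simp: \<iota>_def)
    qed (auto simp: \<iota>_def)
  qed
  have \<iota>_eq: "\<iota> (i, x) = \<iota> (j, y) \<longleftrightarrow> i = j \<and> x = y \<or> x = b i \<and> y = b j" if "i \<in> I" "j \<in> I" for i j x y
  proof
    assume eq: "\<iota> (i, x) = \<iota> (j, y)"
    show "i = j \<and> x = y \<or> x = b i \<and> y = b j"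
      using fun_cong[OF eq, of i] fun_cong[OF eq, of j] that by (cases "i = j") (auto simp: \<iota>_def)
  next
    assume "i = j \<and> x = y \<or> x = b i \<and> y = b j"
    then show "\<iota> (i, x) = \<iota> (j, y)" by (auto simp: \<iota>_def fun_eq_iff)
  qed
  obtain \<kappa> where \<kappa>: "continuous_map (wedge_sum X b I) ?P \<kappa>"
    "\<And>p. p \<in> topspace (sum_topology X I) \<Longrightarrow> \<kappa> (wedge_class b I p) = \<iota> p"
  proof (rule quotient_map_lift_exists[OF quotient_map_wedge_class c\<iota>])
    fix p p' assume "p \<in> topspace (sum_topology X I)" "p' \<in> topspace (sum_topology X I)"
      "wedge_class b I p = wedge_class b I p'"
    then show "\<iota> p = \<iota> p'"
      using \<iota>_eq[of "fst p" "fst p'" "snd p" "snd p'"] wedge_class_eq_iff[of "fst p" I "fst p'" b "snd p" "snd p'"]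
      by (cases p; cases p') simp
  qed auto
  have "inj_on \<kappa> (topspace (wedge_sum X b I))"
  proof (rule inj_onI)
    fix v v' assume v: "v \<in> topspace (wedge_sum X b I)" "v' \<in> topspace (wedge_sum X b I)" "\<kappa> v = \<kappa> v'"
    have "v \<in> wedge_class b I ` topspace (sum_topology X I)" "v' \<in> wedge_class b I ` topspace (sum_topology X I)"
      unfolding quotient_imp_surjective_map[OF quotient_map_wedge_class] using v by auto
    then obtain p p' where p: "p \<in> topspace (sum_topology X I)" "v = wedge_class b I p"
      "p' \<in> topspace (sum_topology X I)" "v' = wedge_class b I p'"
      by (elim imageE)
    then have "\<iota> p = \<iota> p'" using v(3) \<kappa>(2) by simp
    moreover obtain i x j y where "p = (i, x)" "p' = (j, y)" by (cases p; cases p')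
    ultimately show "v = v'" using p \<iota>_eq[of i j x y] wedge_class_eq_iff[of i I j b x y] by auto
  qed
  moreover have "Hausdorff_space ?P" using X by (simp add: Hausdorff_space_product_topology)
  ultimately show ?thesis using Hausdorff_space_injective_preimage[OF _ \<kappa>(1)] by blast
qed

text \<open>With r the squared norm of u, the image of u has first coordinate 2r - 1 and remaining
  coordinates 2 sqrt(1 - r) u. It lies on the sphere because (2r - 1)^2 + 4r(1 - r) = 1. The
  boundary goes to the base point and the centre to its antipode; for d = 0 the one point of the
  disk goes to -1.\<close>

lemma disk_onto_sphere:
  "\<exists>c. continuous_map (disk d) (nsphere d) c \<and>
    (\<forall>u\<in>topspace (disk d). c u = nsphere_base \<longleftrightarrow> u \<notin> disk_interior d) \<and>
    inj_on c (disk_interior d) \<and>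
    (\<forall>y\<in>sphere_set d. y \<noteq> nsphere_base \<longrightarrow> (\<exists>u\<in>disk_interior d. c u = y))"
proof -
  let ?D = "{u. (\<forall>i\<ge>d. u i = 0) \<and> (\<Sum>i<d. u i ^ 2) \<le> (1::real)}"
  define r2 where "r2 u = (\<Sum>i<d. u i ^ 2)" for u :: "nat \<Rightarrow> real"
  define c where "c u j = (case j of 0 \<Rightarrow> 2 * r2 u - 1 | Suc i \<Rightarrow> 2 * sqrt (1 - r2 u) * u i)"
    for u :: "nat \<Rightarrow> real" and j
  have c0: "c u 0 = 2 * r2 u - 1" and cS: "c u (Suc i) = 2 * sqrt (1 - r2 u) * u i" for u i
    by (auto simp: c_def)
  have sum0: "(\<Sum>k\<le>d. f k) = f 0 + (\<Sum>i<d. f (Suc i))" for f :: "nat \<Rightarrow> real"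
    by (simp only: lessThan_Suc_atMost[symmetric] sum.lessThan_Suc_shift)
  have cr: "continuous_on S r2" for S
    unfolding r2_def by (intro continuous_on_sum continuous_on_power continuous_on_eval)
  have cc: "continuous_on S c" for S
  proof (rule continuous_on_coordinatewise_then_product)
    fix j show "continuous_on S (\<lambda>u. c u j)"
      unfolding c_def
      by (cases j) (auto intro!: continuous_on_mult continuous_on_real_sqrt continuous_on_diff
          continuous_on_eval continuous_on_const cr)
  qed
  have csq: "(\<Sum>i<d. c u (Suc i) ^ 2) = 4 * (1 - r2 u) * r2 u" if "r2 u \<le> 1" for u
  proof -
    have "(\<Sum>i<d. c u (Suc i) ^ 2) = (\<Sum>i<d. 4 * (1 - r2 u) * u i ^ 2)"
      using that by (intro sum.cong) (auto simp: cS power_mult_distrib)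
    then show ?thesis by (simp add: r2_def sum_distrib_left)
  qed
  have cS_in: "c u \<in> sphere_set d" if "u \<in> ?D" for u
  proof -
    have "r2 u \<le> 1" using that by (simp add: r2_def)
    then have "(\<Sum>k\<le>d. c u k ^ 2) = (2 * r2 u - 1) ^ 2 + 4 * (1 - r2 u) * r2 u"
      unfolding sum0 using csq by (simp add: c0)
    also have "\<dots> = 1" by (simp add: power2_eq_square algebra_simps)
    finally have "(\<Sum>k\<le>d. c u k ^ 2) = 1" .
    moreover have "c u k = 0" if "d < k" for k
      using that \<open>u \<in> ?D\<close> by (cases k) (auto simp: cS)
    ultimately show ?thesis by (simp add: sphere_set_def)
  qed
  have int: "u \<in> disk_interior d \<longleftrightarrow> r2 u < 1" if "u \<in> ?D" for u
    using that by (auto simp: disk_interior_eq r2_def)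
  have base: "c u = nsphere_base \<longleftrightarrow> u \<notin> disk_interior d" if u: "u \<in> ?D" for u
  proof
    assume "c u = nsphere_base"
    then have "r2 u = 1" using c0[of u] by (simp add: nsphere_base_def)
    then show "u \<notin> disk_interior d" using int[OF u] by simp
  next
    assume "u \<notin> disk_interior d"
    then have "r2 u = 1" using int[OF u] u by (auto simp: r2_def)
    then show "c u = nsphere_base"
      by (auto simp: fun_eq_iff nsphere_base_def c_def split: nat.split)
  qed
  have inj: "inj_on c (disk_interior d)"
  proof (rule inj_onI, rule ext)
    fix u v i assume u: "u \<in> disk_interior d" and v: "v \<in> disk_interior d" and eq: "c u = c v"
    have "r2 u = r2 v" using fun_cong[OF eq, of 0] by (simp add: c0)
    moreover have "r2 v < 1" using v by (simp add: disk_interior_eq r2_def)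
    ultimately show "u i = v i" using fun_cong[OF eq, of "Suc i"] by (simp add: cS)
  qed
  have surj: "\<exists>u\<in>disk_interior d. c u = y" if y: "y \<in> sphere_set d" "y \<noteq> nsphere_base" for y
  proof -
    have sq: "y 0 ^ 2 + (\<Sum>i<d. y (Suc i) ^ 2) = 1" and off: "\<And>k. d < k \<Longrightarrow> y k = 0"
      using y(1) by (auto simp: sphere_set_def sum0)
    have "y 0 \<noteq> 1"
    proof
      assume 1: "y 0 = 1"
      then have "\<forall>i<d. y (Suc i) = 0" using sq by (simp add: sum_nonneg_eq_0_iff)
      then have "y k = nsphere_base k" for k
        using 1 off[of k] by (cases k) (auto simp: nsphere_base_def, metis Suc_lessI not_less_eq)
      then show False using y(2) by blast
    qed
    moreover have y0: "\<bar>y 0\<bar> \<le> 1" using sphere_set_le_1[OF y(1)] .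
    ultimately have y1: "y 0 < 1" "- 1 \<le> y 0" by auto
    \<comment> \<open>The first coordinate forces 1 - r2 u = (1 - y 0) / 2, so \<open>t\<close> is
      the factor 2 * sqrt (1 - r2 u) by which the other coordinates of y must be divided.\<close>
    define t where "t = 2 * sqrt ((1 - y 0) / 2)"
    have t: "0 < t" "t ^ 2 = 2 * (1 - y 0)" using y1 by (auto simp: t_def power_mult_distrib)
    define u where "u i = y (Suc i) / t" for i
    have "r2 u = (\<Sum>i<d. y (Suc i) ^ 2) / t ^ 2"
      by (simp add: r2_def u_def power_divide sum_divide_distrib)
    also have "(\<Sum>i<d. y (Suc i) ^ 2) = 1 - y 0 ^ 2" using sq by linarith
    also have "(1 - y 0 ^ 2) / t ^ 2 = (1 - y 0 ^ 2) / (2 * (1 - y 0))" by (simp only: t(2))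
    also have "\<dots> = (1 + y 0) / 2"
      using y1 by (simp add: field_simps power2_eq_square)
    finally have r: "r2 u = (1 + y 0) / 2" .
    have "c u k = y k" for k
    proof (cases k)
      case (Suc i)
      have "2 * sqrt (1 - r2 u) = t" unfolding t_def r by (simp add: field_simps)
      then show ?thesis using t Suc by (simp add: cS u_def)
    qed (simp add: c0 r field_simps)
    moreover have "u \<in> disk_interior d"
      using r y1 off by (simp add: disk_interior_eq r2_def u_def)
    ultimately show ?thesis by blast
  qed
  have "continuous_map (disk d) (nsphere d) c"
    using cc cS_in by (auto simp: disk_eq nsphere_eq)
  then show ?thesis using base inj surj by (intro exI[of _ c]) (auto simp: disk_eq)
qed

lemma closed_simplex_onto_sphere:
  assumes "finite \<sigma>" "card \<sigma> = Suc d"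
  shows "\<exists>s. continuous_map (top_of_set (closed_simplex \<sigma>)) (nsphere d) s \<and>
    (\<forall>x\<in>closed_simplex \<sigma>. s x = nsphere_base \<longleftrightarrow> x \<notin> open_simplex \<sigma>) \<and>
    inj_on s (open_simplex \<sigma>) \<and>
    (\<forall>y\<in>sphere_set d. y \<noteq> nsphere_base \<longrightarrow> (\<exists>x\<in>open_simplex \<sigma>. s x = y))"
proof -
  let ?S = "closed_simplex \<sigma>"
  obtain \<Phi> \<Psi> where h: "homeomorphic_maps (disk d) (top_of_set ?S) \<Phi> \<Psi>"
    and int: "\<And>x. x \<in> ?S \<Longrightarrow> \<Psi> x \<in> disk_interior d \<longleftrightarrow> x \<in> open_simplex \<sigma>"
    using disk_closed_simplex_homeomorphic[OF assms] by blast
  have \<Psi>: "continuous_map (top_of_set ?S) (disk d) \<Psi>" and \<Phi>: "continuous_map (disk d) (top_of_set ?S) \<Phi>"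
    using h by (auto simp: homeomorphic_maps_def)
  have \<Psi>D: "\<Psi> x \<in> topspace (disk d)" if "x \<in> ?S" for x
    using continuous_map_image_subset_topspace[OF \<Psi>] that by auto
  have \<Phi>S: "\<Phi> u \<in> ?S" if "u \<in> topspace (disk d)" for u
    using continuous_map_image_subset_topspace[OF \<Phi>] that by auto
  have \<Phi>\<Psi>: "\<Phi> (\<Psi> x) = x" if "x \<in> ?S" for x using h that by (auto simp: homeomorphic_maps_def)
  have \<Psi>\<Phi>: "\<Psi> (\<Phi> u) = u" if "u \<in> topspace (disk d)" for u
    using h that by (auto simp: homeomorphic_maps_def)
  obtain c where c: "continuous_map (disk d) (nsphere d) c"
    "\<And>u. u \<in> topspace (disk d) \<Longrightarrow> c u = nsphere_base \<longleftrightarrow> u \<notin> disk_interior d"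
    "inj_on c (disk_interior d)"
    "\<And>y. y \<in> sphere_set d \<Longrightarrow> y \<noteq> nsphere_base \<Longrightarrow> \<exists>u\<in>disk_interior d. c u = y"
    using disk_onto_sphere[of d] by blast
  have OS: "x \<in> ?S" if "x \<in> open_simplex \<sigma>" for x using that by (simp add: open_simplex_def)
  show ?thesis
  proof (intro exI[of _ "c \<circ> \<Psi>"] conjI ballI impI)
    show "continuous_map (top_of_set ?S) (nsphere d) (c \<circ> \<Psi>)"
      by (rule continuous_map_compose[OF \<Psi> c(1)])
    show "(c \<circ> \<Psi>) x = nsphere_base \<longleftrightarrow> x \<notin> open_simplex \<sigma>" if "x \<in> ?S" for x
      using c(2)[OF \<Psi>D[OF that]] int[OF that] by simp
    show "inj_on (c \<circ> \<Psi>) (open_simplex \<sigma>)"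
    proof (rule inj_onI)
      fix x y assume x: "x \<in> open_simplex \<sigma>" and y: "y \<in> open_simplex \<sigma>" and eq: "(c \<circ> \<Psi>) x = (c \<circ> \<Psi>) y"
      have "\<Psi> x = \<Psi> y"
        using inj_onD[OF c(3), of "\<Psi> x" "\<Psi> y"] eq int[OF OS[OF x]] int[OF OS[OF y]] x y by simp
      then show "x = y" using \<Phi>\<Psi>[OF OS[OF x]] \<Phi>\<Psi>[OF OS[OF y]] by metis
    qed
    fix y assume "y \<in> sphere_set d" "y \<noteq> nsphere_base"
    then obtain u where u: "u \<in> disk_interior d" "c u = y" using c(4) by blast
    have uD: "u \<in> topspace (disk d)" using u(1) by (simp add: disk_eq disk_interior_eq)
    have "\<Phi> u \<in> open_simplex \<sigma>" using int[OF \<Phi>S[OF uD]] \<Psi>\<Phi>[OF uD] u(1) by simp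
    then show "\<exists>x\<in>open_simplex \<sigma>. (c \<circ> \<Psi>) x = y"
      using \<Psi>\<Phi>[OF uD] u(2) by (intro bexI[of _ "\<Phi> u"]) simp_all
  qed
qed

text \<open>\<open>Q\<close> is \<open>q\<close> on the complex without \<open>F\<close> and the map
  onto a sphere on each facet in \<open>F\<close>. The pieces fit together because the facets meet
  each other and the rest only in their boundaries; these lie in \<open>A\<close>, so all pieces
  send them to the wedge point. The nontrivial fibre of \<open>Q\<close> is then the realization of
  \<open>A\<close>, and the wedge is recognized as the quotient of the whole complex by
  \<open>A\<close>.\<close>

lemma realization_homotopy_equivalent_wedge:
  fixes K :: "'v::countable set set"
  assumes K: "finite_complex K" and L: "finite_complex (K - F)" and F: "F \<subseteq> K"
    and A: "finite_complex A" "A \<subseteq> K - F" "{} \<in> A" "realization A \<noteq> {}"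
    and con: "contractible_space (geometric_realization A)"
    and cF: "card F = k" "\<And>\<sigma>. \<sigma> \<in> F \<Longrightarrow> card \<sigma> = Suc d"
    and max: "\<And>\<sigma> \<tau>. \<sigma> \<in> F \<Longrightarrow> \<tau> \<in> K \<Longrightarrow> \<sigma> \<subseteq> \<tau> \<Longrightarrow> \<tau> = \<sigma>"
    and bd: "\<And>\<sigma> \<rho>. \<sigma> \<in> F \<Longrightarrow> \<rho> \<subset> \<sigma> \<Longrightarrow> \<rho> \<in> A"
  shows "geometric_realization K homotopy_equivalent_space
    wedge_of_spheres_with k d (top_of_set (collapse_map (K - F) A ` realization (K - F))) (\<lambda>_. 0)"
proof -
  let ?L = "K - F"
  interpret subcomplex_pair ?L A by unfold_locales (use L A in auto)
  have "finite F" using finite_complexD(1)[OF K] F by (rule rev_finite_subset)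
  then obtain \<phi> where "bij_betw \<phi> {0..<k} F" using ex_bij_betw_nat_finite cF(1) by blast
  then have \<phi>: "bij_betw \<phi> {..<k} F" by (simp add: atLeast0LessThan)
  have \<phi>F: "\<phi> i \<in> F" if "i < k" for i using \<phi> that by (auto simp: bij_betw_def)
  have \<phi>K: "\<phi> i \<in> K" if "i < k" for i using \<phi>F[OF that] F by blast
  have \<phi>fin: "finite (\<phi> i)" if "i < k" for i using finite_complexD(2)[OF K \<phi>K[OF that]] .
  have "\<forall>i\<in>{..<k}. \<exists>s. continuous_map (top_of_set (closed_simplex (\<phi> i))) (nsphere d) s \<and>
    (\<forall>x\<in>closed_simplex (\<phi> i). s x = nsphere_base \<longleftrightarrow> x \<notin> open_simplex (\<phi> i)) \<and>
    inj_on s (open_simplex (\<phi> i)) \<and>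
    (\<forall>y\<in>sphere_set d. y \<noteq> nsphere_base \<longrightarrow> (\<exists>x\<in>open_simplex (\<phi> i). s x = y))"
    by (intro ballI closed_simplex_onto_sphere) (use \<phi>fin cF(2) \<phi>F in auto)
  then obtain s where "\<forall>i\<in>{..<k}. continuous_map (top_of_set (closed_simplex (\<phi> i))) (nsphere d) (s i) \<and>
    (\<forall>x\<in>closed_simplex (\<phi> i). s i x = nsphere_base \<longleftrightarrow> x \<notin> open_simplex (\<phi> i)) \<and>
    inj_on (s i) (open_simplex (\<phi> i)) \<and>
    (\<forall>y\<in>sphere_set d. y \<noteq> nsphere_base \<longrightarrow> (\<exists>x\<in>open_simplex (\<phi> i). s i x = y))"
    by (rule bchoice[THEN exE])
  then have s: "continuous_map (top_of_set (closed_simplex (\<phi> i))) (nsphere d) (s i)"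
    "\<And>x. x \<in> closed_simplex (\<phi> i) \<Longrightarrow> s i x = nsphere_base \<longleftrightarrow> x \<notin> open_simplex (\<phi> i)"
    "inj_on (s i) (open_simplex (\<phi> i))"
    "\<And>y. y \<in> sphere_set d \<Longrightarrow> y \<noteq> nsphere_base \<Longrightarrow> \<exists>x\<in>open_simplex (\<phi> i). s i x = y" if "i < k" for i
    using that by auto
  define XX where "XX i = (if i < k then nsphere d else top_of_set (q ` realization ?L))" for i
  define bb where "bb i = (if i < k then nsphere_base else (\<lambda>_. 0))" for i
  let ?W = "wedge_sum XX bb {..k}" and ?\<pi> = "wedge_class bb {..k}"
  have W: "wedge_of_spheres_with k d (top_of_set (q ` realization ?L)) (\<lambda>_. 0) = ?W"
    by (simp add: wedge_of_spheres_with_def XX_def[abs_def] bb_def[abs_def])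
  have zL: "(\<lambda>_. 0) \<in> q ` realization ?L"
    using A(4) realization_mono[OF A(2)] collapse_map_eq_0_iff by (metis ex_in_conv image_eqI subsetD)
  have HW: "Hausdorff_space ?W"
  proof (rule Hausdorff_wedge_sum)
    fix i assume "i \<in> {..k}"
    show "Hausdorff_space (XX i)" by (simp add: XX_def nsphere_eq Hausdorff_space_subtopology)
    show "bb i \<in> topspace (XX i)" using zL nsphere_base_in by (simp add: XX_def bb_def nsphere_eq)
  qed
  have open_supp: "x \<in> open_simplex (\<phi> i) \<longleftrightarrow> x \<in> realization K \<and> {v. x v \<noteq> 0} = \<phi> i" if "i < k" for x i
  proof
    assume x: "x \<in> open_simplex (\<phi> i)"
    then have "x \<in> closed_simplex (\<phi> i)" by (simp add: open_simplex_def)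
    then show "x \<in> realization K \<and> {v. x v \<noteq> 0} = \<phi> i"
      using open_simplex_support[OF x] closed_simplex_sub_realization[OF K \<phi>K[OF that]] by blast
  next
    assume "x \<in> realization K \<and> {v. x v \<noteq> 0} = \<phi> i"
    then show "x \<in> open_simplex (\<phi> i)" using realization_open_simplex[of x K] by simp
  qed
  have L_iff: "x \<in> realization ?L \<longleftrightarrow> {v. x v \<noteq> 0} \<notin> F" if "x \<in> realization K" for x
    using that by (auto simp: realization_def)
  define T where "T i = (if i < k then closed_simplex (\<phi> i) else realization ?L)" for i
  define f where "f i x = ?\<pi> (i, if i < k then s i x else q x)" for i x
  have TK: "T i \<subseteq> realization K" for i
    using closed_simplex_sub_realization[OF K \<phi>K] realization_mono[of ?L K] by (auto simp: T_def)
  have cover: "realization K = (\<Union>i\<in>{..k}. T i)"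
  proof (intro equalityI subsetI)
    fix x assume x: "x \<in> realization K"
    show "x \<in> (\<Union>i\<in>{..k}. T i)"
    proof (cases "{v. x v \<noteq> 0} \<in> F")
      case True
      then obtain i where "i < k" "{v. x v \<noteq> 0} = \<phi> i" using \<phi> by (auto simp: bij_betw_def)
      then have "x \<in> T i" "i \<in> {..k}" using realization_mem_support(3)[OF x] by (auto simp: T_def)
      then show ?thesis by blast
    next
      case False
      then have "x \<in> T k" using L_iff[OF x] by (simp add: T_def)
      then show ?thesis by blast
    qed
  qed (use TK in blast)
  have on_bd: "f i x = ?\<pi> (k, \<lambda>_. 0)" if i: "i < k" and x: "x \<in> closed_simplex (\<phi> i)" "x \<notin> open_simplex (\<phi> i)" for i x
  proof -
    have "s i x = nsphere_base" using s(2)[OF i x(1)] x(2) by simp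
    then show ?thesis using i by (simp add: f_def wedge_class_eq_iff bb_def)
  qed
  have bdA: "x \<in> realization A" if i: "i < k" and x: "x \<in> closed_simplex (\<phi> i)" "x \<notin> open_simplex (\<phi> i)" for i x
  proof -
    have xK: "x \<in> realization K" using closed_simplex_sub_realization[OF K \<phi>K[OF i]] x by blast
    have "{v. x v \<noteq> 0} \<subset> \<phi> i"
      using closed_simplex_support(1)[OF \<phi>fin[OF i] x(1)] open_supp[OF i] xK x(2) by blast
    then have "{v. x v \<noteq> 0} \<in> A" using bd \<phi>F[OF i] by blast
    then show ?thesis using xK by (simp add: realization_def)
  qed
  \<comment> \<open>By maximality, the interior of a facet in \<open>F\<close> meets no other piece
    of the cover.\<close>
  have not_open: "x \<notin> open_simplex (\<phi> i)" if "i < k" "j \<le> k" "i \<noteq> j" "x \<in> T j" for i j x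
  proof
    assume "x \<in> open_simplex (\<phi> i)"
    then have x: "x \<in> realization K" "{v. x v \<noteq> 0} = \<phi> i" using open_supp[OF that(1)] by auto
    show False
    proof (cases "j < k")
      case True
      then have "\<phi> i \<subseteq> \<phi> j"
        using closed_simplex_support(1)[OF \<phi>fin[OF True], of x] that(4) x(2) by (simp add: T_def)
      then have "\<phi> j = \<phi> i" using max[OF \<phi>F[OF that(1)] \<phi>K[OF True]] by blast
      then show False using \<phi> True that(1,3) by (auto simp: bij_betw_def inj_on_def)
    next
      case False
      then have "x \<in> realization ?L" using that(4) by (simp add: T_def)
      then show False using L_iff[OF x(1)] x(2) \<phi>F[OF that(1)] by simp
    qed
  qed
  have agree: "f i x = f j x" if "i \<le> k" "j \<le> k" "x \<in> T i" "x \<in> T j" for i j x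
  proof -
    have base: "f i x = ?\<pi> (k, \<lambda>_. 0)" if "i \<le> k" "j \<le> k" "i \<noteq> j" "x \<in> T i" "x \<in> T j" for i j
    proof (cases "i < k")
      case True
      then show ?thesis using on_bd[OF True] not_open[OF True that(2,3,5)] that(4) by (simp add: T_def)
    next
      case False
      then have j: "i = k" "j < k" using that by auto
      then have "x \<in> realization A"
        using bdA[OF j(2)] not_open[OF j(2) that(1) _ that(4)] that(3,5) by (simp add: T_def)
      moreover have "x \<in> realization ?L" using that(4) j by (simp add: T_def)
      ultimately have "q x = (\<lambda>_. 0)" using collapse_map_eq_0_iff by simp
      then show ?thesis using j by (simp add: f_def)
    qed
    show ?thesis
    proof (cases "i = j")
      case False
      then show ?thesis using base[of i j] base[of j i] that by simp
    qed simp
  qed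
  have "\<exists>Q. continuous_map (top_of_set (realization K)) ?W Q \<and> (\<forall>i\<in>{..k}. \<forall>x\<in>T i. Q x = f i x)"
  proof (rule pasting_lemma_exists_closed[of "{..k}" "top_of_set (realization K)" T ?W f])
    show "topspace (top_of_set (realization K)) \<subseteq> \<Union>(T ` {..k})" using cover by simp
    fix i assume i: "i \<in> {..k}"
    have "closed (T i)"
      by (cases "i < k") (simp_all add: T_def closed_closed_simplex closed_realization[OF L])
    then show "closedin (top_of_set (realization K)) (T i)" using TK by (simp add: closed_subset)
    have T: "subtopology (top_of_set (realization K)) (T i) = top_of_set (T i)"
      using TK[of i] by (simp add: subtopology_subtopology Int_absorb1)
    have "continuous_map (top_of_set (T i)) (XX i) (\<lambda>x. if i < k then s i x else q x)"
      using s(1)[of i] continuous_on_collapse_map by (auto simp: T_def XX_def)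
    from continuous_map_compose[OF this continuous_map_wedge_class[OF i, of XX bb]]
    show "continuous_map (subtopology (top_of_set (realization K)) (T i)) ?W (f i)"
      unfolding T by (simp add: o_def f_def[abs_def])
  next
    fix i j x assume "i \<in> {..k}" "j \<in> {..k}" "x \<in> topspace (top_of_set (realization K)) \<inter> T i \<inter> T j"
    then show "f i x = f j x" using agree[of i j x] by simp
  next
    fix Q assume Q: "continuous_map (top_of_set (realization K)) ?W Q"
      "\<And>x i. i \<in> {..k} \<Longrightarrow> x \<in> topspace (top_of_set (realization K)) \<inter> T i \<Longrightarrow> Q x = f i x"
    have "Q x = f i x" if "i \<in> {..k}" "x \<in> T i" for i x using Q(2)[OF that(1), of x] that(2) TK[of i] by auto
    then show "\<exists>Q. continuous_map (top_of_set (realization K)) ?W Q \<and> (\<forall>i\<in>{..k}. \<forall>x\<in>T i. Q x = f i x)"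
      using Q(1) by blast
  qed simp
  then obtain Q where Q: "continuous_map (top_of_set (realization K)) ?W Q"
    and QT': "\<forall>i\<in>{..k}. \<forall>x\<in>T i. Q x = f i x" by blast
  have QT: "Q x = f i x" if "i \<le> k" "x \<in> T i" for x i
    using QT' that by simp
  have cases: "x \<in> realization ?L \<or> (\<exists>i<k. x \<in> open_simplex (\<phi> i))" if x: "x \<in> realization K" for x
  proof (cases "{v. x v \<noteq> 0} \<in> F")
    case True
    then obtain i where "i < k" "{v. x v \<noteq> 0} = \<phi> i" using \<phi> by (auto simp: bij_betw_def)
    then show ?thesis using open_supp x by blast
  qed (use L_iff[OF x] in simp)
  have QL: "Q x = ?\<pi> (k, q x)" if "x \<in> realization ?L" for x
    using QT[of k x] that by (simp add: T_def f_def)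
  have QO: "Q x = ?\<pi> (i, s i x)" "s i x \<noteq> nsphere_base" "x \<notin> realization ?L" "x \<notin> realization A"
    if "i < k" "x \<in> open_simplex (\<phi> i)" for x i
  proof -
    have x: "x \<in> closed_simplex (\<phi> i)" using that(2) by (simp add: open_simplex_def)
    show "Q x = ?\<pi> (i, s i x)" using QT[of i x] that x by (simp add: T_def f_def)
    show "s i x \<noteq> nsphere_base" using s(2)[OF that(1) x] that(2) by simp
    show "x \<notin> realization ?L" using open_supp[OF that(1), of x] that(2) L_iff \<phi>F[OF that(1)] by auto
    then show "x \<notin> realization A" using realization_mono[OF A(2)] by blast
  qed
  have fib: "Q x = Q y \<longleftrightarrow> x = y \<or> x \<in> realization A \<and> y \<in> realization A"
    if x: "x \<in> realization K" and y: "y \<in> realization K" for x y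
  proof -
    have LO: "Q x \<noteq> Q y" "x \<noteq> y" "y \<notin> realization A"
      if "x \<in> realization ?L" "i < k" "y \<in> open_simplex (\<phi> i)" for x y i
      using QO[OF that(2,3)] QL[OF that(1)] that(1,2) by (auto simp: wedge_class_eq_iff bb_def)
    consider "x \<in> realization ?L" "y \<in> realization ?L"
      | i where "x \<in> realization ?L" "i < k" "y \<in> open_simplex (\<phi> i)"
      | i where "y \<in> realization ?L" "i < k" "x \<in> open_simplex (\<phi> i)"
      | i j where "i < k" "x \<in> open_simplex (\<phi> i)" "j < k" "y \<in> open_simplex (\<phi> j)"
      using cases[OF x] cases[OF y] by blast
    then show ?thesis
    proof cases
      case 1
      then show ?thesis
        using collapse_map_eq_iff[OF 1] collapse_map_eq_0_iff[OF 1(1)] collapse_map_eq_0_iff[OF 1(2)]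
        by (auto simp: QL wedge_class_eq_iff bb_def)
    next
      case 2
      then show ?thesis using LO[of x i y] by blast
    next
      case 3
      then show ?thesis using LO[of y i x] by metis
    next
      case 4
      note Qx = QO[OF 4(1,2)] and Qy = QO[OF 4(3,4)]
      have "Q x = Q y \<longleftrightarrow> i = j \<and> s i x = s j y"
        using Qx(1,2) Qy(1,2) 4(1,3) by (auto simp: wedge_class_eq_iff bb_def)
      also have "\<dots> \<longleftrightarrow> x = y"
      proof
        assume "i = j \<and> s i x = s j y"
        then show "x = y" using inj_onD[OF s(3)[OF 4(1)]] 4 by metis
      next
        assume "x = y"
        then have "\<phi> i = \<phi> j" using 4 open_simplex_support by metis
        then have "i = j" using \<phi> 4(1,3) by (auto simp: bij_betw_def inj_on_def)
        then show "i = j \<and> s i x = s j y" using \<open>x = y\<close> by simp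
      qed
      finally show ?thesis using Qx(4) by blast
    qed
  qed
  have surj: "Q ` realization K = topspace ?W"
  proof (intro equalityI subsetI)
    fix v assume "v \<in> Q ` realization K"
    then show "v \<in> topspace ?W" using continuous_map_image_subset_topspace[OF Q] by auto
  next
    fix v assume "v \<in> topspace ?W"
    then have "v \<in> ?\<pi> ` topspace (sum_topology XX {..k})"
      using quotient_imp_surjective_map[OF quotient_map_wedge_class, of bb "{..k}" XX] by simp
    then obtain i a where ia: "i \<le> k" "a \<in> topspace (XX i)" "v = ?\<pi> (i, a)" by auto
    have L_in: "?\<pi> (k, q x) \<in> Q ` realization K" if "x \<in> realization ?L" for x
      using QL[OF that] realization_mono[of ?L K] that by (metis Diff_subset image_eqI subsetD)
    show "v \<in> Q ` realization K"
    proof (cases "i < k")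
      case False
      then have "i = k" "a \<in> q ` realization ?L" using ia by (auto simp: XX_def)
      then show ?thesis using ia(3) L_in by auto
    next
      case True
      then have a: "a \<in> sphere_set d" using ia(2) by (simp add: XX_def nsphere_eq)
      show ?thesis
      proof (cases "a = nsphere_base")
        case base: True
        then have "v = ?\<pi> (k, \<lambda>_. 0)" using True ia(3) by (simp add: wedge_class_eq_iff bb_def)
        moreover obtain x where "x \<in> realization ?L" "q x = (\<lambda>_. 0)" using zL by (metis imageE)
        ultimately show ?thesis using L_in by metis
      next
        case False
        then obtain x where "x \<in> open_simplex (\<phi> i)" "s i x = a" using s(4)[OF True a] by blast
        then have "v = Q x" "x \<in> realization K" using QO(1)[OF True] ia(3) open_supp[OF True] by auto
        then show ?thesis by blast
      qed
    qed
  qed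
  have AK: "A \<subseteq> K" using A(2) by blast
  show ?thesis
    unfolding W
  proof (rule homotopy_equivalent_collapse_contractible_subcomplex[OF K A(1) AK A(3,4) con HW])
    show "continuous_map (geometric_realization K) ?W Q" using Q by (simp add: geometric_realization_eq)
  qed (use surj fib in blast)+
qed

section \<open>The homotopy type of the Stirling complex\<close>

theorem theorem5p5:
  shows "(\<forall>n::nat. n \<ge> 1 \<longrightarrow>
            (\<exists>(Y :: (nat \<Rightarrow> real) topology) E dm e0.
               cw_complex Y E dm \<and> e0 \<in> E \<and> dm e0 = 0 \<and>
               (\<forall>e\<in>E - {e0}. \<lceil>real n / 2\<rceil> - 1 \<le> int (dm e) \<and> int (dm e) \<le> int n - 2) \<and>
               geometric_realization (stirling_complex n) homotopy_equivalent_space Y)) \<and>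
         (\<forall>n::nat. n \<ge> 1 \<longrightarrow>
            (\<exists>(X :: (nat \<Rightarrow> real) topology) x0.
               x0 \<in> topspace X \<and> k_connected_space (n - 1) X \<and>
               geometric_realization (stirling_complex (2 * n)) homotopy_equivalent_space
                 wedge_of_spheres_with (fact n) (n - 1) X x0))"
proof (intro conjI allI impI)
  fix n :: nat assume n: "1 \<le> n"
  \<comment> \<open>This is the largest k with 2 * k < n, and k + 1 is the ceiling of n / 2. Faces
    outside the core have at least k + 1 vertices, so their dimension is at least k.\<close>
  obtain k where k: "k = (n - 1) div 2" by blast
  let ?K = "stirling_complex n" and ?A = "stirling_core n k"
  note core = stirling_core[OF n, of k]
  have AK: "?A \<subseteq> ?K" using stirling_coreD(1)[OF _ n] by blast
  interpret subcomplex_pair ?K ?A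
    by unfold_locales (use finite_complex_stirling core AK in auto)
  have dims: "\<lceil>real n / 2\<rceil> - 1 \<le> int (cell_dim e) \<and> int (cell_dim e) \<le> int n - 2"
    if e: "e \<in> cells - {{\<lambda>_. 0}}" for e
  proof -
    have "e \<in> open_cell ` (?K - ?A)" using e unfolding cells_def by blast
    then obtain \<sigma> where \<sigma>: "\<sigma> \<in> ?K - ?A" "e = open_cell \<sigma>" by blast
    have "2 * k < n" using n k by linarith
    then have "k < card \<sigma>" "card \<sigma> < n"
      using stirling_core_complement[OF n _ \<sigma>(1)] by auto
    moreover have "cell_dim e = card \<sigma> - 1" using cell_dim_open_cell[OF \<sigma>(1)] \<sigma>(2) by simp
    ultimately have "int k \<le> int (cell_dim e)" "int (cell_dim e) \<le> int n - 2" by auto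
    moreover have "\<lceil>real n / 2\<rceil> \<le> int k + 1"
    proof -
      have "n \<le> 2 * k + 2" using k by linarith
      then have "real n / 2 \<le> real k + 1" by linarith
      then show ?thesis by (simp add: ceiling_le_iff)
    qed
    ultimately show ?thesis by linarith
  qed
  show "\<exists>(Y :: (nat \<Rightarrow> real) topology) E dm e0.
       cw_complex Y E dm \<and> e0 \<in> E \<and> dm e0 = 0 \<and>
       (\<forall>e\<in>E - {e0}. \<lceil>real n / 2\<rceil> - 1 \<le> int (dm e) \<and> int (dm e) \<le> int n - 2) \<and>
       geometric_realization ?K homotopy_equivalent_space Y"
    using cw_complex_quotient dims homotopy_equivalent_collapse_map[OF core(4)]
    by (intro exI[of _ "top_of_set (q ` realization ?K)"] exI[of _ cells] exI[of _ cell_dim]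
        exI[of _ "{\<lambda>_. 0}"]) (auto simp: cells_def cell_dim_def)
next
  fix n :: nat assume n: "1 \<le> n"
  let ?K = "stirling_complex (2 * n)" and ?F = "square_facets n"
  let ?L = "?K - ?F"
  from stirling_core_even[OF n] obtain A where core:
    "finite_complex A \<and> {} \<in> A \<and> A \<subseteq> ?L \<and> realization A \<noteq> {} \<and>
      contractible_space (geometric_realization A) \<and> (\<forall>\<sigma>\<in>?L. card \<sigma> \<le> n \<longrightarrow> \<sigma> \<in> A) \<and>
      (\<forall>\<sigma>\<in>?F. \<forall>\<rho>. \<rho> \<subset> \<sigma> \<longrightarrow> \<rho> \<in> A)" ..
  then have A: "finite_complex A" "{} \<in> A" "A \<subseteq> ?L" "realization A \<noteq> {}"
    "contractible_space (geometric_realization A)"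
    and skel: "\<forall>\<sigma>\<in>?L. card \<sigma> \<le> n \<longrightarrow> \<sigma> \<in> A" and bd: "\<forall>\<sigma>\<in>?F. \<forall>\<rho>. \<rho> \<subset> \<sigma> \<longrightarrow> \<rho> \<in> A"
    by simp_all
  have FK: "?F \<subseteq> ?K" by (auto simp: square_facets_def)
  have L: "finite_complex ?L"
    \<comment> \<open>Removing the square facets leaves a complex because they are maximal
      faces.\<close>
    unfolding finite_complex_def
  proof (intro conjI ballI subsetI)
    fix \<sigma> \<rho> assume \<sigma>: "\<sigma> \<in> ?L" and "\<rho> \<in> Pow \<sigma>"
    then have "\<rho> \<in> ?K" using finite_complexD(3)[OF finite_complex_stirling, of \<sigma> "2 * n" \<rho>] by blast
    moreover have "\<rho> \<notin> ?F" using square_facets_maximal[of \<rho> n \<sigma>] \<sigma> \<open>\<rho> \<in> Pow \<sigma>\<close> by blast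
    ultimately show "\<rho> \<in> ?L" by blast
  qed (use finite_complexD[OF finite_complex_stirling[of "2 * n"]] in auto)
  interpret subcomplex_pair ?L A by unfold_locales (use L A in auto)
  let ?X = "top_of_set (q ` realization ?L)"
  have eq: "geometric_realization ?L homotopy_equivalent_space ?X"
    by (rule homotopy_equivalent_collapse_map[OF A(5)])
  have x0: "(\<lambda>_. 0) \<in> topspace ?X"
    using Union_cells by (auto simp: cells_def)
  have "k_connected_space (n - 1) ?X"
  proof (rule k_connected_spaceI)
    show "topspace ?X \<noteq> {}" using x0 by blast
    fix i f assume i: "i \<le> n - 1" and f: "continuous_map (nsphere i) ?X f"
    show "\<exists>c. homotopic_with (\<lambda>_. True) (nsphere i) ?X f (\<lambda>_. c)"
    proof (rule nullhomotopic_homotopy_equivalent[OF eq _ f])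
      \<comment> \<open>A face with at most i + 1 vertices has at most n of them, because i \<le> n
        - 1 and n is positive; so the i-skeleton lies in the contractible \<open>A\<close>.\<close>
      fix g assume "continuous_map (nsphere i) (geometric_realization ?L) g"
      then show "\<exists>c. homotopic_with (\<lambda>_. True) (nsphere i) (geometric_realization ?L) g (\<lambda>_. c)"
        using skel i n by (intro sphere_map_nullhomotopic[OF L A(1,3,5)]) auto
    qed
  qed
  moreover have "geometric_realization ?K homotopy_equivalent_space
      wedge_of_spheres_with (fact n) (n - 1) ?X (\<lambda>_. 0)"
    by (rule realization_homotopy_equivalent_wedge[OF finite_complex_stirling L FK A(1,3,2,4,5) card_square_facets])
      (use square_facets_maximal square_facetsD(2) bd n in auto)
  ultimately show "\<exists>(X :: (nat \<Rightarrow> real) topology) x0. x0 \<in> topspace X \<and> k_connected_space (n - 1) X \<and>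
      geometric_realization ?K homotopy_equivalent_space wedge_of_spheres_with (fact n) (n - 1) X x0"
    using x0 by blast
qed

end
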